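(* Let $H$ be a Hopf algebra with invertible antipode over a field $\Bbbk$, equipped with a Woronowicz differential calculus $(\Omega^\bullet,\wedge,\mathrm d)$ such that $\Omega^1$ is finitely generated as a right $H$-module and $\overline\sigma^{\mathcal W}_{\Omega^1,\Omega^1}$ is diagonalisable with $1$ among its eigenvalues. Let $\mathbf g$ be an arbitrary metric and $f\in H$ an invertible element. If $\Phi_{\mathbf g}\colon\mathrm{Hom}_H(\Omega^1,\Omega^1\vee\Omega^1)\to\mathrm{Hom}_H(\Omega^1\vee\Omega^1,\Omega^1)$ is invertible, with corresponding (unique) Levi-Civita connection $\nabla^{\mathrm{LC}}$ of $\mathbf g$, then $$\nabla'^{\,\mathrm{LC}}=\nabla^{\mathrm{LC}}+\Phi_{\mathbf g}^{-1}\Big(f^{-1}\mathrm df\,\langle\mathbf g,\cdot\otimes_H\cdot\rangle\big|_{\Omega^1\vee\Omega^1}\Big)$$ is the unique Levi-Civita connection of the metric $\mathbf g':=f\mathbf g$.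
   Context: Hopf algebra notation: $\otimes=\otimes_\Bbbk$, $\Delta(h)=h_1\otimes h_2$, $\overline S=S^{-1}$; right/left coactions $m\mapsto m_0\otimes m_1$, $m\mapsto m_{-1}\otimes m_0$, iterated in Sweedler notation. A bicovariant bimodule is an $H$-bimodule $M$ with commuting right and left coactions $\delta_M,\lambda_M$ satisfying $\delta_M(amb)=\Delta(a)\delta_M(m)\Delta(b)$, $\lambda_M(amb)=\Delta(a)\lambda_M(m)\Delta(b)$; $M\otimes_HN$ is one with diagonal coactions. The Woronowicz braiding is $\sigma^{\mathcal W}_{M,N}\colon M\otimes_HN\to N\otimes_HM$, $m\otimes_Hn\mapsto m_{-2}n_0S(n_1)\otimes_HS(m_{-1})m_0n_2$, an isomorphism of bicovariant bimodules; its inverse is denoted $\overline\sigma^{\mathcal W}_{N,M}\colon N\otimes_HM\to M\otimes_HN$. Subscripts $12,23$ indicate the tensor factors acted on. Calculus: a differential calculus on $H$ is a differential graded algebra $(\Omega^\bullet,\wedge,\mathrm d)$ with $\Omega^0=H$ and $\Omega^k$ spanned by $a^0\mathrm da^1\wedge\dots\wedge\mathrm da^k$; it is bicovariant if $\Omega^\bullet$ is a graded $H$-bicomodule algebra (extending $\Delta$ on $H$) with $\mathrm d$ bicolinear. It is a Woronowicz calculus if $\Omega^\bullet$ is the braided exterior algebra of $\Omega^1$, i.e. the tensor algebra of $\Omega^1$ over $H$ modulo in each degree $n$ the kernel of $A_n=\sum_{p}\mathrm{sign}(p)\Pi_p$, where $\Pi_p$ is obtained from a reduced decomposition of the permutation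 $p$ into nearest neighbour transpositions by replacing each transposition by $\overline\sigma^{\mathcal W}_{\Omega^1,\Omega^1}$ on the corresponding neighbours. In particular $\Omega^2\cong\mathrm{Im}(\mathrm{id}-\overline\sigma^{\mathcal W}_{\Omega^1,\Omega^1})$ with $\wedge=\mathrm{id}-\overline\sigma^{\mathcal W}_{\Omega^1,\Omega^1}$ on $\Omega^1\otimes_H\Omega^1$. Symmetric tensors: $\Omega^1\vee\Omega^1\subseteq\Omega^1\otimes_H\Omega^1$ is the eigenspace of $\overline\sigma^{\mathcal W}_{\Omega^1,\Omega^1}$ for eigenvalue $1$, $\Omega^1\wedge\Omega^1$ is the sum of the other eigenspaces, and $\pi_\vee\colon\Omega^1\otimes_H\Omega^1\to\Omega^1\vee\Omega^1$ is the projection along $\Omega^1\wedge\Omega^1$. $\mathfrak X=\mathrm{Hom}_H(\Omega^1,H)$ (right $H$-linear maps) is a bicovariant bimodule with $(aXb)(\omega)=aX(b\omega)$, $X_0(\omega)\otimes X_1=X(\omega_0)_0\otimes X(\omega_0)_1S(\omega_1)$, $X_{-1}\otimes X_0(\omega)=X(\omega_0)_{-1}\overline S(\omega_{-1})\otimes X(\omega_0)_0$; $\langle X,\omega\rangle=X(\omega)$. $\mathfrak X^{\vee2}=\{\mathbf g\in\mathfrak X\otimes_H\mathfrak X:\sigma^{\mathcal W}_{\mathfrak X,\mathfrak X}(\mathbf g)=\mathbf g\}$. Metrics: for $\mathbf g=\mathbf g^{a}\otimes_H\mathbf g_{a}\in\mathfrak X\otimes_H\mathfrak X$ (finite sum)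 put $\langle\mathbf g,\omega\otimes_H\eta\rangle=\langle\mathbf g^a\langle\mathbf g_a,\omega\rangle,\eta\rangle\in H$ and $\langle\mathbf g,\omega\otimes_H\eta\otimes_H\rho\rangle=\langle\mathbf g,\omega\otimes_H\eta\rangle\rho\in\Omega^1$. $\mathbf g$ is a (pseudo-Riemannian) metric if $\mathbf g\in\mathfrak X^{\vee2}$ and $\mathbf g^\sharp=\mathbf g^a\langle\mathbf g_a,\cdot\rangle\colon\Omega^1\to\mathfrak X$ is an isomorphism of right $H$-modules. If $\mathbf g$ is a metric and $f\in H$ is invertible, $f\mathbf g$ is again a metric. Connections: a right connection on a right $H$-module $M$ is a linear $\nabla\colon M\to M\otimes_H\Omega^1$ with $\nabla(ma)=\nabla(m)a+m\otimes_H\mathrm da$. For a right connection or right $H$-linear map $\phi\colon\Omega^1\to\Omega^1\otimes_H\Omega^1$, the prescription $\phi_{-1}\otimes\phi_0(m)=\phi(m_0)_{-1}\overline S(m_{-1})\otimes\phi(m_0)_0$ defines an element $\phi_{-1}\otimes\phi_0\in H\otimes\mathrm{Hom}_\Bbbk(\Omega^1,\Omega^1\otimes_H\Omega^1)$, with iteration $\phi_{-2}\otimes\phi_{-1}\otimes\phi_0$, and one defines $\phi\oplus\phi\colon\Omega^1\otimes_H\Omega^1\to\Omega^1\otimes_H\Omega^1\otimes_H\Omega^1$ by $(\phi\oplus\phi)(m\otimes_Hn)=\sigma^{\mathcal W}_{23}(\phi(m_0S(m_1))\otimes_Hm_2n)+\phi_{-2}m_0S(\phi_{-1}m_1)\otimes_H\phi_0(m_2n)$.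 If $\phi$ is a connection, $\phi\oplus\phi$ is a right connection; if $\phi$ is right $H$-linear so is $\phi\oplus\phi$. Put $\phi_\vee=(\pi_\vee\otimes_H\mathrm{id}_{\Omega^1})\circ(\phi\oplus\phi)|_{\Omega^1\vee\Omega^1}$. A right connection $\nabla$ on $\Omega^1$ is compatible with a metric $\mathbf g$ if $\langle\mathbf g,\nabla_\vee(\cdot)\rangle=\mathrm d\circ\langle\mathbf g,\cdot\rangle$ as maps $\Omega^1\vee\Omega^1\to\Omega^1$; it is torsion-free if $\wedge\circ\nabla+\mathrm d=0\colon\Omega^1\to\Omega^2$; it is a Levi-Civita connection for $\mathbf g$ if it is torsion-free and compatible with $\mathbf g$. The map $\Phi_{\mathbf g}$ is $\Phi_{\mathbf g}(\phi)=\langle\mathbf g,\cdot\otimes_H\cdot\rangle\circ\phi_\vee$ for right $H$-linear $\phi\colon\Omega^1\to\Omega^1\vee\Omega^1\subseteq\Omega^1\otimes_H\Omega^1$ (with $\langle\mathbf g,\cdot\rangle$ pairing the first two of three factors). If $\Phi_{\mathbf g}$ is invertible, $\mathbf g$ has a unique Levi-Civita connection. *)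

theory Defs
  imports
    Complex_Main
    "HOL-Library.Poly_Mapping"
    "HOL-Library.Function_Algebras"
    "HOL-Combinatorics.Permutations"
begin

text \<open>
  Everything happens over a ground field \<open>'k\<close>. The type \<open>'x \<Rightarrow>\<^sub>0 'k\<close> is the free vector space on \<open>'x\<close>;
  tensor products are quotients of such spaces.
  A map whose domain is a proper subset \<open>A\<close> of a type is represented by a total function that is
  \<open>0\<close> outside \<open>A\<close>, so that equality of representing functions is equality of maps and the pointwise
  operations are the operations on maps.
\<close>

section \<open>Free vector spaces and quotients\<close>

definition fscale :: "'k::field \<Rightarrow> ('x \<Rightarrow>\<^sub>0 'k) \<Rightarrow> ('x \<Rightarrow>\<^sub>0 'k)" where
  "fscale c t = Poly_Mapping.map ((*) c) t"

lemma lookup_fscale [simp]: "Poly_Mapping.lookup (fscale c t) x = c * Poly_Mapping.lookup t x"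
  unfolding fscale_def by transfer (auto simp: when_def)

lemma vector_space_fscale: "vector_space (fscale :: 'k::field \<Rightarrow> ('x \<Rightarrow>\<^sub>0 'k) \<Rightarrow> _)"
  by (rule vector_space.intro) (auto intro!: poly_mapping_eqI simp: lookup_add algebra_simps)

text \<open>
  The linear extension of \<open>F\<close> to formal sums. On an element \<open>t = \<Sum> a \<otimes> b\<close> of a tensor product, the
  value \<open>lsum s t (\<lambda>(a, b). F a b)\<close> is \<open>\<Sum> F a b\<close> whenever \<open>F\<close> respects the defining relations of the
  tensor product; this is how Sweedler notation is written below.
\<close>

definition lsum :: "('k::field \<Rightarrow> 'v \<Rightarrow> 'v::ab_group_add) \<Rightarrow> ('x \<Rightarrow>\<^sub>0 'k) \<Rightarrow> ('x \<Rightarrow> 'v) \<Rightarrow> 'v" where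
  "lsum s t F = (\<Sum>x\<in>Poly_Mapping.keys t. s (Poly_Mapping.lookup t x) (F x))"

abbreviation "fspan \<equiv> module.span fscale"

abbreviation gen :: "'x \<Rightarrow> ('x \<Rightarrow>\<^sub>0 'k::field)" where
  "gen x \<equiv> Poly_Mapping.single x 1"

text \<open>
  The quotient of a free vector space by the span of \<open>R\<close> is realised as the range of a linear map
  \<open>p\<close> with kernel the span of \<open>R\<close> and \<open>p t \<equiv> t\<close> modulo that span: \<open>p\<close> sends each
  element to a chosen representative of its class, linearly in the class. So the elements of the quotient
  are formal sums themselves, and addition and scaling in the quotient are those of the free space.
\<close>

definition is_quot_proj :: "('x \<Rightarrow>\<^sub>0 'k::field) set \<Rightarrow> (('x \<Rightarrow>\<^sub>0 'k) \<Rightarrow> ('x \<Rightarrow>\<^sub>0 'k)) \<Rightarrow> bool" where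
  "is_quot_proj R p \<longleftrightarrow> Vector_Spaces.linear fscale fscale p \<and>
     (\<forall>t. p t = 0 \<longleftrightarrow> t \<in> fspan R) \<and> (\<forall>t. p t - t \<in> fspan R)"

definition quot_proj :: "('x \<Rightarrow>\<^sub>0 'k::field) set \<Rightarrow> ('x \<Rightarrow>\<^sub>0 'k) \<Rightarrow> ('x \<Rightarrow>\<^sub>0 'k)" where
  "quot_proj R = (SOME p. is_quot_proj R p)"

lemma is_quot_proj_quot_proj:
  fixes R :: "('x \<Rightarrow>\<^sub>0 'k::field) set"
  shows "is_quot_proj R (quot_proj R)"
proof -
  interpret V: vector_space "fscale :: 'k \<Rightarrow> ('x \<Rightarrow>\<^sub>0 'k) \<Rightarrow> _" by (rule vector_space_fscale)
  interpret VV: vector_space_pair "fscale :: 'k \<Rightarrow> ('x \<Rightarrow>\<^sub>0 'k) \<Rightarrow> _" fscale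
    by (intro vector_space_pair.intro vector_space_fscale)
  obtain B where B: "B \<subseteq> V.span R" "V.independent B" "V.span R \<subseteq> V.span B"
    using V.maximal_independent_subset by blast
  have spanB: "V.span B = V.span R"
    using B V.span_minimal[OF B(1)] by auto
  define C where "C = V.extend_basis B"
  have C: "B \<subseteq> C" "V.independent C" "V.span C = UNIV"
    unfolding C_def using V.extend_basis_superset V.independent_extend_basis V.span_extend_basis B(2)
    by blast+
  define p where "p = VV.construct C (\<lambda>b. if b \<in> B then 0 else b)"
  have lin: "Vector_Spaces.linear fscale fscale p"
    unfolding p_def by (rule VV.linear_construct[OF C(2)])
  interpret p: Vector_Spaces.linear fscale fscale p by (rule lin)
  have pb: "p b = (if b \<in> B then 0 else b)" if "b \<in> C" for b
    unfolding p_def using VV.construct_basis[OF C(2) that] .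
  have diff: "p t - t \<in> V.span R" for t
  proof -
    have "t \<in> V.span C" using C(3) by simp
    then show ?thesis
    proof (induction rule: V.span_induct_alt)
      case base then show ?case by (simp add: V.span_zero)
    next
      case (step c b t)
      have "p b - b \<in> V.span R"
        using pb[OF step(1)] B(1) by (auto intro: V.span_zero V.span_neg)
      then have "fscale c (p b - b) + (p t - t) \<in> V.span R"
        using step(2) by (intro V.span_add V.span_scale)
      then show ?case by (simp add: p.add p.scale V.scale_right_diff_distrib algebra_simps)
    qed
  qed
  have ker: "p t = 0 \<longleftrightarrow> t \<in> V.span R" for t
  proof
    assume "p t = 0"
    then have "- t \<in> V.span R" using diff[of t] by simp
    then show "t \<in> V.span R" using V.span_neg[of "- t" R] by simp
  next
    assume "t \<in> V.span R"
    then have "t \<in> V.span B" using spanB by simp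
    then show "p t = 0"
      by (induction rule: V.span_induct_alt) (use pb C(1) in \<open>auto simp: p.add p.scale\<close>)
  qed
  have "is_quot_proj R p" unfolding is_quot_proj_def using lin ker diff by blast
  then show ?thesis unfolding quot_proj_def by (rule someI[of "is_quot_proj R"])
qed

text \<open>The universal property: a linear map killing the relations factors through the quotient.\<close>

lemma quot_proj_factor:
  assumes "Vector_Spaces.linear fscale s G" and "\<And>r. r \<in> R \<Longrightarrow> G r = 0"
  shows "G (quot_proj R t) = G t"
proof -
  interpret G: Vector_Spaces.linear fscale s G by fact
  have "quot_proj R t - t \<in> G.vs1.span R"
    using is_quot_proj_quot_proj[of R] by (simp add: is_quot_proj_def)
  then have "G (quot_proj R t - t) = 0"
    using assms(2) by (rule G.eq_0_on_span[rotated])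
  then show ?thesis by (simp add: G.diff)
qed

section \<open>Tensor products over the ground field\<close>

text \<open>
  A vector space is given by a scaling and a subspace of a type. The pairs \<open>(a, b)\<close> occurring in an
  element of \<open>V \<otimes> W\<close> (as a formal sum) always have \<open>a\<close> in \<open>V\<close> and \<open>b\<close> in \<open>W\<close>.
\<close>

type_synonym ('k, 'v) vspace = "('k \<Rightarrow> 'v \<Rightarrow> 'v) \<times> 'v set"

definition ktens_rels :: "('k::field, 'a::ab_group_add) vspace \<Rightarrow> ('k, 'b::ab_group_add) vspace \<Rightarrow> ('a \<times> 'b \<Rightarrow>\<^sub>0 'k) set" where
  "ktens_rels V W =
     {gen (a + a', b) - gen (a, b) - gen (a', b) | a a' b. a \<in> snd V \<and> a' \<in> snd V \<and> b \<in> snd W} \<union>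
     {gen (a, b + b') - gen (a, b) - gen (a, b') | a b b'. a \<in> snd V \<and> b \<in> snd W \<and> b' \<in> snd W} \<union>
     {gen (fst V c a, b) - fscale c (gen (a, b)) | c a b. a \<in> snd V \<and> b \<in> snd W} \<union>
     {gen (a, fst W c b) - fscale c (gen (a, b)) | c a b. a \<in> snd V \<and> b \<in> snd W}"

definition ktens :: "('k::field, 'a::ab_group_add) vspace \<Rightarrow> ('k, 'b::ab_group_add) vspace \<Rightarrow> 'a \<Rightarrow> 'b \<Rightarrow> ('a \<times> 'b \<Rightarrow>\<^sub>0 'k)" where
  "ktens V W a b = quot_proj (ktens_rels V W) (gen (a, b))"

definition ktensor :: "('k::field, 'a::ab_group_add) vspace \<Rightarrow> ('k, 'b::ab_group_add) vspace \<Rightarrow> ('k, 'a \<times> 'b \<Rightarrow>\<^sub>0 'k) vspace" where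
  "ktensor V W = (fscale, fspan {ktens V W a b | a b. a \<in> snd V \<and> b \<in> snd W})"

definition linear_map :: "('k, 'a::ab_group_add) vspace \<Rightarrow> ('k, 'b::ab_group_add) vspace \<Rightarrow> ('a \<Rightarrow> 'b) \<Rightarrow> bool" where
  "linear_map V W \<phi> \<longleftrightarrow> (\<forall>x\<in>snd V. \<phi> x \<in> snd W) \<and>
     (\<forall>x\<in>snd V. \<forall>y\<in>snd V. \<phi> (x + y) = \<phi> x + \<phi> y) \<and>
     (\<forall>c. \<forall>x\<in>snd V. \<phi> (fst V c x) = fst W c (\<phi> x))"

section \<open>Hopf algebras\<close>

record (overloaded) ('k::zero, 'h) hopf =
  hscale :: "'k \<Rightarrow> 'h \<Rightarrow> 'h"
  comult :: "'h \<Rightarrow> ('h \<times> 'h \<Rightarrow>\<^sub>0 'k)"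
  counit :: "'h \<Rightarrow> 'k"
  antip :: "'h \<Rightarrow> 'h"

abbreviation hsp :: "('k::field, 'h::ring_1) hopf \<Rightarrow> ('k, 'h) vspace" where
  "hsp H \<equiv> (hscale H, UNIV)"

abbreviation hhsp :: "('k::field, 'h::ring_1) hopf \<Rightarrow> ('k, 'h \<times> 'h \<Rightarrow>\<^sub>0 'k) vspace" where
  "hhsp H \<equiv> ktensor (hsp H) (hsp H)"

abbreviation htH :: "('k::field, 'h::ring_1) hopf \<Rightarrow> 'h \<Rightarrow> 'h \<Rightarrow> ('h \<times> 'h \<Rightarrow>\<^sub>0 'k)" where
  "htH H \<equiv> ktens (hsp H) (hsp H)"

definition algebra_over :: "('k::field \<Rightarrow> 'a \<Rightarrow> 'a::ring_1) \<Rightarrow> bool" where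
  "algebra_over s \<longleftrightarrow> vector_space s \<and> (\<forall>c a b. s c (a * b) = s c a * b \<and> s c (a * b) = a * s c b)"

definition hopf_algebra :: "('k::field, 'h::ring_1) hopf \<Rightarrow> bool" where
  "hopf_algebra H \<longleftrightarrow>
     algebra_over (hscale H) \<and>
     linear_map (hsp H) (hhsp H) (comult H) \<and>
     (\<forall>a. lsum fscale (comult H a) (\<lambda>(a1, a2). lsum fscale (comult H a1) (\<lambda>(b1, b2).
             ktens (hsp H) (hhsp H) b1 (htH H b2 a2)))
        = lsum fscale (comult H a) (\<lambda>(a1, a2). lsum fscale (comult H a2) (\<lambda>(b1, b2).
             ktens (hsp H) (hhsp H) a1 (htH H b1 b2)))) \<and>
     comult H 1 = htH H 1 1 \<and>
     (\<forall>a b. comult H (a * b) = lsum fscale (comult H a) (\<lambda>(a1, a2).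
             lsum fscale (comult H b) (\<lambda>(b1, b2). htH H (a1 * b1) (a2 * b2)))) \<and>
     Vector_Spaces.linear (hscale H) (*) (counit H) \<and>
     counit H 1 = 1 \<and> (\<forall>a b. counit H (a * b) = counit H a * counit H b) \<and>
     (\<forall>a. lsum (hscale H) (comult H a) (\<lambda>(a1, a2). hscale H (counit H a1) a2) = a) \<and>
     (\<forall>a. lsum (hscale H) (comult H a) (\<lambda>(a1, a2). hscale H (counit H a2) a1) = a) \<and>
     Vector_Spaces.linear (hscale H) (hscale H) (antip H) \<and>
     (\<forall>a. lsum (hscale H) (comult H a) (\<lambda>(a1, a2). antip H a1 * a2) = hscale H (counit H a) 1) \<and>
     (\<forall>a. lsum (hscale H) (comult H a) (\<lambda>(a1, a2). a1 * antip H a2) = hscale H (counit H a) 1)"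

section \<open>Bicovariant bimodules and their tensor powers\<close>

text \<open>
  The data of a bicovariant bimodule with underlying space \<open>carr M\<close>; the left and right coactions
  take values in \<open>H \<otimes> carr M\<close> and \<open>carr M \<otimes> H\<close>.
\<close>

record (overloaded) ('k::zero, 'h, 'm) bimod =
  carr :: "'m set"
  bscale :: "'k \<Rightarrow> 'm \<Rightarrow> 'm"
  lact :: "'h \<Rightarrow> 'm \<Rightarrow> 'm"
  ract :: "'m \<Rightarrow> 'h \<Rightarrow> 'm"
  lcoact :: "'m \<Rightarrow> ('h \<times> 'm \<Rightarrow>\<^sub>0 'k)"
  rcoact :: "'m \<Rightarrow> ('m \<times> 'h \<Rightarrow>\<^sub>0 'k)"

text \<open>
  The \<open>n\<close>-fold tensor power of \<open>M\<close> over \<open>H\<close> is spanned by the classes \<open>htens M [x\<^sub>1, \<dots>, x\<^sub>n]\<close> of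
  lists of elements of \<open>carr M\<close>, subject to multilinearity and to \<open>x\<^sub>i h \<otimes> x\<^sub>i\<^sub>+\<^sub>1 = x\<^sub>i \<otimes> h x\<^sub>i\<^sub>+\<^sub>1\<close>.
  For \<open>n = 0\<close> this gives \<open>'k\<close> instead of \<open>H\<close>; only \<open>n \<ge> 1\<close> is used.
\<close>

definition htens_rels :: "('k::field, 'h, 'm::ab_group_add) bimod \<Rightarrow> nat \<Rightarrow> ('m list \<Rightarrow>\<^sub>0 'k) set" where
  "htens_rels M n =
     {gen (us @ [x + y] @ vs) - gen (us @ [x] @ vs) - gen (us @ [y] @ vs) | us vs x y.
        set (us @ [x, y] @ vs) \<subseteq> carr M \<and> length us + 1 + length vs = n} \<union>
     {gen (us @ [bscale M c x] @ vs) - fscale c (gen (us @ [x] @ vs)) | us vs c x.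
        set (us @ [x] @ vs) \<subseteq> carr M \<and> length us + 1 + length vs = n} \<union>
     {gen (us @ [ract M x h, y] @ vs) - gen (us @ [x, lact M h y] @ vs) | us vs x h y.
        set (us @ [x, y] @ vs) \<subseteq> carr M \<and> length us + 2 + length vs = n}"

definition htens :: "('k::field, 'h, 'm::ab_group_add) bimod \<Rightarrow> 'm list \<Rightarrow> ('m list \<Rightarrow>\<^sub>0 'k)" where
  "htens M xs = quot_proj (htens_rels M (length xs)) (gen xs)"

definition htpow :: "('k::field, 'h, 'm::ab_group_add) bimod \<Rightarrow> nat \<Rightarrow> ('m list \<Rightarrow>\<^sub>0 'k) set" where
  "htpow M n = fspan {htens M xs | xs. set xs \<subseteq> carr M \<and> length xs = n}"

abbreviation htsp :: "('k::field, 'h, 'm::ab_group_add) bimod \<Rightarrow> nat \<Rightarrow> ('k, 'm list \<Rightarrow>\<^sub>0 'k) vspace" where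
  "htsp M n \<equiv> (fscale, htpow M n)"

definition hconc :: "('k::field, 'h, 'm::ab_group_add) bimod \<Rightarrow> ('m list \<Rightarrow>\<^sub>0 'k) \<Rightarrow> ('m list \<Rightarrow>\<^sub>0 'k) \<Rightarrow> ('m list \<Rightarrow>\<^sub>0 'k)" where
  "hconc M s t = lsum fscale s (\<lambda>xs. lsum fscale t (\<lambda>ys. htens M (xs @ ys)))"

definition ht_lact :: "('k::field, 'h, 'm::ab_group_add) bimod \<Rightarrow> 'h \<Rightarrow> ('m list \<Rightarrow>\<^sub>0 'k) \<Rightarrow> ('m list \<Rightarrow>\<^sub>0 'k)" where
  "ht_lact M h t = lsum fscale t (\<lambda>xs. htens M (lact M h (hd xs) # tl xs))"

definition ht_ract :: "('k::field, 'h, 'm::ab_group_add) bimod \<Rightarrow> ('m list \<Rightarrow>\<^sub>0 'k) \<Rightarrow> 'h \<Rightarrow> ('m list \<Rightarrow>\<^sub>0 'k)" where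
  "ht_ract M t h = lsum fscale t (\<lambda>xs. htens M (butlast xs @ [ract M (last xs) h]))"

text \<open>The diagonal left coaction \<open>m \<otimes> n \<mapsto> m\<^sub>-\<^sub>1 n\<^sub>-\<^sub>1 \<otimes> (m\<^sub>0 \<otimes> n\<^sub>0)\<close> on the tensor square.\<close>

definition ht2_lcoact :: "('k::field, 'h::ring_1) hopf \<Rightarrow> ('k, 'h, 'm::ab_group_add) bimod
    \<Rightarrow> ('m list \<Rightarrow>\<^sub>0 'k) \<Rightarrow> ('h \<times> ('m list \<Rightarrow>\<^sub>0 'k) \<Rightarrow>\<^sub>0 'k)" where
  "ht2_lcoact H M t = lsum fscale t (\<lambda>xs.
     lsum fscale (lcoact M (xs ! 0)) (\<lambda>(a, m0). lsum fscale (lcoact M (xs ! 1)) (\<lambda>(b, n0).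
       ktens (hsp H) (htsp M 2) (a * b) (htens M [m0, n0]))))"

text \<open>
  The Woronowicz braiding \<open>\<sigma>\<close> of \<open>M\<close> with itself,
  \<open>m \<otimes> n \<mapsto> m\<^sub>-\<^sub>2 n\<^sub>0 S(n\<^sub>1) \<otimes> S(m\<^sub>-\<^sub>1) m\<^sub>0 n\<^sub>2\<close>.
\<close>

definition wor :: "('k::field, 'h::ring_1) hopf \<Rightarrow> ('k, 'h, 'm::ab_group_add) bimod
    \<Rightarrow> ('m list \<Rightarrow>\<^sub>0 'k) \<Rightarrow> ('m list \<Rightarrow>\<^sub>0 'k)" where
  "wor H M t = lsum fscale t (\<lambda>xs.
     lsum fscale (lcoact M (xs ! 0)) (\<lambda>(a, m0). lsum fscale (comult H a) (\<lambda>(a1, a2).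
     lsum fscale (rcoact M (xs ! 1)) (\<lambda>(n0, b). lsum fscale (comult H b) (\<lambda>(b1, b2).
       htens M [ract M (lact M a1 n0) (antip H b1), ract M (lact M (antip H a2) m0) b2])))))"

definition wor_inv :: "('k::field, 'h::ring_1) hopf \<Rightarrow> ('k, 'h, 'm::ab_group_add) bimod
    \<Rightarrow> ('m list \<Rightarrow>\<^sub>0 'k) \<Rightarrow> ('m list \<Rightarrow>\<^sub>0 'k)" where
  "wor_inv H M = inv_into (htpow M 2) (wor H M)"

text \<open>
  The braiding and its inverse on the neighbouring factors \<open>i\<close>, \<open>i + 1\<close> (counted from \<open>0\<close>) of a
  tensor power. On the \<open>n\<close>-th power, \<open>id \<otimes> \<sigma>\<^sup>-\<^sup>1 \<otimes> id\<close> is the inverse of \<open>id \<otimes> \<sigma> \<otimes> id\<close>.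
\<close>

definition wor_at :: "('k::field, 'h::ring_1) hopf \<Rightarrow> ('k, 'h, 'm::ab_group_add) bimod
    \<Rightarrow> nat \<Rightarrow> ('m list \<Rightarrow>\<^sub>0 'k) \<Rightarrow> ('m list \<Rightarrow>\<^sub>0 'k)" where
  "wor_at H M i t = lsum fscale t (\<lambda>xs.
     lsum fscale (wor H M (htens M [xs ! i, xs ! Suc i])) (\<lambda>ys.
       htens M (take i xs @ ys @ drop (i + 2) xs)))"

definition wor_inv_at :: "('k::field, 'h::ring_1) hopf \<Rightarrow> ('k, 'h, 'm::ab_group_add) bimod
    \<Rightarrow> nat \<Rightarrow> nat \<Rightarrow> ('m list \<Rightarrow>\<^sub>0 'k) \<Rightarrow> ('m list \<Rightarrow>\<^sub>0 'k)" where
  "wor_inv_at H M n i = inv_into (htpow M n) (wor_at H M i)"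

text \<open>Words in the neighbour transpositions \<open>(i i+1)\<close> of \<open>{..<n}\<close>, of minimal length for \<open>p\<close>.\<close>

definition reduced_word :: "nat \<Rightarrow> (nat \<Rightarrow> nat) \<Rightarrow> nat list \<Rightarrow> bool" where
  "reduced_word n p is \<longleftrightarrow> (\<forall>i\<in>set is. Suc i < n) \<and> apply_adj_transps is = p \<and>
     (\<forall>js. (\<forall>j\<in>set js. Suc j < n) \<and> apply_adj_transps js = p \<longrightarrow> length is \<le> length js)"

definition braid_perm :: "('k::field, 'h::ring_1) hopf \<Rightarrow> ('k, 'h, 'm::ab_group_add) bimod
    \<Rightarrow> nat \<Rightarrow> (nat \<Rightarrow> nat) \<Rightarrow> ('m list \<Rightarrow>\<^sub>0 'k) \<Rightarrow> ('m list \<Rightarrow>\<^sub>0 'k)" where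
  "braid_perm H M n p = foldr (\<circ>) (map (wor_inv_at H M n) (SOME is. reduced_word n p is)) id"

definition antisymmetrizer :: "('k::field, 'h::ring_1) hopf \<Rightarrow> ('k, 'h, 'm::ab_group_add) bimod
    \<Rightarrow> nat \<Rightarrow> ('m list \<Rightarrow>\<^sub>0 'k) \<Rightarrow> ('m list \<Rightarrow>\<^sub>0 'k)" where
  "antisymmetrizer H M n t = (\<Sum>p | p permutes {..<n}. fscale (of_int (sign p)) (braid_perm H M n p t))"

section \<open>Differential calculi\<close>

text \<open>
  The differential graded algebra \<open>\<Omega>\<close> is the type \<open>'o\<close> with its multiplication as wedge
  product; \<open>incl\<close> identifies \<open>H\<close> with the degree zero part.
\<close>

record (overloaded) ('k::zero, 'h, 'o) calculus =
  oscale :: "'k \<Rightarrow> 'o \<Rightarrow> 'o"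
  incl :: "'h \<Rightarrow> 'o"
  grade :: "nat \<Rightarrow> 'o set"
  diff :: "'o \<Rightarrow> 'o"
  rco :: "'o \<Rightarrow> ('o \<times> 'h \<Rightarrow>\<^sub>0 'k)"
  lco :: "'o \<Rightarrow> ('h \<times> 'o \<Rightarrow>\<^sub>0 'k)"

definition graded_algebra :: "('k::field \<Rightarrow> 'o \<Rightarrow> 'o::ring_1) \<Rightarrow> (nat \<Rightarrow> 'o set) \<Rightarrow> bool" where
  "graded_algebra s G \<longleftrightarrow> algebra_over s \<and>
     (\<forall>n. module.subspace s (G n)) \<and>
     module.span s (\<Union>n. G n) = UNIV \<and>
     (\<forall>w N. (\<forall>n. w n \<in> G n) \<and> (\<Sum>n\<le>N. w n) = 0 \<longrightarrow> (\<forall>n\<le>N. w n = 0)) \<and>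
     1 \<in> G 0 \<and> (\<forall>m n. \<forall>x\<in>G m. \<forall>y\<in>G n. x * y \<in> G (m + n))"

definition differential_calculus :: "('k::field, 'h::ring_1) hopf \<Rightarrow> ('k, 'h, 'o::ring_1) calculus \<Rightarrow> bool" where
  "differential_calculus H C \<longleftrightarrow>
     graded_algebra (oscale C) (grade C) \<and>
     Vector_Spaces.linear (hscale H) (oscale C) (incl C) \<and>
     incl C 1 = 1 \<and> (\<forall>a b. incl C (a * b) = incl C a * incl C b) \<and>
     inj (incl C) \<and> range (incl C) = grade C 0 \<and>
     Vector_Spaces.linear (oscale C) (oscale C) (diff C) \<and>
     (\<forall>n. \<forall>x\<in>grade C n. diff C x \<in> grade C (Suc n)) \<and>
     (\<forall>x. diff C (diff C x) = 0) \<and>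
     (\<forall>n. \<forall>x\<in>grade C n. \<forall>y. diff C (x * y) = diff C x * y + (- 1) ^ n * (x * diff C y)) \<and>
     (\<forall>n. grade C n = module.span (oscale C)
        {incl C a * prod_list (map (\<lambda>b. diff C (incl C b)) bs) | a bs. length bs = n})"

text \<open>
  The coactions on the graded space \<open>\<Omega>\<close> preserve degrees, so they are given by the coactions
  \<open>\<Omega>\<^sup>n \<rightarrow> \<Omega>\<^sup>n \<otimes> H\<close> and \<open>\<Omega>\<^sup>n \<rightarrow> H \<otimes> \<Omega>\<^sup>n\<close>; the values of \<open>rco\<close> and \<open>lco\<close> on inhomogeneous elements are
  irrelevant.
\<close>

abbreviation osp :: "('k::field, 'h::ring_1, 'o::ring_1) calculus \<Rightarrow> nat \<Rightarrow> ('k, 'o) vspace" where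
  "osp C n \<equiv> (oscale C, grade C n)"

definition right_comodule_calculus :: "('k::field, 'h::ring_1) hopf \<Rightarrow> ('k, 'h, 'o::ring_1) calculus \<Rightarrow> bool" where
  "right_comodule_calculus H C \<longleftrightarrow>
     (\<forall>n. linear_map (osp C n) (ktensor (osp C n) (hsp H)) (rco C)) \<and>
     (\<forall>n. \<forall>x\<in>grade C n.
        lsum fscale (rco C x) (\<lambda>(x0, a). lsum fscale (rco C x0) (\<lambda>(y, b).
             ktens (osp C n) (hhsp H) y (htH H b a)))
        = lsum fscale (rco C x) (\<lambda>(x0, a). lsum fscale (comult H a) (\<lambda>(a1, a2).
             ktens (osp C n) (hhsp H) x0 (htH H a1 a2)))) \<and>
     (\<forall>n. \<forall>x\<in>grade C n. lsum (oscale C) (rco C x) (\<lambda>(x0, a). oscale C (counit H a) x0) = x) \<and>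
     (\<forall>m n. \<forall>x\<in>grade C m. \<forall>y\<in>grade C n. rco C (x * y) =
        lsum fscale (rco C x) (\<lambda>(x0, a). lsum fscale (rco C y) (\<lambda>(y0, b).
             ktens (osp C (m + n)) (hsp H) (x0 * y0) (a * b)))) \<and>
     (\<forall>a. rco C (incl C a) = lsum fscale (comult H a) (\<lambda>(a1, a2). ktens (osp C 0) (hsp H) (incl C a1) a2)) \<and>
     (\<forall>n. \<forall>x\<in>grade C n. rco C (diff C x) =
        lsum fscale (rco C x) (\<lambda>(x0, a). ktens (osp C (Suc n)) (hsp H) (diff C x0) a))"

definition left_comodule_calculus :: "('k::field, 'h::ring_1) hopf \<Rightarrow> ('k, 'h, 'o::ring_1) calculus \<Rightarrow> bool" where
  "left_comodule_calculus H C \<longleftrightarrow>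
     (\<forall>n. linear_map (osp C n) (ktensor (hsp H) (osp C n)) (lco C)) \<and>
     (\<forall>n. \<forall>x\<in>grade C n.
        lsum fscale (lco C x) (\<lambda>(a, x0). lsum fscale (lco C x0) (\<lambda>(b, y).
             ktens (hsp H) (ktensor (hsp H) (osp C n)) a (ktens (hsp H) (osp C n) b y)))
        = lsum fscale (lco C x) (\<lambda>(a, x0). lsum fscale (comult H a) (\<lambda>(a1, a2).
             ktens (hsp H) (ktensor (hsp H) (osp C n)) a1 (ktens (hsp H) (osp C n) a2 x0)))) \<and>
     (\<forall>n. \<forall>x\<in>grade C n. lsum (oscale C) (lco C x) (\<lambda>(a, x0). oscale C (counit H a) x0) = x) \<and>
     (\<forall>m n. \<forall>x\<in>grade C m. \<forall>y\<in>grade C n. lco C (x * y) =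
        lsum fscale (lco C x) (\<lambda>(a, x0). lsum fscale (lco C y) (\<lambda>(b, y0).
             ktens (hsp H) (osp C (m + n)) (a * b) (x0 * y0)))) \<and>
     (\<forall>a. lco C (incl C a) = lsum fscale (comult H a) (\<lambda>(a1, a2). ktens (hsp H) (osp C 0) a1 (incl C a2))) \<and>
     (\<forall>n. \<forall>x\<in>grade C n. lco C (diff C x) =
        lsum fscale (lco C x) (\<lambda>(a, x0). ktens (hsp H) (osp C (Suc n)) a (diff C x0)))"

definition bicovariant_calculus :: "('k::field, 'h::ring_1) hopf \<Rightarrow> ('k, 'h, 'o::ring_1) calculus \<Rightarrow> bool" where
  "bicovariant_calculus H C \<longleftrightarrow>
     differential_calculus H C \<and> right_comodule_calculus H C \<and> left_comodule_calculus H C \<and>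
     (\<forall>n. \<forall>x\<in>grade C n.
        lsum fscale (rco C x) (\<lambda>(x0, b). lsum fscale (lco C x0) (\<lambda>(a, y).
             ktens (hsp H) (ktensor (osp C n) (hsp H)) a (ktens (osp C n) (hsp H) y b)))
        = lsum fscale (lco C x) (\<lambda>(a, x0). lsum fscale (rco C x0) (\<lambda>(y, b).
             ktens (hsp H) (ktensor (osp C n) (hsp H)) a (ktens (osp C n) (hsp H) y b))))"

definition Omega1 :: "('k::field, 'h::ring_1, 'o::ring_1) calculus \<Rightarrow> ('k, 'h, 'o) bimod" where
  "Omega1 C = \<lparr>carr = grade C 1, bscale = oscale C,
     lact = (\<lambda>a w. incl C a * w), ract = (\<lambda>w a. w * incl C a),
     lcoact = lco C, rcoact = rco C\<rparr>"

definition wedge :: "('k::field, 'h::ring_1, 'o::ring_1) calculus \<Rightarrow> ('o list \<Rightarrow>\<^sub>0 'k) \<Rightarrow> 'o" where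
  "wedge C t = lsum (oscale C) t prod_list"

text \<open>
  The calculus is the braided exterior algebra of its one-forms: in each positive degree the
  multiplication map identifies the quotient of the tensor power by the kernel of the
  antisymmetrizer with the forms of that degree.
\<close>

definition woronowicz_calculus :: "('k::field, 'h::ring_1) hopf \<Rightarrow> ('k, 'h, 'o::ring_1) calculus \<Rightarrow> bool" where
  "woronowicz_calculus H C \<longleftrightarrow> bicovariant_calculus H C \<and>
     (\<forall>n\<ge>1. wedge C ` htpow (Omega1 C) n = grade C n \<and>
        (\<forall>t\<in>htpow (Omega1 C) n. wedge C t = 0 \<longleftrightarrow> antisymmetrizer H (Omega1 C) n t = 0))"

definition fin_gen_right :: "('k::field, 'h::ring_1, 'm::ab_group_add) bimod \<Rightarrow> bool" where
  "fin_gen_right M \<longleftrightarrow> (\<exists>B. finite B \<and> B \<subseteq> carr M \<and>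
     (\<forall>m\<in>carr M. \<exists>c. m = (\<Sum>b\<in>B. ract M b (c b))))"

section \<open>Symmetric tensors\<close>

definition eigsp :: "('k::field, 'h::ring_1) hopf \<Rightarrow> ('k, 'h, 'o::ring_1) calculus \<Rightarrow> 'k \<Rightarrow> ('o list \<Rightarrow>\<^sub>0 'k) set" where
  "eigsp H C c = {t \<in> htpow (Omega1 C) 2. wor_inv H (Omega1 C) t = fscale c t}"

definition braid_diagonalisable :: "('k::field, 'h::ring_1) hopf \<Rightarrow> ('k, 'h, 'o::ring_1) calculus \<Rightarrow> bool" where
  "braid_diagonalisable H C \<longleftrightarrow> htpow (Omega1 C) 2 = fspan (\<Union>c. eigsp H C c)"

definition braid_eigenvalue :: "('k::field, 'h::ring_1) hopf \<Rightarrow> ('k, 'h, 'o::ring_1) calculus \<Rightarrow> 'k \<Rightarrow> bool" where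
  "braid_eigenvalue H C c \<longleftrightarrow> (\<exists>t\<in>eigsp H C c. t \<noteq> 0)"

definition sym2 :: "('k::field, 'h::ring_1) hopf \<Rightarrow> ('k, 'h, 'o::ring_1) calculus \<Rightarrow> ('o list \<Rightarrow>\<^sub>0 'k) set" where
  "sym2 H C = eigsp H C 1"

definition alt2 :: "('k::field, 'h::ring_1) hopf \<Rightarrow> ('k, 'h, 'o::ring_1) calculus \<Rightarrow> ('o list \<Rightarrow>\<^sub>0 'k) set" where
  "alt2 H C = fspan (\<Union>c\<in>- {1}. eigsp H C c)"

definition sym_proj :: "('k::field, 'h::ring_1) hopf \<Rightarrow> ('k, 'h, 'o::ring_1) calculus \<Rightarrow> ('o list \<Rightarrow>\<^sub>0 'k) \<Rightarrow> ('o list \<Rightarrow>\<^sub>0 'k)" where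
  "sym_proj H C t = (THE s. s \<in> sym2 H C \<and> t - s \<in> alt2 H C)"

text \<open>\<open>\<pi> \<otimes> id\<close> on the third tensor power.\<close>

definition sym_proj12 :: "('k::field, 'h::ring_1) hopf \<Rightarrow> ('k, 'h, 'o::ring_1) calculus \<Rightarrow> ('o list \<Rightarrow>\<^sub>0 'k) \<Rightarrow> ('o list \<Rightarrow>\<^sub>0 'k)" where
  "sym_proj12 H C t = lsum fscale t (\<lambda>xs.
     hconc (Omega1 C) (sym_proj H C (htens (Omega1 C) [xs ! 0, xs ! 1])) (htens (Omega1 C) [xs ! 2]))"

section \<open>Vector fields and metrics\<close>

definition right_hom :: "'a set \<Rightarrow> ('a \<Rightarrow> 'h \<Rightarrow> 'a) \<Rightarrow> 'b set \<Rightarrow> ('b \<Rightarrow> 'h \<Rightarrow> 'b) \<Rightarrow> ('a::ab_group_add \<Rightarrow> 'b::ab_group_add) set" where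
  "right_hom A rA B rB = {\<phi>. (\<forall>x\<in>A. \<phi> x \<in> B) \<and> (\<forall>x. x \<notin> A \<longrightarrow> \<phi> x = 0) \<and>
     (\<forall>x\<in>A. \<forall>y\<in>A. \<phi> (x + y) = \<phi> x + \<phi> y) \<and> (\<forall>x\<in>A. \<forall>h. \<phi> (rA x h) = rB (\<phi> x) h)}"

definition vfields :: "('k::field, 'h::ring_1, 'o::ring_1) calculus \<Rightarrow> ('o \<Rightarrow> 'h) set" where
  "vfields C = right_hom (grade C 1) (ract (Omega1 C)) UNIV (*)"

definition vf_scale :: "('k::field, 'h::ring_1) hopf \<Rightarrow> 'k \<Rightarrow> ('o \<Rightarrow> 'h) \<Rightarrow> 'o \<Rightarrow> 'h" where
  "vf_scale H c X = (\<lambda>w. hscale H c (X w))"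

text \<open>
  The coactions on \<open>X\<close> are determined by
  \<open>X\<^sub>0(\<omega>) \<otimes> X\<^sub>1 = X(\<omega>\<^sub>0)\<^sub>0 \<otimes> X(\<omega>\<^sub>0)\<^sub>1 S(\<omega>\<^sub>1)\<close> and
  \<open>X\<^sub>-\<^sub>1 \<otimes> X\<^sub>0(\<omega>) = X(\<omega>\<^sub>0)\<^sub>-\<^sub>1 S\<^sup>-\<^sup>1(\<omega>\<^sub>-\<^sub>1) \<otimes> X(\<omega>\<^sub>0)\<^sub>0\<close> for all one-forms \<open>\<omega>\<close>, where both coactions of
  \<open>H\<close> on itself are the comultiplication.
\<close>

definition vf_rcoact :: "('k::field, 'h::ring_1) hopf \<Rightarrow> ('k, 'h, 'o::ring_1) calculus \<Rightarrow> ('o \<Rightarrow> 'h) \<Rightarrow> (('o \<Rightarrow> 'h) \<times> 'h \<Rightarrow>\<^sub>0 'k)" where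
  "vf_rcoact H C X = (THE t. t \<in> snd (ktensor (vf_scale H, vfields C) (hsp H)) \<and>
     (\<forall>w\<in>grade C 1. lsum fscale t (\<lambda>(X0, X1). htH H (X0 w) X1)
       = lsum fscale (rco C w) (\<lambda>(w0, w1). lsum fscale (comult H (X w0)) (\<lambda>(a0, a1).
           htH H a0 (a1 * antip H w1)))))"

definition vf_lcoact :: "('k::field, 'h::ring_1) hopf \<Rightarrow> ('k, 'h, 'o::ring_1) calculus \<Rightarrow> ('o \<Rightarrow> 'h) \<Rightarrow> ('h \<times> ('o \<Rightarrow> 'h) \<Rightarrow>\<^sub>0 'k)" where
  "vf_lcoact H C X = (THE t. t \<in> snd (ktensor (hsp H) (vf_scale H, vfields C)) \<and>
     (\<forall>w\<in>grade C 1. lsum fscale t (\<lambda>(X1, X0). htH H X1 (X0 w))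
       = lsum fscale (lco C w) (\<lambda>(w1, w0). lsum fscale (comult H (X w0)) (\<lambda>(a1, a0).
           htH H (a1 * inv (antip H) w1) a0))))"

definition VF :: "('k::field, 'h::ring_1) hopf \<Rightarrow> ('k, 'h, 'o::ring_1) calculus \<Rightarrow> ('k, 'h, 'o \<Rightarrow> 'h) bimod" where
  "VF H C = \<lparr>carr = vfields C, bscale = vf_scale H,
     lact = (\<lambda>a X w. a * X w),
     ract = (\<lambda>X b w. if w \<in> grade C 1 then X (incl C b * w) else 0),
     lcoact = vf_lcoact H C, rcoact = vf_rcoact H C\<rparr>"

text \<open>The pairing \<open>\<langle>g, \<omega> \<otimes> \<eta>\<rangle> = \<langle>g\<^sup>a \<langle>g\<^sub>a, \<omega>\<rangle>, \<eta>\<rangle>\<close>.\<close>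

definition pair2 :: "('k::field, 'h::ring_1) hopf \<Rightarrow> ('k, 'h, 'o::ring_1) calculus
    \<Rightarrow> (('o \<Rightarrow> 'h) list \<Rightarrow>\<^sub>0 'k) \<Rightarrow> ('o list \<Rightarrow>\<^sub>0 'k) \<Rightarrow> 'h" where
  "pair2 H C g t = lsum (hscale H) g (\<lambda>Xs. lsum (hscale H) t (\<lambda>ws.
     ract (VF H C) (Xs ! 0) ((Xs ! 1) (ws ! 0)) (ws ! 1)))"

definition pair3 :: "('k::field, 'h::ring_1) hopf \<Rightarrow> ('k, 'h, 'o::ring_1) calculus
    \<Rightarrow> (('o \<Rightarrow> 'h) list \<Rightarrow>\<^sub>0 'k) \<Rightarrow> ('o list \<Rightarrow>\<^sub>0 'k) \<Rightarrow> 'o" where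
  "pair3 H C g t = lsum (oscale C) t (\<lambda>ws.
     incl C (pair2 H C g (htens (Omega1 C) [ws ! 0, ws ! 1])) * ws ! 2)"

definition sharp :: "('k::field, 'h::ring_1) hopf \<Rightarrow> ('k, 'h, 'o::ring_1) calculus
    \<Rightarrow> (('o \<Rightarrow> 'h) list \<Rightarrow>\<^sub>0 'k) \<Rightarrow> 'o \<Rightarrow> ('o \<Rightarrow> 'h)" where
  "sharp H C g w = lsum (vf_scale H) g (\<lambda>Xs. ract (VF H C) (Xs ! 0) ((Xs ! 1) w))"

definition metric :: "('k::field, 'h::ring_1) hopf \<Rightarrow> ('k, 'h, 'o::ring_1) calculus
    \<Rightarrow> (('o \<Rightarrow> 'h) list \<Rightarrow>\<^sub>0 'k) \<Rightarrow> bool" where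
  "metric H C g \<longleftrightarrow> g \<in> htpow (VF H C) 2 \<and> wor H (VF H C) g = g \<and>
     sharp H C g \<in> right_hom (grade C 1) (ract (Omega1 C)) (vfields C) (ract (VF H C)) \<and>
     bij_betw (sharp H C g) (grade C 1) (vfields C)"

section \<open>Connections\<close>

definition right_connection :: "('k::field, 'h::ring_1) hopf \<Rightarrow> ('k, 'h, 'o::ring_1) calculus
    \<Rightarrow> ('o \<Rightarrow> ('o list \<Rightarrow>\<^sub>0 'k)) \<Rightarrow> bool" where
  "right_connection H C D \<longleftrightarrow>
     linear_map (osp C 1) (htsp (Omega1 C) 2) D \<and> (\<forall>w. w \<notin> grade C 1 \<longrightarrow> D w = 0) \<and>
     (\<forall>w\<in>grade C 1. \<forall>a. D (w * incl C a)
        = ht_ract (Omega1 C) (D w) a + htens (Omega1 C) [w, diff C (incl C a)])"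

text \<open>
  \<open>\<phi>\<^sub>-\<^sub>1 \<otimes> \<phi>\<^sub>0(m) = \<phi>(m\<^sub>0)\<^sub>-\<^sub>1 S\<^sup>-\<^sup>1(m\<^sub>-\<^sub>1) \<otimes> \<phi>(m\<^sub>0)\<^sub>0\<close>, as a function of \<open>m\<close>; the further leg in
  \<open>\<phi>\<^sub>-\<^sub>2 \<otimes> \<phi>\<^sub>-\<^sub>1 \<otimes> \<phi>\<^sub>0\<close> is obtained by comultiplying the first one.
\<close>

definition map_lcoact :: "('k::field, 'h::ring_1) hopf \<Rightarrow> ('k, 'h, 'o::ring_1) calculus
    \<Rightarrow> ('o \<Rightarrow> ('o list \<Rightarrow>\<^sub>0 'k)) \<Rightarrow> 'o \<Rightarrow> ('h \<times> ('o list \<Rightarrow>\<^sub>0 'k) \<Rightarrow>\<^sub>0 'k)" where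
  "map_lcoact H C \<phi> m = lsum fscale (lco C m) (\<lambda>(a, m0).
     lsum fscale (ht2_lcoact H (Omega1 C) (\<phi> m0)) (\<lambda>(b, t).
       ktens (hsp H) (htsp (Omega1 C) 2) (b * inv (antip H) a) t))"

text \<open>
  \<open>(\<phi> \<oplus> \<phi>)(m \<otimes> n) = \<sigma>\<^sub>2\<^sub>3(\<phi>(m\<^sub>0 S(m\<^sub>1)) \<otimes> m\<^sub>2 n) + \<phi>\<^sub>-\<^sub>2 m\<^sub>0 S(\<phi>\<^sub>-\<^sub>1 m\<^sub>1) \<otimes> \<phi>\<^sub>0(m\<^sub>2 n)\<close>; the tensor
  factors \<open>2\<close> and \<open>3\<close> are the positions \<open>1\<close> and \<open>2\<close> of a list.
\<close>

definition osum :: "('k::field, 'h::ring_1) hopf \<Rightarrow> ('k, 'h, 'o::ring_1) calculus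
    \<Rightarrow> ('o \<Rightarrow> ('o list \<Rightarrow>\<^sub>0 'k)) \<Rightarrow> ('o list \<Rightarrow>\<^sub>0 'k) \<Rightarrow> ('o list \<Rightarrow>\<^sub>0 'k)" where
  "osum H C \<phi> t = (let M = Omega1 C in lsum fscale t (\<lambda>ws.
     lsum fscale (rco C (ws ! 0)) (\<lambda>(m0, b). lsum fscale (comult H b) (\<lambda>(m1, m2).
       wor_at H M 1 (hconc M (\<phi> (ract M m0 (antip H m1))) (htens M [lact M m2 (ws ! 1)]))
       + lsum fscale (map_lcoact H C \<phi> (lact M m2 (ws ! 1))) (\<lambda>(e, s).
           lsum fscale (comult H e) (\<lambda>(e1, e2).
             hconc M (htens M [ract M (lact M e1 m0) (antip H (e2 * m1))]) s))))))"

definition vee :: "('k::field, 'h::ring_1) hopf \<Rightarrow> ('k, 'h, 'o::ring_1) calculus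
    \<Rightarrow> ('o \<Rightarrow> ('o list \<Rightarrow>\<^sub>0 'k)) \<Rightarrow> ('o list \<Rightarrow>\<^sub>0 'k) \<Rightarrow> ('o list \<Rightarrow>\<^sub>0 'k)" where
  "vee H C \<phi> t = (if t \<in> sym2 H C then sym_proj12 H C (osum H C \<phi> t) else 0)"

definition metric_compatible :: "('k::field, 'h::ring_1) hopf \<Rightarrow> ('k, 'h, 'o::ring_1) calculus
    \<Rightarrow> (('o \<Rightarrow> 'h) list \<Rightarrow>\<^sub>0 'k) \<Rightarrow> ('o \<Rightarrow> ('o list \<Rightarrow>\<^sub>0 'k)) \<Rightarrow> bool" where
  "metric_compatible H C g D \<longleftrightarrow>
     (\<forall>t\<in>sym2 H C. pair3 H C g (vee H C D t) = diff C (incl C (pair2 H C g t)))"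

definition torsion_free :: "('k::field, 'h::ring_1, 'o::ring_1) calculus \<Rightarrow> ('o \<Rightarrow> ('o list \<Rightarrow>\<^sub>0 'k)) \<Rightarrow> bool" where
  "torsion_free C D \<longleftrightarrow> (\<forall>w\<in>grade C 1. wedge C (D w) + diff C w = 0)"

definition levi_civita :: "('k::field, 'h::ring_1) hopf \<Rightarrow> ('k, 'h, 'o::ring_1) calculus
    \<Rightarrow> (('o \<Rightarrow> 'h) list \<Rightarrow>\<^sub>0 'k) \<Rightarrow> ('o \<Rightarrow> ('o list \<Rightarrow>\<^sub>0 'k)) \<Rightarrow> bool" where
  "levi_civita H C g D \<longleftrightarrow>
     right_connection H C D \<and> torsion_free C D \<and> metric_compatible H C g D"

definition Hom_Omega_Sym :: "('k::field, 'h::ring_1) hopf \<Rightarrow> ('k, 'h, 'o::ring_1) calculus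
    \<Rightarrow> ('o \<Rightarrow> ('o list \<Rightarrow>\<^sub>0 'k)) set" where
  "Hom_Omega_Sym H C = right_hom (grade C 1) (ract (Omega1 C)) (sym2 H C) (ht_ract (Omega1 C))"

definition Hom_Sym_Omega :: "('k::field, 'h::ring_1) hopf \<Rightarrow> ('k, 'h, 'o::ring_1) calculus
    \<Rightarrow> (('o list \<Rightarrow>\<^sub>0 'k) \<Rightarrow> 'o) set" where
  "Hom_Sym_Omega H C = right_hom (sym2 H C) (ht_ract (Omega1 C)) (grade C 1) (ract (Omega1 C))"

definition Phi :: "('k::field, 'h::ring_1) hopf \<Rightarrow> ('k, 'h, 'o::ring_1) calculus
    \<Rightarrow> (('o \<Rightarrow> 'h) list \<Rightarrow>\<^sub>0 'k) \<Rightarrow> ('o \<Rightarrow> ('o list \<Rightarrow>\<^sub>0 'k)) \<Rightarrow> ('o list \<Rightarrow>\<^sub>0 'k) \<Rightarrow> 'o" where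
  "Phi H C g \<phi> = (\<lambda>t. pair3 H C g (vee H C \<phi> t))"

end

theory Submission
  imports Defs
begin

text \<open>
  Let \<open>\<psi>\<close> be the correction term, so \<open>\<Phi>\<^sub>g(\<psi>) = f\<^sup>-\<^sup>1 df \<langle>g, \<cdot>\<rangle>\<close>. The map \<open>\<phi> \<mapsto> \<phi>\<^sub>\<or>\<close> is additive and the
  pairing is left linear in the metric, so \<open>\<langle>f g, (\<nabla> + \<psi>)\<^sub>\<or>\<rangle> = f d\<langle>g, \<cdot>\<rangle> + df \<langle>g, \<cdot>\<rangle> = d\<langle>f g, \<cdot>\<rangle>\<close>. The difference
  of two torsion-free connections is a right linear map into the kernel of \<open>\<and>\<close>, which is the space of symmetric
  tensors; for two Levi-Civita connections of \<open>f g\<close> it lies in the kernel of \<open>\<Phi>\<^sub>g\<close>.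

  That the braiding is a well-defined bimodule map is a Sweedler
  computation using only the compatibility of the coactions with the actions; for vector fields these coactions
  exist because the one-forms are finitely generated. That \<open>\<sigma>\<close> is bijective follows since \<open>M \<otimes>\<^sub>H M\<close> is generated by
  tensors of coinvariant elements, on which \<open>\<sigma>\<close> is the flip; its inverse is the braiding over the co-opposite
  Hopf algebra.
\<close>

subsection \<open>Linear extension from the basis of a free vector space\<close>

text \<open>Several objects are fixed by choice or description: \<open>wor_inv\<close> is an
  \<open>inv_into\<close>, the coactions of vector fields are \<open>THE\<close> terms, the word in
  \<open>braid_perm\<close> is a \<open>SOME\<close>. They acquire their meaning only through a
  proof: of bijectivity of \<sigma> on the tensor square, of existence and uniqueness of the
  coactions, of uniqueness of reduced words in degree two. Most of the work lies there, because
  symmetric tensors are defined through \<open>wor_inv\<close>, and \<sigma>(f g) = f g for vector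
  fields presupposes coactions compatible with the actions. A second obstacle is that tensors are
  formal sums, chosen as representatives, with entries in types larger than the modules. Hence
  linearity is stated relative to carriers, and the supports of representatives are tracked. The
  factor f^{-1} df comes from the Leibniz rule: d(f p) exceeds f dp by df p, and pairing with f g
  multiplies by f on the left, so the correction must satisfy f \<Phi>_g(\<psi>) = df \<langle>g,
  .\<rangle>.\<close>

abbreviation "keys \<equiv> Poly_Mapping.keys"
abbreviation "ksum \<equiv> lsum (*)"
abbreviation "fsum \<equiv> lsum fscale"
abbreviation "hsum H \<equiv> lsum (hscale H)"

text \<open>The source is a carrier inside a type, the target a whole type: values are added and
  scaled in the ambient type, and their membership in a carrier is tracked separately.\<close>

abbreviation lin :: "('k::field, 'a::ab_group_add) vspace \<Rightarrow> ('k \<Rightarrow> 'v \<Rightarrow> 'v::ab_group_add) \<Rightarrow> ('a \<Rightarrow> 'v) \<Rightarrow> bool" where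
  "lin V s F \<equiv> linear_map V (s, UNIV) F"

definition bilin where
  "bilin V W s F \<longleftrightarrow> (\<forall>b\<in>snd W. lin V s (\<lambda>a. F a b)) \<and> (\<forall>a\<in>snd V. lin W s (\<lambda>b. F a b))"

definition trilin where
  "trilin U V W s F \<longleftrightarrow> (\<forall>b\<in>snd V. \<forall>c\<in>snd W. lin U s (\<lambda>a. F a b c)) \<and>
     (\<forall>a\<in>snd U. \<forall>c\<in>snd W. lin V s (\<lambda>b. F a b c)) \<and> (\<forall>a\<in>snd U. \<forall>b\<in>snd V. lin W s (\<lambda>c. F a b c))"

lemma lin_add: "lin V s F \<Longrightarrow> x \<in> snd V \<Longrightarrow> y \<in> snd V \<Longrightarrow> F (x + y) = F x + F y"
  and lin_scale: "lin V s F \<Longrightarrow> x \<in> snd V \<Longrightarrow> F (fst V c x) = s c (F x)"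
  by (simp_all add: linear_map_def)

lemma linI:
  assumes "\<And>x y. x \<in> snd V \<Longrightarrow> y \<in> snd V \<Longrightarrow> F (x + y) = F x + F y"
    and "\<And>c x. x \<in> snd V \<Longrightarrow> F (fst V c x) = s c (F x)"
  shows "lin V s F"
  using assms by (simp add: linear_map_def)

lemma vector_space_mult: "vector_space ((*) :: 'k::field \<Rightarrow> 'k \<Rightarrow> 'k)"
  by unfold_locales (auto simp: algebra_simps)

lemma lin_UNIV_iff:
  assumes "vector_space r" and "vector_space s"
  shows "lin (r, UNIV) s F \<longleftrightarrow> Vector_Spaces.linear r s F"
  using assms by (auto simp: linear_map_def Vector_Spaces.linear_iff)

context
  fixes s :: "'k::field \<Rightarrow> 'v::ab_group_add \<Rightarrow> 'v"
  assumes vs: "vector_space s"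
begin

interpretation vector_space s by (rule vs)

lemma lsum_superset:
  assumes "finite K" "keys t \<subseteq> K"
  shows "lsum s t F = (\<Sum>x\<in>K. s (Poly_Mapping.lookup t x) (F x))"
  unfolding lsum_def using assms by (intro sum.mono_neutral_left) (auto simp: in_keys_iff)

lemma lsum_add: "lsum s (t + u) F = lsum s t F + lsum s u F"
proof -
  let ?K = "keys t \<union> keys u"
  have "keys (t + u) \<subseteq> ?K" by (rule Poly_Mapping.keys_add)
  then show ?thesis
    by (simp add: lsum_superset[of ?K] lookup_add scale_left_distrib sum.distrib)
qed

lemma keys_fscale: "keys (fscale c t) \<subseteq> keys t"
  by (auto simp: in_keys_iff)

lemma lsum_fscale: "lsum s (fscale c t) F = s c (lsum s t F)"
proof -
  have "lsum s (fscale c t) F = (\<Sum>x\<in>keys t. s (c * Poly_Mapping.lookup t x) (F x))"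
    by (subst lsum_superset[OF _ keys_fscale]) auto
  then show ?thesis by (simp add: lsum_def scale_sum_right)
qed

lemma lsum_gen [simp]: "lsum s (gen x) F = F x"
  by (simp add: lsum_def)

lemma lsum_zero [simp]: "lsum s 0 F = 0"
  by (simp add: lsum_def)

lemma linear_lsum: "Vector_Spaces.linear fscale s (\<lambda>t. lsum s t F)"
  by (simp add: Vector_Spaces.linear_iff vs vector_space_fscale lsum_add lsum_fscale)

lemma lsum_uminus: "lsum s (- t) F = - lsum s t F"
  using lsum_add[of t "- t" F] by (simp add: add_eq_0_iff)

lemma lsum_minus: "lsum s (t - u) F = lsum s t F - lsum s u F"
  using lsum_add[of t "- u" F] by (simp add: lsum_uminus)

lemma lsum_sum: "lsum s (\<Sum>i\<in>I. t i) F = (\<Sum>i\<in>I. lsum s (t i) F)"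
  by (induction I rule: infinite_finite_induct) (auto simp: lsum_add)

lemma lsum_add_fun: "lsum s t (\<lambda>x. F x + G x) = lsum s t F + lsum s t G"
  by (simp add: lsum_def scale_right_distrib sum.distrib)

lemma lsum_add_fun2:
  "lsum s t (\<lambda>(a, b). F a b + G a b) = lsum s t (\<lambda>(a, b). F a b) + lsum s t (\<lambda>(a, b). G a b)"
  by (simp add: split_def lsum_add_fun)

lemma lsum_lsum: "lsum s (fsum t F) G = lsum s t (\<lambda>x. lsum s (F x) G)"
  by (simp add: lsum_def[of fscale] lsum_sum lsum_fscale) (simp add: lsum_def)

lemma lsum_lsum2: "lsum s (fsum t (\<lambda>(a, b). F a b)) G = lsum s t (\<lambda>(a, b). lsum s (F a b) G)"
  by (simp add: lsum_lsum split_def)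

lemma lsum_swap: "lsum s t (\<lambda>x. lsum s u (\<lambda>y. F x y)) = lsum s u (\<lambda>y. lsum s t (\<lambda>x. F x y))"
  unfolding lsum_def scale_sum_right by (subst sum.swap) (simp add: mult.commute)

lemma lsum_swap2:
  "lsum s t (\<lambda>(a, b). lsum s u (\<lambda>(c, d). F a b c d)) = lsum s u (\<lambda>(c, d). lsum s t (\<lambda>(a, b). F a b c d))"
  unfolding split_def by (rule lsum_swap)

text \<open>Linearity is assumed only for those \<open>y\<close> that occur in \<open>t\<close>,
  since these are the ones known to lie in a carrier.\<close>

lemma lin_lsum_fun:
  assumes "\<And>y. y \<in> keys t \<Longrightarrow> lin V s (\<lambda>x. F x y)"
  shows "lin V s (\<lambda>x. lsum s t (\<lambda>y. F x y))"
proof (rule linI)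
  fix x y assume "x \<in> snd V" "y \<in> snd V"
  then have "lsum s t (F (x + y)) = lsum s t (\<lambda>z. F x z + F y z)"
    unfolding lsum_def by (intro sum.cong) (auto simp: lin_add[OF assms])
  then show "lsum s t (F (x + y)) = lsum s t (F x) + lsum s t (F y)" by (simp add: lsum_add_fun)
next
  fix c x assume "x \<in> snd V"
  then have "lsum s t (F (fst V c x)) = (\<Sum>z\<in>keys t. s (Poly_Mapping.lookup t z) (s c (F x z)))"
    unfolding lsum_def by (intro sum.cong) (auto simp: lin_scale[OF assms])
  then show "lsum s t (F (fst V c x)) = s c (lsum s t (F x))"
    by (simp add: lsum_def scale_sum_right mult.commute)
qed

lemma lin_lsum_fun2:
  assumes "\<And>a b. (a, b) \<in> keys t \<Longrightarrow> lin V s (\<lambda>x. F x a b)"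
  shows "lin V s (\<lambda>x. lsum s t (\<lambda>(a, b). F x a b))"
  unfolding split_def using assms by (intro lin_lsum_fun) auto

lemma lin_lsum_arg:
  assumes "lin V fscale T"
  shows "lin V s (\<lambda>x. lsum s (T x) F)"
  using assms by (simp add: linear_map_def lsum_add lsum_fscale)

lemma lin_smult: "lin V s F \<Longrightarrow> lin V s (\<lambda>x. s c (F x))"
  by (simp add: linear_map_def scale_right_distrib mult.commute)

lemma lin_smult_left: "lin V (*) F \<Longrightarrow> lin V s (\<lambda>x. s (F x) v)"
  by (simp add: linear_map_def scale_left_distrib)

lemma lin_id: "lin (s, A) s (\<lambda>x. x)"
  by (simp add: linear_map_def)

text \<open>Extend x - y to a basis and send it to 1. Vector-valued Sweedler identities are reduced
  by this to their scalar-valued form, in which the axioms are stated.\<close>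

lemma functional_ext:
  assumes "\<And>p. lin (s, UNIV) (*) p \<Longrightarrow> p x = p y"
  shows "x = y"
proof (rule ccontr)
  assume "x \<noteq> y"
  then have ind: "independent {x - y}" by (simp add: dependent_single)
  interpret P: vector_space_pair s "(*) :: 'k \<Rightarrow> 'k \<Rightarrow> 'k"
    by (intro vector_space_pair.intro vs vector_space_mult)
  define p where "p = P.construct {x - y} (\<lambda>_. 1)"
  have lp: "Vector_Spaces.linear s (*) p" unfolding p_def by (rule P.linear_construct[OF ind])
  have "p (x - y) = 1" unfolding p_def by (rule P.construct_basis[OF ind]) simp
  moreover have "p x = p y"
    using lp by (intro assms) (simp add: lin_UNIV_iff[OF vs vector_space_mult])
  ultimately show False using Vector_Spaces.linear.axioms(3)[OF lp] lp
    by (simp add: P.linear_diff)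
qed

end

lemma lsum_cong:
  assumes "t = u" and "\<And>x. x \<in> keys u \<Longrightarrow> F x = G x"
  shows "lsum s t F = lsum s u G"
  unfolding lsum_def using assms by (auto intro: sum.cong)

lemma lsum_cong2:
  assumes "\<And>a b. (a, b) \<in> keys t \<Longrightarrow> F a b = G a b"
  shows "lsum s t (\<lambda>(a, b). F a b) = lsum s t (\<lambda>(a, b). G a b)"
  using assms by (intro lsum_cong) auto

lemma lin_zero:
  assumes "vector_space s" "vector_space r" "lin (r, A) s F" "0 \<in> A"
  shows "F 0 = 0"
  using lin_add[OF assms(3), of 0 0] assms(4) by simp

lemma lin_sum:
  assumes "vector_space r" "module.subspace r A" "lin (r, A) s F" "\<And>i. i \<in> I \<Longrightarrow> f i \<in> A"
  shows "F (\<Sum>i\<in>I. f i) = (\<Sum>i\<in>I. F (f i))"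
proof -
  interpret vector_space r by fact
  have "F 0 = 0" using lin_add[OF assms(3), of 0 0] subspace_0[OF assms(2)] by simp
  with assms(4) show ?thesis
    by (induction I rule: infinite_finite_induct)
       (auto simp: lin_add[OF assms(3)] subspace_sum[OF assms(2)])
qed

lemma lsum_in_subspace:
  assumes "vector_space r" "module.subspace r A" "\<And>x. x \<in> keys t \<Longrightarrow> F x \<in> A"
  shows "lsum r t F \<in> A"
proof -
  interpret vector_space r by fact
  show ?thesis unfolding lsum_def using assms(2,3) by (intro subspace_sum subspace_scale)
qed

lemma lin_lsum:
  assumes "vector_space r" "module.subspace r A" "lin (r, A) s G" "\<And>x. x \<in> keys t \<Longrightarrow> F x \<in> A"
  shows "G (lsum r t F) = lsum s t (\<lambda>x. G (F x))"
proof -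
  interpret vector_space r by fact
  show ?thesis unfolding lsum_def
    using assms(4) lin_scale[OF assms(3)]
    by (subst lin_sum[OF assms(1-3)]) (auto intro!: sum.cong subspace_scale[OF assms(2)])
qed

lemma lin_lsum_UNIV:
  assumes "vector_space r" "lin (r, UNIV) s G"
  shows "G (lsum r t F) = lsum s t (\<lambda>x. G (F x))"
    and "G (lsum r u (\<lambda>(a, b). F2 a b)) = lsum s u (\<lambda>(a, b). G (F2 a b))"
proof -
  interpret vector_space r by fact
  show "G (lsum r t F) = lsum s t (\<lambda>x. G (F x))" for t :: "'x \<Rightarrow>\<^sub>0 'a" and F
    using assms by (intro lin_lsum) auto
  from this[of u "\<lambda>x. F2 (fst x) (snd x)"]
  show "G (lsum r u (\<lambda>(a, b). F2 a b)) = lsum s u (\<lambda>(a, b). G (F2 a b))"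
    by (simp add: split_def)
qed

lemma lin_compose:
  assumes "lin (s, UNIV) r p" "lin V s F"
  shows "lin V r (\<lambda>x. p (F x))"
  using assms by (simp add: linear_map_def)

lemma bilin_compose: "lin (s, UNIV) r p \<Longrightarrow> bilin V W s F \<Longrightarrow> bilin V W r (\<lambda>a b. p (F a b))"
  by (auto simp: bilin_def intro: lin_compose)

lemma trilin_compose: "lin (s, UNIV) r p \<Longrightarrow> trilin U V W s F \<Longrightarrow> trilin U V W r (\<lambda>a b c. p (F a b c))"
  by (auto simp: trilin_def intro: lin_compose)

text \<open>A bilinear \<open>F\<close> kills the relations, so the sum over the representative
  chosen by \<open>quot_proj\<close> does not see the choice.\<close>

lemma lsum_ktens:
  fixes V :: "('k::field, 'a::ab_group_add) vspace" and W :: "('k, 'b::ab_group_add) vspace"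
  assumes "vector_space s" and "bilin V W s F" and "a \<in> snd V" "b \<in> snd W"
  shows "lsum s (ktens V W a b) (\<lambda>(x, y). F x y) = F a b"
proof -
  have "lsum s r (\<lambda>(x, y). F x y) = 0" if "r \<in> ktens_rels V W" for r
    using that assms(1,2) unfolding ktens_rels_def
    by (auto simp: lsum_minus lsum_fscale bilin_def linear_map_def)
  then show ?thesis unfolding ktens_def
    by (subst quot_proj_factor[OF linear_lsum[OF assms(1)]]) (auto simp: assms(1))
qed

subsection \<open>Hopf algebras\<close>

lemmas lin_lsum_intros = lin_lsum_fun lin_lsum_fun2 lin_lsum_arg lin_smult lin_smult_left lin_id

text \<open>
  Identities between elements of tensor products are tested on multilinear forms with values in the ground
  field. In this form the axioms do not mention the chosen representatives in \<open>quot_proj\<close>, and they are stable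
  under exchanging tensor factors.
\<close>

locale hopf_sweedler =
  fixes H :: "('k::field, 'h::ring_1) hopf"
  assumes algebra: "algebra_over (hscale H)"
    and lin_comult0: "lin (hsp H) fscale (comult H)"
    and coassoc0: "trilin (hsp H) (hsp H) (hsp H) (*) G \<Longrightarrow>
      ksum (comult H a) (\<lambda>(a1, a2). ksum (comult H a1) (\<lambda>(b1, b2). G b1 b2 a2))
      = ksum (comult H a) (\<lambda>(a1, a2). ksum (comult H a2) (\<lambda>(b1, b2). G a1 b1 b2))"
    and comult_one0: "bilin (hsp H) (hsp H) (*) F \<Longrightarrow> ksum (comult H 1) (\<lambda>(a1, a2). F a1 a2) = F 1 1"
    and comult_mult0: "bilin (hsp H) (hsp H) (*) F \<Longrightarrow>
      ksum (comult H (a * b)) (\<lambda>(x, y). F x y)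
      = ksum (comult H a) (\<lambda>(a1, a2). ksum (comult H b) (\<lambda>(b1, b2). F (a1 * b1) (a2 * b2)))"
    and lin_counit0: "lin (hsp H) (*) (counit H)"
    and counit_one: "counit H 1 = 1"
    and counit_mult: "counit H (a * b) = counit H a * counit H b"
    and counit_left0: "hsum H (comult H a) (\<lambda>(a1, a2). hscale H (counit H a1) a2) = a"
    and counit_right0: "hsum H (comult H a) (\<lambda>(a1, a2). hscale H (counit H a2) a1) = a"
    and lin_antip0: "lin (hsp H) (hscale H) (antip H)"
    and antip_left0: "hsum H (comult H a) (\<lambda>(a1, a2). antip H a1 * a2) = hscale H (counit H a) 1"
    and antip_right0: "hsum H (comult H a) (\<lambda>(a1, a2). a1 * antip H a2) = hscale H (counit H a) 1"
begin

abbreviation "S \<equiv> antip H"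

sublocale hv: vector_space "hscale H"
  using algebra by (simp add: algebra_over_def)

lemma hscale_mult [simp]: "hscale H c a * b = hscale H c (a * b)" "a * hscale H c b = hscale H c (a * b)"
  using algebra unfolding algebra_over_def by metis+

lemma lin_comult: "lin V (hscale H) F \<Longrightarrow> lin V fscale (\<lambda>x. comult H (F x))"
  using lin_comult0 by (rule lin_compose)

lemma lin_antip: "lin V (hscale H) F \<Longrightarrow> lin V (hscale H) (\<lambda>x. S (F x))"
  using lin_antip0 by (rule lin_compose)

lemma lin_counit: "lin V (hscale H) F \<Longrightarrow> lin V (*) (\<lambda>x. counit H (F x))"
  using lin_counit0 by (rule lin_compose)

lemma lin_mult: "lin V (hscale H) F \<Longrightarrow> lin V (hscale H) (\<lambda>x. F x * b)"
   "lin V (hscale H) F \<Longrightarrow> lin V (hscale H) (\<lambda>x. b * F x)"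
  by (simp_all add: linear_map_def distrib_left distrib_right)

lemmas lin_hopf = lin_comult lin_antip lin_counit lin_mult lin_lsum_intros hv.vector_space_axioms

lemma bilin_lin1: "bilin (hsp H) W s F \<Longrightarrow> b \<in> snd W \<Longrightarrow> lin V (hscale H) G \<Longrightarrow> lin V s (\<lambda>x. F (G x) b)"
  by (rule lin_compose[where p = "\<lambda>a. F a b"]) (auto simp: bilin_def)

lemma bilin_lin2: "bilin U (hsp H) s F \<Longrightarrow> a \<in> snd U \<Longrightarrow> lin V (hscale H) G \<Longrightarrow> lin V s (\<lambda>x. F a (G x))"
  by (rule lin_compose[where p = "\<lambda>b. F a b"]) (auto simp: bilin_def)

lemma trilin_lin1: "trilin (hsp H) V W s F \<Longrightarrow> b \<in> snd V \<Longrightarrow> c \<in> snd W \<Longrightarrow> lin X (hscale H) G \<Longrightarrow> lin X s (\<lambda>x. F (G x) b c)"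
  by (rule lin_compose[where p = "\<lambda>a. F a b c"]) (auto simp: trilin_def)

lemma trilin_lin2: "trilin U (hsp H) W s F \<Longrightarrow> a \<in> snd U \<Longrightarrow> c \<in> snd W \<Longrightarrow> lin X (hscale H) G \<Longrightarrow> lin X s (\<lambda>x. F a (G x) c)"
  by (rule lin_compose[where p = "\<lambda>b. F a b c"]) (auto simp: trilin_def)

lemma trilin_lin3: "trilin U V (hsp H) s F \<Longrightarrow> a \<in> snd U \<Longrightarrow> b \<in> snd V \<Longrightarrow> lin X (hscale H) G \<Longrightarrow> lin X s (\<lambda>x. F a b (G x))"
  by (rule lin_compose[where p = "\<lambda>c. F a b c"]) (auto simp: trilin_def)

context
  fixes s :: "'k \<Rightarrow> 'v \<Rightarrow> 'v::ab_group_add"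
  assumes vs: "vector_space s"
begin

text \<open>A linear functional commutes with \<open>lsum\<close> and keeps \<open>G\<close>
  trilinear, so it turns the claim into the scalar axiom \<open>coassoc0\<close>; functionals
  separate points. The next two lemmas are lifted in the same way.\<close>

lemma coassoc:
  assumes "trilin (hsp H) (hsp H) (hsp H) s G"
  shows "lsum s (comult H a) (\<lambda>(a1, a2). lsum s (comult H a1) (\<lambda>(b1, b2). G b1 b2 a2))
      = lsum s (comult H a) (\<lambda>(a1, a2). lsum s (comult H a2) (\<lambda>(b1, b2). G a1 b1 b2))"
  by (rule functional_ext[OF vs])
     (simp add: lin_lsum_UNIV(2)[OF vs] coassoc0[OF trilin_compose[OF _ assms]])

lemma comult_one:
  assumes "bilin (hsp H) (hsp H) s F"
  shows "lsum s (comult H 1) (\<lambda>(a1, a2). F a1 a2) = F 1 1"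
  by (rule functional_ext[OF vs]) (simp add: lin_lsum_UNIV(2)[OF vs] comult_one0[OF bilin_compose[OF _ assms]])

lemma comult_mult:
  assumes "bilin (hsp H) (hsp H) s F"
  shows "lsum s (comult H (a * b)) (\<lambda>(x, y). F x y)
      = lsum s (comult H a) (\<lambda>(a1, a2). lsum s (comult H b) (\<lambda>(b1, b2). F (a1 * b1) (a2 * b2)))"
  by (rule functional_ext[OF vs]) (simp add: lin_lsum_UNIV(2)[OF vs] comult_mult0[OF bilin_compose[OF _ assms]])

lemma lin_push: "lin (hsp H) s F \<Longrightarrow> lsum s t (\<lambda>(a, b). F (G a b)) = F (hsum H t (\<lambda>(a, b). G a b))"
  by (simp add: lin_lsum_UNIV(2)[OF hv.vector_space_axioms])

lemma lin_hscale: "lin (hsp H) s F \<Longrightarrow> F (hscale H c a) = s c (F a)"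
  using lin_scale[of "hsp H"] by force

lemma counit_left:
  "lin (hsp H) s F \<Longrightarrow> lsum s (comult H a) (\<lambda>(a1, a2). s (counit H a1) (F a2)) = F a"
  using lin_push[of F "comult H a" "\<lambda>a1 a2. hscale H (counit H a1) a2"]
  by (simp add: counit_left0 lin_hscale)

lemma counit_right:
  "lin (hsp H) s F \<Longrightarrow> lsum s (comult H a) (\<lambda>(a1, a2). s (counit H a2) (F a1)) = F a"
  using lin_push[of F "comult H a" "\<lambda>a1 a2. hscale H (counit H a2) a1"]
  by (simp add: counit_right0 lin_hscale)

lemma antip_left:
  "lin (hsp H) s F \<Longrightarrow> lsum s (comult H a) (\<lambda>(a1, a2). F (S a1 * a2)) = s (counit H a) (F 1)"
  by (simp add: lin_push[of F] antip_left0 lin_hscale)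

lemma antip_right:
  "lin (hsp H) s F \<Longrightarrow> lsum s (comult H a) (\<lambda>(a1, a2). F (a1 * S a2)) = s (counit H a) (F 1)"
  by (simp add: lin_push[of F] antip_right0 lin_hscale)

end

text \<open>The iterated comultiplication \<open>a\<^sub>1 \<otimes> a\<^sub>2 \<otimes> a\<^sub>3\<close>.\<close>

definition D3 :: "('k \<Rightarrow> 'v \<Rightarrow> 'v::ab_group_add) \<Rightarrow> 'h \<Rightarrow> ('h \<Rightarrow> 'h \<Rightarrow> 'h \<Rightarrow> 'v) \<Rightarrow> 'v" where
  "D3 s a G = lsum s (comult H a) (\<lambda>(a1, a2). lsum s (comult H a2) (\<lambda>(b1, b2). G a1 b1 b2))"

text \<open>\<open>D3\<close> nests to the right by definition. This is the other bracketing, for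
  use when the first two legs are to be treated as the comultiplication of one element.\<close>

lemma D3_left: "vector_space s \<Longrightarrow> trilin (hsp H) (hsp H) (hsp H) s G \<Longrightarrow>
  D3 s a G = lsum s (comult H a) (\<lambda>(a1, a2). lsum s (comult H a1) (\<lambda>(b1, b2). G b1 b2 a2))"
  by (simp add: D3_def coassoc)

context
  fixes s :: "'k \<Rightarrow> 'v \<Rightarrow> 'v::ab_group_add" and F :: "'h \<Rightarrow> 'h \<Rightarrow> 'v"
  assumes vs: "vector_space s" and F: "bilin (hsp H) (hsp H) s F"
begin

interpretation vector_space s by (rule vs)

lemma lin_F: "lin (hsp H) s (\<lambda>a. F a b)" "lin (hsp H) s (\<lambda>b. F a b)"
  using F by (auto simp: bilin_def)

lemma D3_antip_right2: "D3 s a (\<lambda>a1 a2 a3. F a1 (a2 * S a3)) = F a 1"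
  unfolding D3_def using lin_F
  by (subst antip_right[OF vs, of "F _"]) (auto simp: counit_right[OF vs, of "\<lambda>x. F x 1"])

lemma D3_antip_left2: "D3 s a (\<lambda>a1 a2 a3. F a1 (S a2 * a3)) = F a 1"
  unfolding D3_def using lin_F
  by (subst antip_left[OF vs, of "F _"]) (auto simp: counit_right[OF vs, of "\<lambda>x. F x 1"])

lemma D3_antip_right1: "D3 s a (\<lambda>a1 a2 a3. F (a1 * S a2) a3) = F 1 a"
proof -
  have "trilin (hsp H) (hsp H) (hsp H) s (\<lambda>a1 a2 a3. F (a1 * S a2) a3)"
    unfolding trilin_def by (auto intro!: lin_hopf bilin_lin1[OF F] bilin_lin2[OF F])
  then show ?thesis
    using lin_F by (simp add: D3_left[OF vs] antip_right[OF vs, of "\<lambda>x. F x _"] counit_left[OF vs, of "F 1"])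
qed

end

lemma antip_one: "S 1 = 1"
proof -
  have "bilin (hsp H) (hsp H) (hscale H) (\<lambda>a b. S a * b)"
    unfolding bilin_def by (auto intro!: lin_hopf)
  from comult_one[OF hv.vector_space_axioms this] antip_left0[of 1] counit_one
  show ?thesis by simp
qed

end

section \<open>The antipode reverses products and coproducts\<close>

context hopf_sweedler
begin

lemma lin_D3:
  assumes "vector_space s"
  shows "(\<And>a b c. lin V s (\<lambda>x. G x a b c)) \<Longrightarrow> lin V s (\<lambda>x. D3 s h (\<lambda>a b c. G x a b c))"
    and "lin V (hscale H) T \<Longrightarrow> lin V s (\<lambda>x. D3 s (T x) K)"
  unfolding D3_def using assms by (auto intro!: lin_hopf)

lemmas lin_hopf2 = lin_hopf lin_D3

text \<open>Uniqueness of convolution inverses on H \<otimes> H: \<open>S (a * b)\<close> is a left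
  inverse of the multiplication and \<open>S b * S a\<close> a right inverse. \<open>E\<close> is
  the triple product of left inverse, multiplication and right inverse; collapsing its right half
  leaves the first, collapsing its left half the second.\<close>

lemma antip_mult: "S (a * b) = S b * S a"
proof -
  let ?hs = "hscale H"
  note [simp] = hv.vector_space_axioms
  define E where "E = D3 ?hs a (\<lambda>a1 a2 a3. D3 ?hs b (\<lambda>b1 b2 b3. S (a1 * b1) * (a2 * b2) * (S b3 * S a3)))"
  have "E = D3 ?hs a (\<lambda>a1 a2 a3. D3 ?hs b (\<lambda>b1 b2 b3. S (a1 * b1) * (a2 * (b2 * S b3) * S a3)))"
    by (simp add: E_def mult.assoc)
  also have "\<dots> = D3 ?hs a (\<lambda>a1 a2 a3. S (a1 * b) * (a2 * S a3))"
    by (subst D3_antip_right2) (auto simp: bilin_def intro!: lin_hopf)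
  also have "\<dots> = S (a * b)"
    by (subst D3_antip_right2) (auto simp: bilin_def intro!: lin_hopf)
  finally have 1: "E = S (a * b)" .
  have "E = D3 ?hs a (\<lambda>a1 a2 a3. lsum ?hs (comult H b) (\<lambda>(b1, b2). lsum ?hs (comult H b1) (\<lambda>(u, v). S (a1 * u) * (a2 * v) * (S b2 * S a3))))"
    unfolding E_def by (subst D3_left) (auto simp: trilin_def intro!: lin_hopf)
  also have "\<dots> = lsum ?hs (comult H a) (\<lambda>(a1, a2). lsum ?hs (comult H a1) (\<lambda>(x, y).
     lsum ?hs (comult H b) (\<lambda>(b1, b2). lsum ?hs (comult H b1) (\<lambda>(u, v). S (x * u) * (y * v) * (S b2 * S a2)))))"
    by (subst D3_left) (auto simp: trilin_def intro!: lin_hopf)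
  also have "\<dots> = lsum ?hs (comult H a) (\<lambda>(a1, a2). lsum ?hs (comult H b) (\<lambda>(b1, b2).
     lsum ?hs (comult H a1) (\<lambda>(x, y). lsum ?hs (comult H b1) (\<lambda>(u, v). S (x * u) * (y * v) * (S b2 * S a2)))))"
    by (subst lsum_swap2) auto
  also have "\<dots> = lsum ?hs (comult H a) (\<lambda>(a1, a2). lsum ?hs (comult H b) (\<lambda>(b1, b2).
     lsum ?hs (comult H (a1 * b1)) (\<lambda>(x, y). S x * y * (S b2 * S a2))))"
    by (subst comult_mult) (auto simp: bilin_def intro!: lin_hopf)
  also have "\<dots> = lsum ?hs (comult H a) (\<lambda>(a1, a2). lsum ?hs (comult H b) (\<lambda>(b1, b2).
     ?hs (counit H a1) (?hs (counit H b1) (S b2 * S a2))))"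
    by (subst antip_left[where F = "\<lambda>x. x * _"]) (auto simp: counit_mult intro!: lin_hopf)
  also have "\<dots> = lsum ?hs (comult H a) (\<lambda>(a1, a2). ?hs (counit H a1) (lsum ?hs (comult H b) (\<lambda>(b1, b2).
     ?hs (counit H b1) (S b2 * S a2))))"
    by (subst lin_lsum_UNIV(2)[where G = "?hs _"]) (auto intro!: lin_hopf)
  also have "\<dots> = S b * S a"
    by (subst counit_left, simp, (auto intro!: lin_hopf)[1])
       (subst counit_left[where F = "\<lambda>x. S b * S x"], auto intro!: lin_hopf)
  finally show ?thesis using 1 by simp
qed

text \<open>Cancelling the inner pair \<open>v * S c\<close> and then the outer pair
  \<open>u * S d\<close> shows that a \<mapsto> S(a_2) \<otimes> S(a_1) is a right convolution
  inverse of the comultiplication.\<close>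

lemma antip_comult_aux:
  assumes vs: "vector_space s" and K: "bilin (hsp H) (hsp H) s K"
  shows "lsum s (comult H a) (\<lambda>(y, w). lsum s (comult H y) (\<lambda>(u, v). lsum s (comult H w) (\<lambda>(c, d).
    K (u * S d) (v * S c)))) = s (counit H a) (K 1 1)"
proof -
  note lins = lin_hopf2 bilin_lin1[OF K] bilin_lin2[OF K] vs
  have "lsum s (comult H a) (\<lambda>(y, w). lsum s (comult H y) (\<lambda>(u, v). lsum s (comult H w) (\<lambda>(c, d).
    K (u * S d) (v * S c)))) = lsum s (comult H a) (\<lambda>(u, z). D3 s z (\<lambda>v c d. K (u * S d) (v * S c)))"
    unfolding D3_def by (rule coassoc[OF vs]) (auto simp: trilin_def intro!: lins)
  also have "\<dots> = lsum s (comult H a) (\<lambda>(u, z). K (u * S z) 1)"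
    by (subst D3_antip_right1[OF vs, where F = "\<lambda>x d. K (_ * S d) x"]) (auto simp: bilin_def intro!: lins)
  also have "\<dots> = s (counit H a) (K 1 1)"
    by (rule antip_right[OF vs, where F = "\<lambda>x. K x 1"]) (auto intro!: lins)
  finally show ?thesis .
qed

text \<open>\<Delta> after \<open>S\<close> is a left convolution inverse of \<Delta>, to be matched
  with the right one of \<open>antip_comult_aux\<close>. As for products, \<open>E\<close> is the
  triple convolution product, collapsed from either side.\<close>

lemma comult_antip:
  assumes vs: "vector_space s" and F: "bilin (hsp H) (hsp H) s F"
  shows "lsum s (comult H (S a)) (\<lambda>(x, y). F x y) = lsum s (comult H a) (\<lambda>(a1, a2). F (S a2) (S a1))"
proof -
  interpret vector_space s by (rule vs)
  note lins = lin_hopf2 bilin_lin1[OF F] bilin_lin2[OF F] vs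
  define E where "E = D3 s a (\<lambda>x y w. lsum s (comult H (S x)) (\<lambda>(p, q). lsum s (comult H y) (\<lambda>(u, v).
    lsum s (comult H w) (\<lambda>(c, d). F (p * (u * S d)) (q * (v * S c))))))"
  have "E = lsum s (comult H a) (\<lambda>(x, z). lsum s (comult H (S x)) (\<lambda>(p, q). lsum s (comult H z) (\<lambda>(y, w).
     lsum s (comult H y) (\<lambda>(u, v). lsum s (comult H w) (\<lambda>(c, d). F (p * (u * S d)) (q * (v * S c)))))))"
    unfolding E_def D3_def by (intro lsum_cong2 lsum_swap2[OF vs])
  also have "\<dots> = lsum s (comult H a) (\<lambda>(x, z). lsum s (comult H (S x)) (\<lambda>(p, q). s (counit H z) (F p q)))"
  proof (intro lsum_cong2)
    fix z p q
    show "lsum s (comult H z) (\<lambda>(y, w). lsum s (comult H y) (\<lambda>(u, v). lsum s (comult H w) (\<lambda>(c, d).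
      F (p * (u * S d)) (q * (v * S c))))) = s (counit H z) (F p q)"
      using antip_comult_aux[OF vs, of "\<lambda>x y. F (p * x) (q * y)" z]
      by (simp add: bilin_def lins)
  qed
  also have "\<dots> = lsum s (comult H a) (\<lambda>(x, z). s (counit H z) (lsum s (comult H (S x)) (\<lambda>(p, q). F p q)))"
    by (intro lsum_cong2 lin_lsum_UNIV(2)[OF vs, symmetric]) (auto intro!: lins)
  also have "\<dots> = lsum s (comult H (S a)) (\<lambda>(p, q). F p q)"
    by (rule counit_right[OF vs, where F = "\<lambda>x. lsum s (comult H (S x)) (\<lambda>(p, q). F p q)"]) (auto intro!: lins)
  finally have 1: "E = \<dots>" .
  have "E = lsum s (comult H a) (\<lambda>(r, w). lsum s (comult H r) (\<lambda>(x, y). lsum s (comult H (S x)) (\<lambda>(p, q).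
     lsum s (comult H y) (\<lambda>(u, v). lsum s (comult H w) (\<lambda>(c, d). F (p * u * S d) (q * v * S c))))))"
    unfolding E_def by (subst D3_left[OF vs]) (auto simp: trilin_def mult.assoc intro!: lins)
  also have "\<dots> = lsum s (comult H a) (\<lambda>(r, w). lsum s (comult H r) (\<lambda>(x, y).
     lsum s (comult H (S x * y)) (\<lambda>(m, n). lsum s (comult H w) (\<lambda>(c, d). F (m * S d) (n * S c)))))"
    by (intro lsum_cong2 comult_mult[OF vs, symmetric]) (auto simp: bilin_def intro!: lins)
  also have "\<dots> = lsum s (comult H a) (\<lambda>(r, w). s (counit H r) (
     lsum s (comult H 1) (\<lambda>(m, n). lsum s (comult H w) (\<lambda>(c, d). F (m * S d) (n * S c)))))"
    by (intro lsum_cong2 antip_left[OF vs, where F = "\<lambda>z. lsum s (comult H z) (\<lambda>(m, n). lsum s _ (\<lambda>(c, d). F (m * S d) (n * S c)))"])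
       (auto intro!: lins)
  also have "\<dots> = lsum s (comult H a) (\<lambda>(r, w). s (counit H r) (lsum s (comult H w) (\<lambda>(c, d). F (S d) (S c))))"
    by (subst comult_one[OF vs]) (auto simp: bilin_def intro!: lins)
  also have "\<dots> = lsum s (comult H a) (\<lambda>(c, d). F (S d) (S c))"
    by (rule counit_left[OF vs, where F = "\<lambda>w. lsum s (comult H w) (\<lambda>(c, d). F (S d) (S c))"]) (auto intro!: lins)
  finally show ?thesis using 1 by simp
qed

end

section \<open>Exchange of the two tensor factors\<close>

definition flip :: "('a \<times> 'b \<Rightarrow>\<^sub>0 'k::field) \<Rightarrow> ('b \<times> 'a \<Rightarrow>\<^sub>0 'k)" where
  "flip t = fsum t (\<lambda>(a, b). gen (b, a))"

lemma lsum_flip: "vector_space s \<Longrightarrow> lsum s (flip t) (\<lambda>(x, y). F x y) = lsum s t (\<lambda>(a, b). F b a)"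
  unfolding flip_def by (simp add: lsum_lsum2)

lemma flip_add: "flip (t + u) = flip t + flip u" and flip_fscale: "flip (fscale c t) = fscale c (flip t)"
  by (simp_all add: flip_def lsum_add lsum_fscale vector_space_fscale)

lemma lsum_self: "fsum t gen = t"
proof (rule poly_mapping_eqI)
  fix x
  have "Poly_Mapping.lookup (fsum t gen) x = (\<Sum>y\<in>keys t. Poly_Mapping.lookup t y * (if y = x then 1 else 0))"
    by (simp add: lsum_def lookup_sum lookup_single when_def)
  also have "\<dots> = Poly_Mapping.lookup t x"
    by (auto simp: if_distrib sum.delta in_keys_iff cong: if_cong)
  finally show "Poly_Mapping.lookup (fsum t gen) x = Poly_Mapping.lookup t x" .
qed

lemma flip_flip [simp]: "flip (flip t) = t"
proof -
  have "flip (flip t) = fsum (flip t) (\<lambda>(a, b). gen (b, a))" by (simp add: flip_def)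
  also have "\<dots> = fsum t (\<lambda>(a, b). gen (a, b))" by (rule lsum_flip[OF vector_space_fscale])
  finally show ?thesis by (simp add: split_def lsum_self)
qed

lemma keys_lsum_fscale:
  fixes F :: "'b \<Rightarrow> ('c \<Rightarrow>\<^sub>0 'k::field)"
  shows "keys (fsum t F) \<subseteq> (\<Union>x\<in>keys t. keys (F x))"
proof -
  have "keys (\<Sum>x\<in>A. fscale (c x) (F x)) \<subseteq> (\<Union>x\<in>A. keys (F x))" if "finite A" for A and c :: "'b \<Rightarrow> 'k"
    using that
  proof (induction A)
    case (insert a A)
    then show ?case
      using Poly_Mapping.keys_add[of "fscale (c a) (F a)" "\<Sum>x\<in>A. fscale (c x) (F x)"]
        keys_fscale[OF vector_space_fscale, of "c a" "F a"]
      by fastforce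
  qed simp
  then show ?thesis by (simp add: lsum_def)
qed

lemma keys_flip: "(x, y) \<in> keys (flip t) \<Longrightarrow> (y, x) \<in> keys t"
  using keys_lsum_fscale[of t "\<lambda>(a, b). gen (b, a) :: _ \<Rightarrow>\<^sub>0 'c"] by (auto simp: flip_def split: if_splits)

subsection \<open>The co-opposite Hopf algebra\<close>

text \<open>Together with \<open>copM\<close> on bimodules this exchanges left and right coactions.
  Besides inverting the braiding, the symmetry later yields the right coaction of the dual from the
  left one.\<close>

definition cop :: "('k::field, 'h) hopf \<Rightarrow> ('k, 'h) hopf" where
  "cop H = H\<lparr>comult := \<lambda>a. flip (comult H a), antip := inv (antip H)\<rparr>"

lemma cop_simps [simp]: "hscale (cop H) = hscale H" "comult (cop H) a = flip (comult H a)"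
  "counit (cop H) = counit H" "antip (cop H) = inv (antip H)"
  by (simp_all add: cop_def)

locale hopf_sweedler_bij = hopf_sweedler H for H :: "('k::field, 'h::ring_1) hopf" +
  assumes bij: "bij (antip H)"
begin

abbreviation "T \<equiv> inv (antip H)"

lemma ST [simp]: "S (T x) = x" and TS [simp]: "T (S x) = x"
  using bij by (auto simp: bij_def surj_f_inv_f)

lemma S_inj: "S x = S y \<Longrightarrow> x = y"
  using bij by (auto simp: bij_def inj_def)

lemma S_lsum: "S (hsum H t (\<lambda>(a, b). F a b)) = hsum H t (\<lambda>(a, b). S (F a b))"
  by (rule lin_lsum_UNIV(2)[OF hv.vector_space_axioms lin_antip0])

lemma S_hscale: "S (hscale H c a) = hscale H c (S a)"
  using lin_scale[OF lin_antip0] by force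

lemma lin_T0: "lin (hsp H) (hscale H) T"
  by (intro linI; rule S_inj) (auto simp: S_hscale lin_add[OF lin_antip0])

lemma hopf_sweedler_cop: "hopf_sweedler (cop H)"
proof
  note fl = lsum_flip[OF vector_space_mult] lsum_flip[OF hv.vector_space_axioms]
  show "algebra_over (hscale (cop H))" using algebra by simp
  show "lin (hsp (cop H)) fscale (comult (cop H))"
    using lin_comult0 by (simp add: linear_map_def flip_add flip_fscale)
  show "ksum (comult (cop H) a) (\<lambda>(a1, a2). ksum (comult (cop H) a1) (\<lambda>(b1, b2). G b1 b2 a2))
      = ksum (comult (cop H) a) (\<lambda>(a1, a2). ksum (comult (cop H) a2) (\<lambda>(b1, b2). G a1 b1 b2))"
    if "trilin (hsp (cop H)) (hsp (cop H)) (hsp (cop H)) (*) G" for G a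
    using that unfolding cop_simps fl by (intro coassoc0[symmetric, of "\<lambda>a b c. G c b a"]) (simp add: trilin_def)
  show "ksum (comult (cop H) 1) (\<lambda>(a1, a2). F a1 a2) = F 1 1"
    if "bilin (hsp (cop H)) (hsp (cop H)) (*) F" for F
    using that unfolding cop_simps fl by (intro comult_one0[of "\<lambda>a b. F b a"]) (simp add: bilin_def)
  show "ksum (comult (cop H) (a * b)) (\<lambda>(x, y). F x y) = ksum (comult (cop H) a)
      (\<lambda>(a1, a2). ksum (comult (cop H) b) (\<lambda>(b1, b2). F (a1 * b1) (a2 * b2)))"
    if "bilin (hsp (cop H)) (hsp (cop H)) (*) F" for F a b
    using that unfolding cop_simps fl by (intro comult_mult0[of "\<lambda>a b. F b a"]) (simp add: bilin_def)
  show "lin (hsp (cop H)) (*) (counit (cop H))" "counit (cop H) 1 = 1"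
    "counit (cop H) (a * b) = counit (cop H) a * counit (cop H) b" for a b
    using lin_counit0 counit_one counit_mult by simp_all
  show "lsum (hscale (cop H)) (comult (cop H) a) (\<lambda>(a1, a2). hscale (cop H) (counit (cop H) a1) a2) = a"
    "lsum (hscale (cop H)) (comult (cop H) a) (\<lambda>(a1, a2). hscale (cop H) (counit (cop H) a2) a1) = a" for a
    using counit_right0 counit_left0 by (simp_all add: fl)
  show "lin (hsp (cop H)) (hscale (cop H)) (antip (cop H))" using lin_T0 by simp
  \<comment> \<open>\<open>S\<close> is injective and antimultiplicative: it carries
    \<open>T a2 * a1\<close> to \<open>S a1 * a2\<close>, which is the antipode axiom of
    \<open>H\<close>.\<close>
  show "lsum (hscale (cop H)) (comult (cop H) a) (\<lambda>(a1, a2). antip (cop H) a1 * a2)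
      = hscale (cop H) (counit (cop H) a) 1" for a
    by (rule S_inj) (simp add: antip_left0 fl S_lsum antip_mult S_hscale antip_one)
  show "lsum (hscale (cop H)) (comult (cop H) a) (\<lambda>(a1, a2). a1 * antip (cop H) a2)
      = hscale (cop H) (counit (cop H) a) 1" for a
    by (rule S_inj) (simp add: antip_right0 fl S_lsum antip_mult S_hscale antip_one)
qed

lemma bij_T: "bij T" using bij by (rule bij_imp_bij_inv)

end

subsection \<open>Covariant bimodules and the braiding\<close>

abbreviation msp :: "('k::field, 'h, 'm::ab_group_add) bimod \<Rightarrow> ('k, 'm) vspace" where
  "msp M \<equiv> (bscale M, carr M)"

section \<open>Quotient projections and the tensor square over \<open>H\<close>\<close>

lemma
  fixes R :: "('x \<Rightarrow>\<^sub>0 'k::field) set"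
  shows linear_quot_proj: "lin (fscale, UNIV) fscale (quot_proj R)"
  and quot_proj_rel: "r \<in> R \<Longrightarrow> quot_proj R r = 0"
  and quot_proj_minus: "quot_proj R t - t \<in> fspan R"
proof -
  have R: "is_quot_proj R (quot_proj R)" by (rule is_quot_proj_quot_proj)
  interpret vector_space "fscale :: 'k \<Rightarrow> ('x \<Rightarrow>\<^sub>0 'k) \<Rightarrow> _" by (rule vector_space_fscale)
  show "lin (fscale, UNIV) fscale (quot_proj R)"
    using R by (simp add: is_quot_proj_def lin_UNIV_iff vector_space_fscale)
  show "r \<in> R \<Longrightarrow> quot_proj R r = 0" "quot_proj R t - t \<in> fspan R"
    using R by (simp_all add: is_quot_proj_def span_base)
qed

lemma lin_minus:
  assumes "lin (r, UNIV) s F"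
  shows "F (x - y) = F x - F y"
  using lin_add[OF assms, of "x - y" y] by simp

lemma quot_proj_idem: "quot_proj R (quot_proj R t) = quot_proj R t"
proof -
  have "quot_proj R (quot_proj R t - t) = 0"
    using is_quot_proj_quot_proj[of R] by (simp add: is_quot_proj_def)
  then show ?thesis by (simp add: lin_minus[OF linear_quot_proj])
qed

lemma quot_proj_relI: "t - u \<in> R \<Longrightarrow> quot_proj R t = quot_proj R u"
  using quot_proj_rel[of "t - u" R] by (simp add: lin_minus[OF linear_quot_proj])

lemma quot_proj_relI_add: "t - u - v \<in> R \<Longrightarrow> quot_proj R t = quot_proj R u + quot_proj R v"
  using quot_proj_rel[of "t - u - v" R] by (simp add: lin_minus[OF linear_quot_proj] diff_eq_eq add.commute)

lemma quot_proj_relI_scale: "t - fscale c u \<in> R \<Longrightarrow> quot_proj R t = fscale c (quot_proj R u)"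
  using quot_proj_relI[of t "fscale c u" R] lin_scale[OF linear_quot_proj] by simp

lemma htens_add:
  assumes "set (us @ [x, y] @ vs) \<subseteq> carr M"
  shows "htens M (us @ [x + y] @ vs) = htens M (us @ [x] @ vs) + htens M (us @ [y] @ vs)"
proof -
  have "gen (us @ [x + y] @ vs) - gen (us @ [x] @ vs) - gen (us @ [y] @ vs) \<in> htens_rels M (length us + 1 + length vs)"
    using assms unfolding htens_rels_def by blast
  from quot_proj_relI_add[OF this] show ?thesis by (simp add: htens_def)
qed

lemma htens_scale:
  assumes "set (us @ [x] @ vs) \<subseteq> carr M"
  shows "htens M (us @ [bscale M c x] @ vs) = fscale c (htens M (us @ [x] @ vs))"
proof -
  have "gen (us @ [bscale M c x] @ vs) - fscale c (gen (us @ [x] @ vs)) \<in> htens_rels M (length us + 1 + length vs)"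
    using assms unfolding htens_rels_def by blast
  from quot_proj_relI_scale[OF this] show ?thesis by (simp add: htens_def)
qed

lemma htens_balanced_append:
  assumes "set (us @ [x, y] @ vs) \<subseteq> carr M"
  shows "htens M (us @ [ract M x h, y] @ vs) = htens M (us @ [x, lact M h y] @ vs)"
proof -
  have "gen (us @ [ract M x h, y] @ vs) - gen (us @ [x, lact M h y] @ vs) \<in> htens_rels M (length us + 2 + length vs)"
    using assms unfolding htens_rels_def by blast
  from quot_proj_relI[OF this] show ?thesis by (simp add: htens_def)
qed

lemma htens_add1: "x \<in> carr M \<Longrightarrow> x' \<in> carr M \<Longrightarrow> y \<in> carr M \<Longrightarrow> htens M [x + x', y] = htens M [x, y] + htens M [x', y]"
  and htens_add2: "x \<in> carr M \<Longrightarrow> y \<in> carr M \<Longrightarrow> y' \<in> carr M \<Longrightarrow> htens M [x, y + y'] = htens M [x, y] + htens M [x, y']"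
  and htens_scale1: "x \<in> carr M \<Longrightarrow> y \<in> carr M \<Longrightarrow> htens M [bscale M c x, y] = fscale c (htens M [x, y])"
  and htens_scale2: "x \<in> carr M \<Longrightarrow> y \<in> carr M \<Longrightarrow> htens M [x, bscale M c y] = fscale c (htens M [x, y])"
  and htens_balanced: "x \<in> carr M \<Longrightarrow> y \<in> carr M \<Longrightarrow> htens M [ract M x h, y] = htens M [x, lact M h y]"
  using htens_add[of "[]" x x' "[y]" M] htens_add[of "[x]" y y' "[]" M] htens_scale[of "[]" x "[y]" M c]
    htens_scale[of "[x]" y "[]" M c] htens_balanced_append[of "[]" x y "[]" M h] by simp_all

lemma length_2_split: "length us + 1 + length vs = 2 \<longleftrightarrow> (\<exists>x. us = [x] \<and> vs = []) \<or> (\<exists>x. us = [] \<and> vs = [x])"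
  by (cases us; cases vs) (auto simp: length_Suc_conv)

text \<open>Universal property of the tensor square: a bilinear balanced \<open>U\<close> kills the
  relations. The carrier enters only through these relations, so the formula holds for all
  \<open>x\<close> and \<open>y\<close>.\<close>

lemma lsum_htens2:
  fixes M :: "('k::field, 'h, 'm::ab_group_add) bimod"
  assumes vs: "vector_space s" and U: "bilin (msp M) (msp M) s (\<lambda>x y. U [x, y])"
    and bal: "\<And>x y h. x \<in> carr M \<Longrightarrow> y \<in> carr M \<Longrightarrow> U [ract M x h, y] = U [x, lact M h y]"
  shows "lsum s (htens M [x, y]) U = U [x, y]"
proof -
  have "lsum s r U = 0" if "r \<in> htens_rels M 2" for r
  proof -
    have "us = [] \<and> vs = []" if "length us + 2 + length vs = 2" for us vs :: "'m list"
      using that by simp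
    then show ?thesis
      using that U bal unfolding htens_rels_def length_2_split
      by (auto simp: vs lsum_minus lsum_fscale bilin_def linear_map_def)
  qed
  then show ?thesis unfolding htens_def
    by (subst quot_proj_factor[OF linear_lsum[OF vs]]) (auto simp: vs numeral_2_eq_2)
qed

lemma subspace_htpow:
  fixes M :: "('k::field, 'h, 'm::ab_group_add) bimod"
  shows "module.subspace fscale (htpow M n)"
proof -
  interpret vector_space "fscale :: 'k \<Rightarrow> ('m list \<Rightarrow>\<^sub>0 'k) \<Rightarrow> _" by (rule vector_space_fscale)
  show ?thesis by (simp add: htpow_def)
qed

lemma htens_in_htpow2:
  fixes M :: "('k::field, 'h, 'm::ab_group_add) bimod"
  assumes "x \<in> carr M" "y \<in> carr M"
  shows "htens M [x, y] \<in> htpow M 2"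
proof -
  interpret vector_space "fscale :: 'k \<Rightarrow> ('m list \<Rightarrow>\<^sub>0 'k) \<Rightarrow> _" by (rule vector_space_fscale)
  show ?thesis using assms unfolding htpow_def by (intro span_base) (force intro: exI[of _ "[x, y]"])
qed

lemma htpow2_eqI:
  fixes M :: "('k::field, 'h, 'm::ab_group_add) bimod"
  assumes "lin (fscale, UNIV) s f" "lin (fscale, UNIV) s g" "vector_space s"
    and "\<And>x y. x \<in> carr M \<Longrightarrow> y \<in> carr M \<Longrightarrow> f (htens M [x, y]) = g (htens M [x, y])" "t \<in> htpow M 2"
  shows "f t = g t"
proof -
  have l: "Vector_Spaces.linear fscale s f" "Vector_Spaces.linear fscale s g"
    using assms(1-3) by (simp_all add: lin_UNIV_iff vector_space_fscale)
  interpret vector_space_pair "fscale :: 'k \<Rightarrow> ('m list \<Rightarrow>\<^sub>0 'k) \<Rightarrow> _" s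
    by (intro vector_space_pair.intro vector_space_fscale assms)
  show ?thesis
  proof (rule linear_eq_on_span[OF l])
    show "t \<in> fspan {htens M xs | xs. set xs \<subseteq> carr M \<and> length xs = 2}" using assms(5) by (simp add: htpow_def)
  next
    fix b assume "b \<in> {htens M xs | xs. set xs \<subseteq> carr M \<and> length xs = 2}"
    then obtain xs where "b = htens M xs" "set xs \<subseteq> carr M" "length xs = 2" by auto
    then show "f b = g b" using assms(4) by (auto simp: length_Suc_conv numeral_2_eq_2)
  qed
qed

lemma htpow2_in_subspace:
  fixes M :: "('k::field, 'h, 'm::ab_group_add) bimod"
  assumes "lin (fscale, UNIV) s f" "vector_space s" "module.subspace s A"
    and "\<And>x y. x \<in> carr M \<Longrightarrow> y \<in> carr M \<Longrightarrow> f (htens M [x, y]) \<in> A" "t \<in> htpow M 2"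
  shows "f t \<in> A"
proof -
  interpret vector_space_pair "fscale :: 'k \<Rightarrow> ('m list \<Rightarrow>\<^sub>0 'k) \<Rightarrow> _" s
    by (intro vector_space_pair.intro vector_space_fscale assms)
  have l: "Vector_Spaces.linear fscale s f"
    using assms(1,2) by (simp add: lin_UNIV_iff vector_space_fscale)
  have "t \<in> fspan {htens M xs | xs. set xs \<subseteq> carr M \<and> length xs = 2}" using assms(5) by (simp add: htpow_def)
  then show ?thesis
  proof (induction rule: vs1.span_induct_alt)
    case base
    then show ?case using vs2.subspace_0[OF assms(3)] by (simp add: linear_0[OF l])
  next
    case (step c b t)
    then obtain xs where "b = htens M xs" "set xs \<subseteq> carr M" "length xs = 2" by auto
    then have "f b \<in> A" using assms(4) by (auto simp: length_Suc_conv numeral_2_eq_2)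
    with step show ?case
      by (auto simp: linear_add[OF l] linear_scale[OF l] intro!: vs2.subspace_add vs2.subspace_scale assms(3))
  qed
qed

text \<open>There are two levels. From the axioms collected here the braiding is well defined and
  left and right linear; this is used for vector fields as well as one-forms. The comodule axioms
  added in \<open>bicov_bimodule\<close> serve to invert the braiding, which is done for
  one-forms.\<close>

locale cov_bimodule = hopf_sweedler H for H :: "('k::field, 'h::ring_1) hopf" +
  fixes M :: "('k, 'h, 'm::ab_group_add) bimod"
  assumes vsM: "vector_space (bscale M)"
    and subspace_carr: "module.subspace (bscale M) (carr M)"
    and lact_closed: "x \<in> carr M \<Longrightarrow> lact M h x \<in> carr M"
    and ract_closed: "x \<in> carr M \<Longrightarrow> ract M x h \<in> carr M"
    and bilin_lact: "bilin (hsp H) (msp M) (bscale M) (lact M)"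
    and bilin_ract: "bilin (msp M) (hsp H) (bscale M) (ract M)"
    and lact_lact: "x \<in> carr M \<Longrightarrow> lact M a (lact M b x) = lact M (a * b) x"
    and ract_ract: "x \<in> carr M \<Longrightarrow> ract M (ract M x a) b = ract M x (a * b)"
    and lact_ract: "x \<in> carr M \<Longrightarrow> lact M a (ract M x b) = ract M (lact M a x) b"
    and lact_one: "x \<in> carr M \<Longrightarrow> lact M 1 x = x"
    and ract_one: "x \<in> carr M \<Longrightarrow> ract M x 1 = x"
    and lcoact_keys: "x \<in> carr M \<Longrightarrow> (a, y) \<in> keys (lcoact M x) \<Longrightarrow> y \<in> carr M"
    and rcoact_keys: "x \<in> carr M \<Longrightarrow> (y, a) \<in> keys (rcoact M x) \<Longrightarrow> y \<in> carr M"
    and lin_lcoact0: "lin (msp M) fscale (lcoact M)"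
    and lin_rcoact0: "lin (msp M) fscale (rcoact M)"
    and lcoact_lact0: "bilin (hsp H) (msp M) (*) F \<Longrightarrow> x \<in> carr M \<Longrightarrow>
      ksum (lcoact M (lact M h x)) (\<lambda>(a, y). F a y)
      = ksum (comult H h) (\<lambda>(h1, h2). ksum (lcoact M x) (\<lambda>(a, y). F (h1 * a) (lact M h2 y)))"
    and lcoact_ract0: "bilin (hsp H) (msp M) (*) F \<Longrightarrow> x \<in> carr M \<Longrightarrow>
      ksum (lcoact M (ract M x h)) (\<lambda>(a, y). F a y)
      = ksum (comult H h) (\<lambda>(h1, h2). ksum (lcoact M x) (\<lambda>(a, y). F (a * h1) (ract M y h2)))"
    and rcoact_lact0: "bilin (msp M) (hsp H) (*) G \<Longrightarrow> x \<in> carr M \<Longrightarrow>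
      ksum (rcoact M (lact M h x)) (\<lambda>(y, a). G y a)
      = ksum (comult H h) (\<lambda>(h1, h2). ksum (rcoact M x) (\<lambda>(y, a). G (lact M h1 y) (h2 * a)))"
    and rcoact_ract0: "bilin (msp M) (hsp H) (*) G \<Longrightarrow> x \<in> carr M \<Longrightarrow>
      ksum (rcoact M (ract M x h)) (\<lambda>(y, a). G y a)
      = ksum (comult H h) (\<lambda>(h1, h2). ksum (rcoact M x) (\<lambda>(y, a). G (ract M y h1) (a * h2)))"
begin

lemmas [simp] = lact_closed ract_closed lact_lact ract_ract lact_ract lact_one ract_one

lemma lin_lact:
  assumes "lin V (bscale M) F" "\<And>x. x \<in> snd V \<Longrightarrow> F x \<in> carr M"
  shows "lin V (bscale M) (\<lambda>x. lact M h (F x))"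
  using assms bilin_lact by (simp add: bilin_def linear_map_def)

lemma lin_lact2: "lin V (hscale H) F \<Longrightarrow> m \<in> carr M \<Longrightarrow> lin V (bscale M) (\<lambda>x. lact M (F x) m)"
  using bilin_lact by (simp add: bilin_def linear_map_def)

lemma lin_ract:
  assumes "lin V (bscale M) F" "\<And>x. x \<in> snd V \<Longrightarrow> F x \<in> carr M"
  shows "lin V (bscale M) (\<lambda>x. ract M (F x) h)"
  using assms bilin_ract by (simp add: bilin_def linear_map_def)

lemma lin_ract2: "lin V (hscale H) F \<Longrightarrow> m \<in> carr M \<Longrightarrow> lin V (bscale M) (\<lambda>x. ract M m (F x))"
  using bilin_ract by (simp add: bilin_def linear_map_def)

lemma lin_lcoact:
  assumes "lin V (bscale M) F" "\<And>x. x \<in> snd V \<Longrightarrow> F x \<in> carr M"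
  shows "lin V fscale (\<lambda>x. lcoact M (F x))"
  using assms lin_lcoact0 by (simp add: linear_map_def)

lemma lin_rcoact:
  assumes "lin V (bscale M) F" "\<And>x. x \<in> snd V \<Longrightarrow> F x \<in> carr M"
  shows "lin V fscale (\<lambda>x. rcoact M (F x))"
  using assms lin_rcoact0 by (simp add: linear_map_def)

lemma lin_htens1:
  assumes "lin V (bscale M) F" "\<And>x. x \<in> snd V \<Longrightarrow> F x \<in> carr M" "y \<in> carr M"
  shows "lin V fscale (\<lambda>x. htens M [F x, y])"
  using assms by (simp add: linear_map_def htens_add1 htens_scale1)

lemma lin_htens2:
  assumes "lin V (bscale M) F" "\<And>x. x \<in> snd V \<Longrightarrow> F x \<in> carr M" "y \<in> carr M"
  shows "lin V fscale (\<lambda>x. htens M [y, F x])"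
  using assms by (simp add: linear_map_def htens_add2 htens_scale2)

lemmas lin_bim = lin_hopf2 lin_lact lin_lact2 lin_ract lin_ract2 lin_lcoact lin_rcoact lin_htens1 lin_htens2
  vsM vector_space_fscale

lemma bilin_lin1M:
  assumes "bilin (msp M) W s F" "b \<in> snd W" "lin V (bscale M) G" "\<And>x. x \<in> snd V \<Longrightarrow> G x \<in> carr M"
  shows "lin V s (\<lambda>x. F (G x) b)"
  using assms by (simp add: bilin_def linear_map_def)

lemma bilin_lin2M:
  assumes "bilin U (msp M) s F" "a \<in> snd U" "lin V (bscale M) G" "\<And>x. x \<in> snd V \<Longrightarrow> G x \<in> carr M"
  shows "lin V s (\<lambda>x. F a (G x))"
  using assms by (simp add: bilin_def linear_map_def)

lemma trilin_lin1M:
  assumes "trilin (msp M) V W s F" "b \<in> snd V" "c \<in> snd W" "lin X (bscale M) G" "\<And>x. x \<in> snd X \<Longrightarrow> G x \<in> carr M"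
  shows "lin X s (\<lambda>x. F (G x) b c)"
  using assms by (simp add: trilin_def linear_map_def)

lemma trilin_lin3M:
  assumes "trilin U V (msp M) s F" "a \<in> snd U" "b \<in> snd V" "lin X (bscale M) G" "\<And>x. x \<in> snd X \<Longrightarrow> G x \<in> carr M"
  shows "lin X s (\<lambda>x. F a b (G x))"
  using assms by (simp add: trilin_def linear_map_def)

text \<open>The iterated coactions \<open>m\<^sub>-\<^sub>2 \<otimes> m\<^sub>-\<^sub>1 \<otimes> m\<^sub>0\<close> and \<open>m\<^sub>0 \<otimes> m\<^sub>1 \<otimes> m\<^sub>2\<close>.\<close>

definition L3 :: "('k \<Rightarrow> 'v \<Rightarrow> 'v::ab_group_add) \<Rightarrow> 'm \<Rightarrow> ('h \<Rightarrow> 'h \<Rightarrow> 'm \<Rightarrow> 'v) \<Rightarrow> 'v" where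
  "L3 s x K = lsum s (lcoact M x) (\<lambda>(a, m). lsum s (comult H a) (\<lambda>(a1, a2). K a1 a2 m))"

definition R3 :: "('k \<Rightarrow> 'v \<Rightarrow> 'v::ab_group_add) \<Rightarrow> 'm \<Rightarrow> ('m \<Rightarrow> 'h \<Rightarrow> 'h \<Rightarrow> 'v) \<Rightarrow> 'v" where
  "R3 s x K = lsum s (rcoact M x) (\<lambda>(n, b). lsum s (comult H b) (\<lambda>(b1, b2). K n b1 b2))"

lemma L3_cong: "x \<in> carr M \<Longrightarrow> (\<And>a b m. m \<in> carr M \<Longrightarrow> K a b m = K' a b m) \<Longrightarrow> L3 s x K = L3 s x K'"
  unfolding L3_def by (intro lsum_cong2) (auto dest: lcoact_keys)

lemma R3_cong: "x \<in> carr M \<Longrightarrow> (\<And>a b m. m \<in> carr M \<Longrightarrow> K m a b = K' m a b) \<Longrightarrow> R3 s x K = R3 s x K'"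
  unfolding R3_def by (intro lsum_cong2) (auto dest: rcoact_keys)

lemma D3_cong: "(\<And>a b c. K a b c = K' a b c) \<Longrightarrow> D3 s x K = D3 s x K'"
  by (metis ext)

context
  fixes s :: "'k \<Rightarrow> 'v \<Rightarrow> 'v::ab_group_add"
  assumes vs: "vector_space s"
begin

lemma lin_L3:
  "x \<in> carr M \<Longrightarrow> (\<And>a b m. m \<in> carr M \<Longrightarrow> lin V s (\<lambda>z. G z a b m)) \<Longrightarrow> lin V s (\<lambda>z. L3 s x (\<lambda>a b m. G z a b m))"
  "lin V (bscale M) F \<Longrightarrow> (\<And>x. x \<in> snd V \<Longrightarrow> F x \<in> carr M) \<Longrightarrow> lin V s (\<lambda>z. L3 s (F z) K)"
  unfolding L3_def using vs by (auto intro!: lin_bim dest: lcoact_keys)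

lemma lin_R3:
  "x \<in> carr M \<Longrightarrow> (\<And>a b m. m \<in> carr M \<Longrightarrow> lin V s (\<lambda>z. G z m a b)) \<Longrightarrow> lin V s (\<lambda>z. R3 s x (\<lambda>m a b. G z m a b))"
  "lin V (bscale M) F \<Longrightarrow> (\<And>x. x \<in> snd V \<Longrightarrow> F x \<in> carr M) \<Longrightarrow> lin V s (\<lambda>z. R3 s (F z) K)"
  unfolding R3_def using vs by (auto intro!: lin_bim dest: rcoact_keys)

lemma lcoact_lact:
  assumes "bilin (hsp H) (msp M) s F" "x \<in> carr M"
  shows "lsum s (lcoact M (lact M h x)) (\<lambda>(a, y). F a y)
      = lsum s (comult H h) (\<lambda>(h1, h2). lsum s (lcoact M x) (\<lambda>(a, y). F (h1 * a) (lact M h2 y)))"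
  by (rule functional_ext[OF vs]) (simp add: lin_lsum_UNIV(2)[OF vs] assms lcoact_lact0[OF bilin_compose[OF _ assms(1)]])

lemma lcoact_ract:
  assumes "bilin (hsp H) (msp M) s F" "x \<in> carr M"
  shows "lsum s (lcoact M (ract M x h)) (\<lambda>(a, y). F a y)
      = lsum s (comult H h) (\<lambda>(h1, h2). lsum s (lcoact M x) (\<lambda>(a, y). F (a * h1) (ract M y h2)))"
  by (rule functional_ext[OF vs]) (simp add: lin_lsum_UNIV(2)[OF vs] assms lcoact_ract0[OF bilin_compose[OF _ assms(1)]])

lemma rcoact_lact:
  assumes "bilin (msp M) (hsp H) s F" "x \<in> carr M"
  shows "lsum s (rcoact M (lact M h x)) (\<lambda>(y, a). F y a)
      = lsum s (comult H h) (\<lambda>(h1, h2). lsum s (rcoact M x) (\<lambda>(y, a). F (lact M h1 y) (h2 * a)))"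
  by (rule functional_ext[OF vs]) (simp add: lin_lsum_UNIV(2)[OF vs] assms rcoact_lact0[OF bilin_compose[OF _ assms(1)]])

lemma rcoact_ract:
  assumes "bilin (msp M) (hsp H) s F" "x \<in> carr M"
  shows "lsum s (rcoact M (ract M x h)) (\<lambda>(y, a). F y a)
      = lsum s (comult H h) (\<lambda>(h1, h2). lsum s (rcoact M x) (\<lambda>(y, a). F (ract M y h1) (a * h2)))"
  by (rule functional_ext[OF vs]) (simp add: lin_lsum_UNIV(2)[OF vs] assms rcoact_ract0[OF bilin_compose[OF _ assms(1)]])

lemma L3_lsum_swap: "L3 s x (\<lambda>a b m. lsum s t (\<lambda>(u, v). G a b m u v)) = lsum s t (\<lambda>(u, v). L3 s x (\<lambda>a b m. G a b m u v))"
proof -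
  have "L3 s x (\<lambda>a b m. lsum s t (\<lambda>(u, v). G a b m u v))
    = lsum s (lcoact M x) (\<lambda>(a, m). lsum s t (\<lambda>(u, v). lsum s (comult H a) (\<lambda>(a1, a2). G a1 a2 m u v)))"
    unfolding L3_def by (intro lsum_cong2 lsum_swap2[OF vs])
  also have "\<dots> = lsum s t (\<lambda>(u, v). L3 s x (\<lambda>a b m. G a b m u v))"
    unfolding L3_def by (rule lsum_swap2[OF vs])
  finally show ?thesis .
qed

lemma R3_lsum_swap: "R3 s x (\<lambda>m a b. lsum s t (\<lambda>(u, v). G a b m u v)) = lsum s t (\<lambda>(u, v). R3 s x (\<lambda>m a b. G a b m u v))"
proof -
  have "R3 s x (\<lambda>m a b. lsum s t (\<lambda>(u, v). G a b m u v))
    = lsum s (rcoact M x) (\<lambda>(m, a). lsum s t (\<lambda>(u, v). lsum s (comult H a) (\<lambda>(a1, a2). G a1 a2 m u v)))"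
    unfolding R3_def by (intro lsum_cong2 lsum_swap2[OF vs])
  also have "\<dots> = lsum s t (\<lambda>(u, v). R3 s x (\<lambda>m a b. G a b m u v))"
    unfolding R3_def by (rule lsum_swap2[OF vs])
  finally show ?thesis .
qed

text \<open>The coaction of \<open>h x\<close> comultiplies \<open>h\<close> once, and
  multiplicativity of the comultiplication splits the leg in \<open>H\<close> once more. For the
  left coaction the legs of \<open>h\<close> arrive bracketed to the left, whence
  \<open>D3_left\<close>; for the right coaction they arrive in the bracketing that defines
  \<open>D3\<close>.\<close>

lemma L3_lact:
  assumes K: "trilin (hsp H) (hsp H) (msp M) s K" and x: "x \<in> carr M"
  shows "L3 s (lact M h x) K = D3 s h (\<lambda>h1 h2 h3. L3 s x (\<lambda>a1 a2 m. K (h1 * a1) (h2 * a2) (lact M h3 m)))"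
proof -
  note lins = lin_bim trilin_lin1[OF K] trilin_lin2[OF K] trilin_lin3M[OF K] vs x
  have "L3 s (lact M h x) K = lsum s (comult H h) (\<lambda>(h1, h2). lsum s (lcoact M x) (\<lambda>(a, m).
      lsum s (comult H (h1 * a)) (\<lambda>(p, q). K p q (lact M h2 m))))"
    unfolding L3_def by (rule lcoact_lact[OF _ x]) (auto simp: bilin_def intro!: lins)
  also have "\<dots> = lsum s (comult H h) (\<lambda>(h1, h2). lsum s (lcoact M x) (\<lambda>(a, m). lsum s (comult H h1) (\<lambda>(p, q).
      lsum s (comult H a) (\<lambda>(a1, a2). K (p * a1) (q * a2) (lact M h2 m)))))"
    by (intro lsum_cong2 comult_mult[OF vs]) (auto simp: bilin_def intro!: lins dest: lcoact_keys[OF x])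
  also have "\<dots> = lsum s (comult H h) (\<lambda>(h1, h2). lsum s (comult H h1) (\<lambda>(p, q). L3 s x (\<lambda>a1 a2 m. K (p * a1) (q * a2) (lact M h2 m))))"
    unfolding L3_def by (intro lsum_cong2 lsum_swap2[OF vs])
  also have "\<dots> = D3 s h (\<lambda>h1 h2 h3. L3 s x (\<lambda>a1 a2 m. K (h1 * a1) (h2 * a2) (lact M h3 m)))"
    by (rule D3_left[OF vs, symmetric]) (auto simp: trilin_def intro!: lins lin_L3)
  finally show ?thesis .
qed

lemma L3_ract:
  assumes K: "trilin (hsp H) (hsp H) (msp M) s K" and x: "x \<in> carr M"
  shows "L3 s (ract M x h) K = D3 s h (\<lambda>h1 h2 h3. L3 s x (\<lambda>a1 a2 m. K (a1 * h1) (a2 * h2) (ract M m h3)))"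
proof -
  note lins = lin_bim trilin_lin1[OF K] trilin_lin2[OF K] trilin_lin3M[OF K] vs x
  have "L3 s (ract M x h) K = lsum s (comult H h) (\<lambda>(h1, h2). lsum s (lcoact M x) (\<lambda>(a, m).
      lsum s (comult H (a * h1)) (\<lambda>(p, q). K p q (ract M m h2))))"
    unfolding L3_def by (rule lcoact_ract[OF _ x]) (auto simp: bilin_def intro!: lins)
  also have "\<dots> = lsum s (comult H h) (\<lambda>(h1, h2). L3 s x (\<lambda>a1 a2 m. lsum s (comult H h1) (\<lambda>(p, q).
      K (a1 * p) (a2 * q) (ract M m h2))))"
    unfolding L3_def
    by (intro lsum_cong2 comult_mult[OF vs]) (auto simp: bilin_def intro!: lins dest: lcoact_keys[OF x])
  also have "\<dots> = lsum s (comult H h) (\<lambda>(h1, h2). lsum s (comult H h1) (\<lambda>(p, q). L3 s x (\<lambda>a1 a2 m. K (a1 * p) (a2 * q) (ract M m h2))))"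
    by (intro lsum_cong2 L3_lsum_swap)
  also have "\<dots> = D3 s h (\<lambda>h1 h2 h3. L3 s x (\<lambda>a1 a2 m. K (a1 * h1) (a2 * h2) (ract M m h3)))"
    by (rule D3_left[OF vs, symmetric]) (auto simp: trilin_def intro!: lins lin_L3)
  finally show ?thesis .
qed

lemma R3_lact:
  assumes K: "trilin (msp M) (hsp H) (hsp H) s K" and x: "x \<in> carr M"
  shows "R3 s (lact M h x) K = D3 s h (\<lambda>h1 h2 h3. R3 s x (\<lambda>n b1 b2. K (lact M h1 n) (h2 * b1) (h3 * b2)))"
proof -
  note lins = lin_bim trilin_lin1M[OF K] trilin_lin2[OF K] trilin_lin3[OF K] vs x
  have "R3 s (lact M h x) K = lsum s (comult H h) (\<lambda>(h1, h2). lsum s (rcoact M x) (\<lambda>(n, b).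
      lsum s (comult H (h2 * b)) (\<lambda>(p, q). K (lact M h1 n) p q)))"
    unfolding R3_def by (rule rcoact_lact[OF _ x]) (auto simp: bilin_def intro!: lins)
  also have "\<dots> = lsum s (comult H h) (\<lambda>(h1, h2). lsum s (rcoact M x) (\<lambda>(n, b). lsum s (comult H h2) (\<lambda>(p, q).
      lsum s (comult H b) (\<lambda>(b1, b2). K (lact M h1 n) (p * b1) (q * b2)))))"
    by (intro lsum_cong2 comult_mult[OF vs]) (auto simp: bilin_def intro!: lins dest: rcoact_keys[OF x])
  also have "\<dots> = D3 s h (\<lambda>h1 h2 h3. R3 s x (\<lambda>n b1 b2. K (lact M h1 n) (h2 * b1) (h3 * b2)))"
    unfolding R3_def D3_def by (intro lsum_cong2 lsum_swap2[OF vs])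
  finally show ?thesis .
qed

lemma R3_ract:
  assumes K: "trilin (msp M) (hsp H) (hsp H) s K" and x: "x \<in> carr M"
  shows "R3 s (ract M x h) K = D3 s h (\<lambda>h1 h2 h3. R3 s x (\<lambda>n b1 b2. K (ract M n h1) (b1 * h2) (b2 * h3)))"
proof -
  note lins = lin_bim trilin_lin1M[OF K] trilin_lin2[OF K] trilin_lin3[OF K] vs x
  have "R3 s (ract M x h) K = lsum s (comult H h) (\<lambda>(h1, h2). lsum s (rcoact M x) (\<lambda>(n, b).
      lsum s (comult H (b * h2)) (\<lambda>(p, q). K (ract M n h1) p q)))"
    unfolding R3_def by (rule rcoact_ract[OF _ x]) (auto simp: bilin_def intro!: lins)
  also have "\<dots> = lsum s (comult H h) (\<lambda>(h1, h2). R3 s x (\<lambda>n b1 b2. lsum s (comult H h2) (\<lambda>(p, q).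
      K (ract M n h1) (b1 * p) (b2 * q))))"
    unfolding R3_def
    by (intro lsum_cong2 comult_mult[OF vs]) (auto simp: bilin_def intro!: lins dest: rcoact_keys[OF x])
  also have "\<dots> = D3 s h (\<lambda>h1 h2 h3. R3 s x (\<lambda>n b1 b2. K (ract M n h1) (b1 * h2) (b2 * h3)))"
    unfolding D3_def by (intro lsum_cong2 R3_lsum_swap)
  finally show ?thesis .
qed

lemma L3_D3_swap: "L3 s x (\<lambda>a b m. D3 s h (\<lambda>u v w. G a b m u v w)) = D3 s h (\<lambda>u v w. L3 s x (\<lambda>a b m. G a b m u v w))"
  unfolding D3_def L3_lsum_swap ..

end

lemmas lin_bim2 = lin_bim lin_L3 lin_R3

lemma ht_lact_htens: "ht_lact M h (htens M [x, y]) = htens M [lact M h x, y]"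
  unfolding ht_lact_def
  by (subst lsum_htens2[OF vector_space_fscale]) (auto simp: bilin_def htens_balanced intro!: lin_bim)

lemma ht_ract_htens: "ht_ract M (htens M [x, y]) h = htens M [x, ract M y h]"
  unfolding ht_ract_def
  by (subst lsum_htens2[OF vector_space_fscale]) (auto simp: bilin_def htens_balanced intro!: lin_bim)

lemma lin_ht_lact: "lin (fscale, UNIV) fscale (ht_lact M h)"
  and lin_ht_ract: "lin (fscale, UNIV) fscale (\<lambda>t. ht_ract M t h)"
  unfolding ht_lact_def[abs_def] ht_ract_def by (auto simp: linear_map_def lsum_add lsum_fscale vector_space_fscale)

lemma lin_wor: "lin (fscale, UNIV) fscale (wor H M)"
  unfolding wor_def[abs_def] by (auto simp: linear_map_def lsum_add lsum_fscale vector_space_fscale)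

text \<open>The braiding as a function of two elements. \<open>wor\<close> sums over the entries of
  a representative; it takes this value on the class of a pair once \<open>worf_balanced\<close> is
  known.\<close>

definition worf :: "'m \<Rightarrow> 'm \<Rightarrow> ('m list \<Rightarrow>\<^sub>0 'k)" where
  "worf x y = L3 fscale x (\<lambda>a1 a2 m. R3 fscale y (\<lambda>n b1 b2.
     htens M [ract M (lact M a1 n) (S b1), ract M (lact M (S a2) m) b2]))"

lemma htens_balanced':
  "x \<in> carr M \<Longrightarrow> y \<in> carr M \<Longrightarrow> htens M [ract M x (a * b), y] = htens M [ract M x a, lact M b y]"
  using htens_balanced[of "ract M x a" M y b] by simp

lemma bilin_worf: "bilin (msp M) (msp M) fscale worf"
  unfolding worf_def[abs_def] by (auto simp: bilin_def intro!: lin_bim2)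

lemma worf_balanced:
  assumes x: "x \<in> carr M" and y: "y \<in> carr M"
  shows "worf (ract M x h) y = worf x (lact M h y)"
proof -
  note vf = vector_space_fscale
  have "worf (ract M x h) y = D3 fscale h (\<lambda>h1 h2 h3. L3 fscale x (\<lambda>a1 a2 m. R3 fscale y (\<lambda>n b1 b2.
     htens M [ract M (lact M (a1 * h1) n) (S b1), ract M (lact M (S (a2 * h2)) (ract M m h3)) b2])))"
    unfolding worf_def by (rule L3_ract[OF vf _ x]) (auto simp: trilin_def y intro!: lin_bim2)
  \<comment> \<open>\<open>S (a2 * h2) = S h2 * S a2\<close>, and \<open>S h2\<close> crosses the
    tensor sign to the left, where it joins \<open>S b1\<close> to form
    \<open>S (h2 * b1)\<close>.\<close>
  also have "\<dots> = D3 fscale h (\<lambda>h1 h2 h3. L3 fscale x (\<lambda>a1 a2 m. R3 fscale y (\<lambda>n b1 b2.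
     htens M [ract M (lact M a1 (lact M h1 n)) (S (h2 * b1)), ract M (lact M (S a2) m) (h3 * b2)])))"
    by (intro D3_cong L3_cong R3_cong x y) (simp add: antip_mult htens_balanced')
  also have "\<dots> = L3 fscale x (\<lambda>a1 a2 m. D3 fscale h (\<lambda>h1 h2 h3. R3 fscale y (\<lambda>n b1 b2.
     htens M [ract M (lact M a1 (lact M h1 n)) (S (h2 * b1)), ract M (lact M (S a2) m) (h3 * b2)])))"
    by (rule L3_D3_swap[OF vf, symmetric])
  also have "\<dots> = worf x (lact M h y)"
    unfolding worf_def
    by (intro L3_cong x R3_lact[OF vf _ y, symmetric]) (auto simp: trilin_def intro!: lin_bim2)
  finally show ?thesis .
qed

lemma wor_htens: "wor H M (htens M [x, y]) = worf x y"
  unfolding wor_def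
  by (subst lsum_htens2[OF vector_space_fscale])
     (use bilin_worf worf_balanced in \<open>auto simp: worf_def[abs_def] L3_def R3_def\<close>)

lemma worf_lact:
  assumes x: "x \<in> carr M" and y: "y \<in> carr M"
  shows "worf (lact M h x) y = ht_lact M h (worf x y)"
proof -
  note vf = vector_space_fscale
  have "worf (lact M h x) y = D3 fscale h (\<lambda>h1 h2 h3. L3 fscale x (\<lambda>a1 a2 m. R3 fscale y (\<lambda>n b1 b2.
     htens M [ract M (lact M (h1 * a1) n) (S b1), ract M (lact M (S (h2 * a2)) (lact M h3 m)) b2])))"
    unfolding worf_def by (rule L3_lact[OF vf _ x]) (auto simp: trilin_def y intro!: lin_bim2)
  \<comment> \<open>\<open>S (h2 * a2) * h3 = S a2 * (S h2 * h3)\<close>: the legs of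
    \<open>h\<close> in the second factor cancel, and all of \<open>h\<close> remains in the
    first.\<close>
  also have "\<dots> = D3 fscale h (\<lambda>h1 h2 h3. L3 fscale x (\<lambda>a1 a2 m. R3 fscale y (\<lambda>n b1 b2.
     htens M [ract M (lact M (h1 * a1) n) (S b1), ract M (lact M (S a2 * (S h2 * h3)) m) b2])))"
    by (intro D3_cong L3_cong R3_cong x y) (simp add: antip_mult mult.assoc)
  also have "\<dots> = L3 fscale x (\<lambda>a1 a2 m. R3 fscale y (\<lambda>n b1 b2.
     htens M [ract M (lact M (h * a1) n) (S b1), ract M (lact M (S a2 * 1) m) b2]))"
    by (rule D3_antip_left2[OF vf, where F = "\<lambda>p q. L3 fscale x (\<lambda>a1 a2 m. R3 fscale y (\<lambda>n b1 b2.
     htens M [ract M (lact M (p * a1) n) (S b1), ract M (lact M (S a2 * q) m) b2]))"])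
       (auto simp: bilin_def x y intro!: lin_bim2)
  also have "\<dots> = L3 fscale x (\<lambda>a1 a2 m. R3 fscale y (\<lambda>n b1 b2.
     ht_lact M h (htens M [ract M (lact M a1 n) (S b1), ract M (lact M (S a2) m) b2])))"
    by (intro L3_cong R3_cong x y) (simp add: ht_lact_htens)
  also have "\<dots> = ht_lact M h (worf x y)"
    unfolding worf_def L3_def R3_def by (simp add: lin_lsum_UNIV(2)[OF vf lin_ht_lact])
  finally show ?thesis .
qed

lemma worf_ract:
  assumes x: "x \<in> carr M" and y: "y \<in> carr M"
  shows "worf x (ract M y h) = ht_ract M (worf x y) h"
proof -
  note vf = vector_space_fscale
  have "worf x (ract M y h) = L3 fscale x (\<lambda>a1 a2 m. D3 fscale h (\<lambda>h1 h2 h3. R3 fscale y (\<lambda>n b1 b2.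
     htens M [ract M (lact M a1 (ract M n h1)) (S (b1 * h2)), ract M (lact M (S a2) m) (b2 * h3)])))"
    unfolding worf_def by (intro L3_cong x R3_ract[OF vf _ y]) (auto simp: trilin_def intro!: lin_bim2)
  also have "\<dots> = L3 fscale x (\<lambda>a1 a2 m. D3 fscale h (\<lambda>h1 h2 h3. R3 fscale y (\<lambda>n b1 b2.
     htens M [ract M (lact M a1 n) (h1 * S h2 * S b1), ract M (lact M (S a2) m) (b2 * h3)])))"
    by (intro D3_cong L3_cong R3_cong x y) (simp add: antip_mult mult.assoc)
  also have "\<dots> = L3 fscale x (\<lambda>a1 a2 m. R3 fscale y (\<lambda>n b1 b2.
     htens M [ract M (lact M a1 n) (1 * S b1), ract M (lact M (S a2) m) (b2 * h)]))"
    by (intro L3_cong x D3_antip_right1[OF vf, where F = "\<lambda>p q. R3 fscale y (\<lambda>n b1 b2.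
     htens M [ract M (lact M _ n) (p * S b1), ract M (lact M (S _) _) (b2 * q)])"])
       (auto simp: bilin_def y intro!: lin_bim2)
  also have "\<dots> = L3 fscale x (\<lambda>a1 a2 m. R3 fscale y (\<lambda>n b1 b2.
     ht_ract M (htens M [ract M (lact M a1 n) (S b1), ract M (lact M (S a2) m) b2]) h))"
    by (intro L3_cong R3_cong x y) (simp add: ht_ract_htens)
  also have "\<dots> = ht_ract M (worf x y) h"
    unfolding worf_def L3_def R3_def by (simp add: lin_lsum_UNIV(2)[OF vf lin_ht_ract])
  finally show ?thesis .
qed

lemma wor_ht_lact: "t \<in> htpow M 2 \<Longrightarrow> wor H M (ht_lact M h t) = ht_lact M h (wor H M t)"
  by (rule htpow2_eqI[where M = M, OF _ _ vector_space_fscale])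
     (auto simp: ht_lact_htens wor_htens worf_lact intro: lin_compose[OF lin_wor lin_ht_lact] lin_compose[OF lin_ht_lact lin_wor])

lemma wor_ht_ract: "t \<in> htpow M 2 \<Longrightarrow> wor H M (ht_ract M t h) = ht_ract M (wor H M t) h"
  by (rule htpow2_eqI[where M = M, OF _ _ vector_space_fscale])
     (auto simp: ht_ract_htens wor_htens worf_ract intro: lin_compose[OF lin_wor lin_ht_ract] lin_compose[OF lin_ht_ract lin_wor])

lemma ht_lact_closed: "t \<in> htpow M 2 \<Longrightarrow> ht_lact M h t \<in> htpow M 2"
  by (rule htpow2_in_subspace[where M = M, OF lin_ht_lact vector_space_fscale subspace_htpow])
     (auto simp: ht_lact_htens htens_in_htpow2)

lemma ht_ract_closed: "t \<in> htpow M 2 \<Longrightarrow> ht_ract M t h \<in> htpow M 2"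
  by (rule htpow2_in_subspace[where M = M, OF lin_ht_ract vector_space_fscale subspace_htpow])
     (auto simp: ht_ract_htens htens_in_htpow2)

lemma worf_closed: "x \<in> carr M \<Longrightarrow> y \<in> carr M \<Longrightarrow> worf x y \<in> htpow M 2"
  unfolding worf_def L3_def R3_def split_def
  by (intro lsum_in_subspace vector_space_fscale subspace_htpow htens_in_htpow2 ract_closed lact_closed)
     (metis lcoact_keys rcoact_keys prod.collapse)+

lemma wor_closed: "t \<in> htpow M 2 \<Longrightarrow> wor H M t \<in> htpow M 2"
  by (rule htpow2_in_subspace[where M = M, OF lin_wor vector_space_fscale subspace_htpow])
     (auto simp: wor_htens worf_closed)

text \<open>Tested on bilinear forms like the axioms of the locale, because
  \<open>lcoact M m\<close> is a formal sum that need not be the chosen representative of 1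
  \<otimes> m.\<close>

definition lcoinv :: "'m \<Rightarrow> bool" where
  "lcoinv m \<longleftrightarrow> m \<in> carr M \<and>
     (\<forall>F. bilin (hsp H) (msp M) (*) F \<longrightarrow> ksum (lcoact M m) (\<lambda>(a, y). F a y) = F 1 m)"

definition rcoinv :: "'m \<Rightarrow> bool" where
  "rcoinv n \<longleftrightarrow> n \<in> carr M \<and>
     (\<forall>F. bilin (msp M) (hsp H) (*) F \<longrightarrow> ksum (rcoact M n) (\<lambda>(y, a). F y a) = F n 1)"

lemma lcoinv_lsum:
  assumes "vector_space s" "lcoinv m" "bilin (hsp H) (msp M) s F"
  shows "lsum s (lcoact M m) (\<lambda>(a, y). F a y) = F 1 m"
  using assms(2) unfolding lcoinv_def
  by (intro functional_ext[OF assms(1)]) (simp add: lin_lsum_UNIV(2)[OF assms(1)] bilin_compose[OF _ assms(3)])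

lemma rcoinv_lsum:
  assumes "vector_space s" "rcoinv m" "bilin (msp M) (hsp H) s F"
  shows "lsum s (rcoact M m) (\<lambda>(y, a). F y a) = F m 1"
  using assms(2) unfolding rcoinv_def
  by (intro functional_ext[OF assms(1)]) (simp add: lin_lsum_UNIV(2)[OF assms(1)] bilin_compose[OF _ assms(3)])

lemma worf_coinv:
  assumes m: "lcoinv m" and n: "rcoinv n"
  shows "worf m n = htens M [n, m]"
proof -
  note vf = vector_space_fscale
  have mc: "m \<in> carr M" and nc: "n \<in> carr M" using m n by (auto simp: lcoinv_def rcoinv_def)
  have "worf m n = fsum (comult H 1) (\<lambda>(a1, a2). R3 fscale n (\<lambda>n b1 b2.
     htens M [ract M (lact M a1 n) (S b1), ract M (lact M (S a2) m) b2]))"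
    unfolding worf_def L3_def by (rule lcoinv_lsum[OF vf m]) (auto simp: bilin_def nc intro!: lin_bim2)
  also have "\<dots> = R3 fscale n (\<lambda>n b1 b2. htens M [ract M (lact M 1 n) (S b1), ract M (lact M (S 1) m) b2])"
    by (rule comult_one[OF vf]) (auto simp: bilin_def nc mc intro!: lin_bim2)
  also have "\<dots> = fsum (comult H 1) (\<lambda>(b1, b2). htens M [ract M (lact M 1 n) (S b1), ract M (lact M (S 1) m) b2])"
    unfolding R3_def by (rule rcoinv_lsum[OF vf n]) (auto simp: bilin_def mc intro!: lin_bim2)
  also have "\<dots> = htens M [ract M (lact M 1 n) (S 1), ract M (lact M (S 1) m) 1]"
    by (rule comult_one[OF vf]) (auto simp: bilin_def nc mc intro!: lin_bim2)
  finally show ?thesis by (simp add: antip_one nc mc)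
qed

end

section \<open>Decomposition into coinvariant elements\<close>

locale bicov_bimodule = cov_bimodule H M
  for H :: "('k::field, 'h::ring_1) hopf" and M :: "('k, 'h, 'm::ab_group_add) bimod" +
  assumes lcoassoc0: "trilin (hsp H) (hsp H) (msp M) (*) G \<Longrightarrow> x \<in> carr M \<Longrightarrow>
      ksum (lcoact M x) (\<lambda>(a, y). ksum (lcoact M y) (\<lambda>(b, z). G a b z))
      = ksum (lcoact M x) (\<lambda>(a, y). ksum (comult H a) (\<lambda>(a1, a2). G a1 a2 y))"
    and lcounit: "x \<in> carr M \<Longrightarrow> lsum (bscale M) (lcoact M x) (\<lambda>(a, y). bscale M (counit H a) y) = x"
    and rcoassoc0: "trilin (msp M) (hsp H) (hsp H) (*) G' \<Longrightarrow> x \<in> carr M \<Longrightarrow>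
      ksum (rcoact M x) (\<lambda>(y, a). ksum (rcoact M y) (\<lambda>(z, b). G' z b a))
      = ksum (rcoact M x) (\<lambda>(y, a). ksum (comult H a) (\<lambda>(a1, a2). G' y a1 a2))"
    and rcounit: "x \<in> carr M \<Longrightarrow> lsum (bscale M) (rcoact M x) (\<lambda>(y, a). bscale M (counit H a) y) = x"
begin

lemma lcoassoc:
  assumes "vector_space s" "trilin (hsp H) (hsp H) (msp M) s G" "x \<in> carr M"
  shows "lsum s (lcoact M x) (\<lambda>(a, y). lsum s (lcoact M y) (\<lambda>(b, z). G a b z)) = L3 s x G"
  unfolding L3_def
  by (rule functional_ext[OF assms(1)])
     (simp add: lin_lsum_UNIV(2)[OF assms(1)] lcoassoc0[OF trilin_compose[OF _ assms(2)] assms(3)])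

lemma rcoassoc:
  assumes "vector_space s" "trilin (msp M) (hsp H) (hsp H) s G" "x \<in> carr M"
  shows "lsum s (rcoact M x) (\<lambda>(y, a). lsum s (rcoact M y) (\<lambda>(z, b). G z b a)) = R3 s x G"
  unfolding R3_def
  by (rule functional_ext[OF assms(1)])
     (simp add: lin_lsum_UNIV(2)[OF assms(1)] rcoassoc0[OF trilin_compose[OF _ assms(2)] assms(3)])

text \<open>The coinvariant elements \<open>S(x\<^sub>-\<^sub>1) x\<^sub>0\<close> and \<open>x\<^sub>0 S(x\<^sub>1)\<close>.\<close>

definition lc :: "'m \<Rightarrow> 'm" where
  "lc x = lsum (bscale M) (lcoact M x) (\<lambda>(a, y). lact M (S a) y)"

definition rc :: "'m \<Rightarrow> 'm" where
  "rc x = lsum (bscale M) (rcoact M x) (\<lambda>(y, a). ract M y (S a))"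

lemma lc_closed [simp]: "x \<in> carr M \<Longrightarrow> lc x \<in> carr M"
  unfolding lc_def by (intro lsum_in_subspace vsM subspace_carr) (auto dest: lcoact_keys)

lemma rc_closed [simp]: "x \<in> carr M \<Longrightarrow> rc x \<in> carr M"
  unfolding rc_def by (intro lsum_in_subspace vsM subspace_carr) (auto dest: rcoact_keys)

lemma lin_carr_lsum:
  assumes "lin (msp M) s F" "\<And>a b. (a, b) \<in> keys t \<Longrightarrow> G a b \<in> carr M"
  shows "F (lsum (bscale M) t (\<lambda>(a, b). G a b)) = lsum s t (\<lambda>(a, b). F (G a b))"
  unfolding split_def using assms by (intro lin_lsum[OF vsM subspace_carr assms(1)]) auto

text \<open>Coassociativity lets the last two legs of the iterated coaction be formed from
  \<open>m\<close> alone, so that \<open>lc m\<close> appears. Together with \<open>R3_rc\<close>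
  this rewrites the braiding in terms of coinvariants.\<close>

lemma L3_lc:
  assumes "vector_space s" and K: "bilin (hsp H) (msp M) s K" and x: "x \<in> carr M"
  shows "L3 s x (\<lambda>a1 a2 m. K a1 (lact M (S a2) m)) = lsum s (lcoact M x) (\<lambda>(a, m). K a (lc m))"
proof -
  note lins = lin_bim2 bilin_lin1[OF K] bilin_lin2M[OF K]
  have "L3 s x (\<lambda>a1 a2 m. K a1 (lact M (S a2) m)) = lsum s (lcoact M x) (\<lambda>(a, y). lsum s (lcoact M y) (\<lambda>(b, z). K a (lact M (S b) z)))"
    by (rule lcoassoc[OF assms(1) _ x, symmetric]) (auto simp: trilin_def intro!: lins)
  also have "\<dots> = lsum s (lcoact M x) (\<lambda>(a, m). K a (lc m))"
    unfolding lc_def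
    by (intro lsum_cong2 lin_carr_lsum[symmetric]) (use K in \<open>auto simp: bilin_def dest: lcoact_keys[OF x] lcoact_keys[OF lcoact_keys[OF x]]\<close>)
  finally show ?thesis .
qed

lemma R3_rc:
  assumes "vector_space s" and K: "bilin (msp M) (hsp H) s K" and x: "x \<in> carr M"
  shows "R3 s x (\<lambda>n b1 b2. K (ract M n (S b1)) b2) = lsum s (rcoact M x) (\<lambda>(n, b). K (rc n) b)"
proof -
  note lins = lin_bim2 bilin_lin1M[OF K] bilin_lin2[OF K]
  have "R3 s x (\<lambda>n b1 b2. K (ract M n (S b1)) b2) = lsum s (rcoact M x) (\<lambda>(y, a). lsum s (rcoact M y) (\<lambda>(z, b). K (ract M z (S b)) a))"
    by (rule rcoassoc[OF assms(1) _ x, symmetric]) (auto simp: trilin_def intro!: lins)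
  also have "\<dots> = lsum s (rcoact M x) (\<lambda>(n, b). K (rc n) b)"
    unfolding rc_def
    by (intro lsum_cong2 lin_carr_lsum[where F = "\<lambda>z. K z _", symmetric])
       (use K in \<open>auto simp: bilin_def dest: rcoact_keys[OF x] rcoact_keys[OF rcoact_keys[OF x]]\<close>)
  finally show ?thesis .
qed

lemma lcoinv_lc:
  assumes x: "x \<in> carr M"
  shows "lcoinv (lc x)"
  unfolding lcoinv_def
proof (intro conjI allI impI)
  fix F :: "'h \<Rightarrow> 'm \<Rightarrow> 'k" assume F: "bilin (hsp H) (msp M) (*) F"
  note vm = vector_space_mult
  note lins = lin_bim2 bilin_lin1[OF F] bilin_lin2M[OF F] vm
  have "ksum (lcoact M (lc x)) (\<lambda>(c, z). F c z)
      = ksum (lcoact M x) (\<lambda>(a, y). ksum (lcoact M (lact M (S a) y)) (\<lambda>(c, z). F c z))"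
    unfolding lc_def
    by (rule lin_carr_lsum[where F = "\<lambda>x. ksum (lcoact M x) (\<lambda>(c, z). F c z)"]) (auto intro!: lins dest: lcoact_keys[OF x])
  also have "\<dots> = ksum (lcoact M x) (\<lambda>(a, y). ksum (comult H (S a)) (\<lambda>(p, q). ksum (lcoact M y) (\<lambda>(c, z). F (p * c) (lact M q z))))"
    by (intro lsum_cong2 lcoact_lact[OF vm F]) (auto dest: lcoact_keys[OF x])
  \<comment> \<open>\<open>S\<close> reverses the two legs, so \<open>S a2\<close> lands beside the
    leg \<open>c\<close> of \<open>y\<close>. By coassociativity \<open>a1\<close>,
    \<open>a2\<close>, \<open>c\<close> are consecutive legs of one element, and
    \<open>S a2 * c\<close> cancels.\<close>
  also have "\<dots> = ksum (lcoact M x) (\<lambda>(a, y). ksum (comult H a) (\<lambda>(a1, a2). ksum (lcoact M y) (\<lambda>(c, z). F (S a2 * c) (lact M (S a1) z))))"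
    by (intro lsum_cong2 comult_antip[OF vm]) (auto simp: bilin_def intro!: lins dest: lcoact_keys[OF x] lcoact_keys[OF lcoact_keys[OF x]])
  also have "\<dots> = ksum (lcoact M x) (\<lambda>(a, y). ksum (lcoact M y) (\<lambda>(c, z). ksum (comult H a) (\<lambda>(a1, a2). F (S a2 * c) (lact M (S a1) z))))"
    by (intro lsum_cong2 lsum_swap2[OF vm])
  also have "\<dots> = ksum (lcoact M x) (\<lambda>(a', z). ksum (comult H a') (\<lambda>(a, c). ksum (comult H a) (\<lambda>(a1, a2). F (S a2 * c) (lact M (S a1) z))))"
    by (subst lcoassoc[OF vm _ x]) (auto simp: trilin_def L3_def intro!: lins)
  also have "\<dots> = ksum (lcoact M x) (\<lambda>(a', z). D3 (*) a' (\<lambda>a1 a2 c. F (S a2 * c) (lact M (S a1) z)))"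
    by (intro lsum_cong2 D3_left[OF vm, symmetric]) (auto simp: trilin_def intro!: lins dest: lcoact_keys[OF x])
  also have "\<dots> = ksum (lcoact M x) (\<lambda>(a', z). F 1 (lact M (S a') z))"
    by (intro lsum_cong2 D3_antip_left2[OF vm, where F = "\<lambda>u v. F v (lact M (S u) _)"])
       (auto simp: bilin_def intro!: lins dest: lcoact_keys[OF x])
  also have "\<dots> = F 1 (lc x)"
    unfolding lc_def using F by (intro lin_carr_lsum[symmetric]) (auto simp: bilin_def dest: lcoact_keys[OF x])
  finally show "ksum (lcoact M (lc x)) (\<lambda>(a, y). F a y) = F 1 (lc x)" .
qed (simp add: x)

lemma rcoinv_rc:
  assumes x: "x \<in> carr M"
  shows "rcoinv (rc x)"
  unfolding rcoinv_def
proof (intro conjI allI impI)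
  fix F :: "'m \<Rightarrow> 'h \<Rightarrow> 'k" assume F: "bilin (msp M) (hsp H) (*) F"
  note vm = vector_space_mult
  note lins = lin_bim2 bilin_lin1M[OF F] bilin_lin2[OF F] vm
  have "ksum (rcoact M (rc x)) (\<lambda>(z, c). F z c)
      = ksum (rcoact M x) (\<lambda>(y, a). ksum (rcoact M (ract M y (S a))) (\<lambda>(z, c). F z c))"
    unfolding rc_def
    by (rule lin_carr_lsum[where F = "\<lambda>x. ksum (rcoact M x) (\<lambda>(c, z). F c z)"]) (auto intro!: lins dest: rcoact_keys[OF x])
  also have "\<dots> = ksum (rcoact M x) (\<lambda>(y, a). ksum (comult H (S a)) (\<lambda>(p, q). ksum (rcoact M y) (\<lambda>(z, c). F (ract M z p) (c * q))))"
    by (intro lsum_cong2 rcoact_ract[OF vm F]) (auto dest: rcoact_keys[OF x])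
  also have "\<dots> = ksum (rcoact M x) (\<lambda>(y, a). ksum (comult H a) (\<lambda>(a1, a2). ksum (rcoact M y) (\<lambda>(z, c). F (ract M z (S a2)) (c * S a1))))"
    by (intro lsum_cong2 comult_antip[OF vm]) (auto simp: bilin_def intro!: lins dest: rcoact_keys[OF x] rcoact_keys[OF rcoact_keys[OF x]])
  also have "\<dots> = ksum (rcoact M x) (\<lambda>(y, a). ksum (rcoact M y) (\<lambda>(z, c). ksum (comult H a) (\<lambda>(a1, a2). F (ract M z (S a2)) (c * S a1))))"
    by (intro lsum_cong2 lsum_swap2[OF vm])
  also have "\<dots> = ksum (rcoact M x) (\<lambda>(z, b). ksum (comult H b) (\<lambda>(c, a). ksum (comult H a) (\<lambda>(a1, a2). F (ract M z (S a2)) (c * S a1))))"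
    by (subst rcoassoc[OF vm _ x]) (auto simp: trilin_def R3_def intro!: lins)
  also have "\<dots> = ksum (rcoact M x) (\<lambda>(z, b). F (ract M z (S b)) 1)"
    unfolding D3_def[symmetric]
    by (intro lsum_cong2 D3_antip_right1[OF vm, where F = "\<lambda>u v. F (ract M _ (S v)) u"])
       (auto simp: bilin_def intro!: lins dest: rcoact_keys[OF x])
  also have "\<dots> = F (rc x) 1"
    unfolding rc_def using F
    by (intro lin_carr_lsum[where F = "\<lambda>z. F z 1", symmetric]) (auto simp: bilin_def dest: rcoact_keys[OF x])
  finally show "ksum (rcoact M (rc x)) (\<lambda>(y, a). F y a) = F (rc x) 1" .
qed (simp add: x)

text \<open>The expression \<open>x\<^sub>-\<^sub>2 S(x\<^sub>-\<^sub>1) x\<^sub>0\<close> collapses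
  by antipode and counit, so left coinvariants generate the bimodule from the left.\<close>

lemma lc_decomp:
  assumes x: "x \<in> carr M"
  shows "lsum (bscale M) (lcoact M x) (\<lambda>(a, m). lact M a (lc m)) = x"
proof -
  have "lsum (bscale M) (lcoact M x) (\<lambda>(a, m). lact M a (lc m)) = L3 (bscale M) x (\<lambda>a1 a2 m. lact M a1 (lact M (S a2) m))"
    by (rule L3_lc[OF vsM bilin_lact x, symmetric])
  also have "\<dots> = L3 (bscale M) x (\<lambda>a1 a2 m. lact M (a1 * S a2) m)"
    by (intro L3_cong x) simp
  also have "\<dots> = lsum (bscale M) (lcoact M x) (\<lambda>(a, y). bscale M (counit H a) (lact M 1 y))"
    unfolding L3_def by (intro lsum_cong2 antip_right[OF vsM, where F = "\<lambda>z. lact M z _"]) (auto intro!: lin_bim dest: lcoact_keys[OF x])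
  also have "\<dots> = lsum (bscale M) (lcoact M x) (\<lambda>(a, y). bscale M (counit H a) y)"
    by (intro lsum_cong2) (auto dest: lcoact_keys[OF x])
  finally show ?thesis by (simp add: lcounit x)
qed

lemma rc_decomp:
  assumes x: "x \<in> carr M"
  shows "lsum (bscale M) (rcoact M x) (\<lambda>(n, b). ract M (rc n) b) = x"
proof -
  have "lsum (bscale M) (rcoact M x) (\<lambda>(n, b). ract M (rc n) b) = R3 (bscale M) x (\<lambda>n b1 b2. ract M (ract M n (S b1)) b2)"
    by (rule R3_rc[OF vsM bilin_ract x, symmetric])
  also have "\<dots> = R3 (bscale M) x (\<lambda>n b1 b2. ract M n (S b1 * b2))"
    by (intro R3_cong x) simp
  also have "\<dots> = lsum (bscale M) (rcoact M x) (\<lambda>(y, a). bscale M (counit H a) (ract M y 1))"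
    unfolding R3_def by (intro lsum_cong2 antip_left[OF vsM, where F = "\<lambda>z. ract M _ z"]) (auto intro!: lin_bim dest: rcoact_keys[OF x])
  also have "\<dots> = lsum (bscale M) (rcoact M x) (\<lambda>(y, a). bscale M (counit H a) y)"
    by (intro lsum_cong2) (auto dest: rcoact_keys[OF x])
  finally show ?thesis by (simp add: rcounit x)
qed

lemma htens_decomp:
  assumes x: "x \<in> carr M" and y: "y \<in> carr M"
  shows "fsum (lcoact M x) (\<lambda>(a, m). fsum (rcoact M y) (\<lambda>(n, b). htens M [lact M a (lc m), ract M (rc n) b]))
     = htens M [x, y]"
proof -
  have "fsum (lcoact M x) (\<lambda>(a, m). fsum (rcoact M y) (\<lambda>(n, b). htens M [lact M a (lc m), ract M (rc n) b]))
    = fsum (lcoact M x) (\<lambda>(a, m). htens M [lact M a (lc m), y])"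
    by (subst (2) rc_decomp[OF y, symmetric], intro lsum_cong2 lin_carr_lsum[where F = "\<lambda>z. htens M [_, z]", symmetric])
       (auto intro!: lin_bim dest: lcoact_keys[OF x] rcoact_keys[OF y])
  also have "\<dots> = htens M [x, y]"
    by (subst (2) lc_decomp[OF x, symmetric], rule lin_carr_lsum[where F = "\<lambda>z. htens M [z, _]", symmetric])
       (auto intro!: lin_bim y dest: lcoact_keys[OF x])
  finally show ?thesis .
qed

text \<open>Compared with \<open>htens_decomp\<close>, the coinvariants \<open>lc m\<close> and
  \<open>rc n\<close> have changed places while the outer factors \<open>a\<close> and
  \<open>b\<close> stay. This is the flip form of the braiding, obtained by recognising
  \<open>rc\<close> in the first factor and \<open>lc\<close> in the second.\<close>

lemma worf_decomp:
  assumes x: "x \<in> carr M" and y: "y \<in> carr M"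
  shows "worf x y = fsum (lcoact M x) (\<lambda>(a, m). fsum (rcoact M y) (\<lambda>(n, b). htens M [lact M a (rc n), ract M (lc m) b]))"
proof -
  note vf = vector_space_fscale
  have "worf x y = L3 fscale x (\<lambda>a1 a2 m. R3 fscale y (\<lambda>n b1 b2. htens M [lact M a1 (ract M n (S b1)), ract M (lact M (S a2) m) b2]))"
    unfolding worf_def by (intro L3_cong R3_cong x y) simp
  also have "\<dots> = L3 fscale x (\<lambda>a1 a2 m. fsum (rcoact M y) (\<lambda>(n, b). htens M [lact M a1 (rc n), ract M (lact M (S a2) m) b]))"
    by (intro L3_cong x R3_rc[OF vf _ y, where K = "\<lambda>u b. htens M [lact M _ u, ract M (lact M (S _) _) b]"])
       (auto simp: bilin_def intro!: lin_bim)
  also have "\<dots> = fsum (lcoact M x) (\<lambda>(a, m). fsum (rcoact M y) (\<lambda>(n, b). htens M [lact M a (rc n), ract M (lc m) b]))"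
    by (rule L3_lc[OF vf _ x, where K = "\<lambda>a u. fsum (rcoact M y) (\<lambda>(n, b). htens M [lact M a (rc n), ract M u b])"])
       (auto simp: bilin_def y intro!: lin_bim dest: rcoact_keys[OF y])
  finally show ?thesis .
qed

end

subsection \<open>Invertibility of the braiding\<close>

definition copM :: "('k::field, 'h, 'm) bimod \<Rightarrow> ('k, 'h, 'm) bimod" where
  "copM M = M\<lparr>lcoact := \<lambda>x. flip (rcoact M x), rcoact := \<lambda>x. flip (lcoact M x)\<rparr>"

lemma copM_simps [simp]: "carr (copM M) = carr M" "bscale (copM M) = bscale M" "lact (copM M) = lact M"
  "ract (copM M) = ract M" "lcoact (copM M) x = flip (rcoact M x)" "rcoact (copM M) x = flip (lcoact M x)"
  by (simp_all add: copM_def)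

lemma copM_copM [simp]: "copM (copM M) = M"
  by (cases M) (simp add: copM_def)

lemma htens_copM [simp]: "htens (copM M) = htens M"
  by (simp add: fun_eq_iff htens_def htens_rels_def)

lemma htpow_copM [simp]: "htpow (copM M) = htpow M"
  by (simp add: fun_eq_iff htpow_def)

locale bicov_bimodule_bij = bicov_bimodule H M + hopf_sweedler_bij H
  for H :: "('k::field, 'h::ring_1) hopf" and M :: "('k, 'h, 'm::ab_group_add) bimod"
begin

lemma cop_cop [simp]: "cop (cop H) = H"
  by (cases H) (use bij in \<open>simp add: cop_def inv_inv_eq\<close>)

lemma bicov_bimodule_cop: "bicov_bimodule (cop H) (copM M)"
proof -
  interpret C: hopf_sweedler "cop H" by (rule hopf_sweedler_cop)
  note fl = lsum_flip[OF vector_space_mult] lsum_flip[OF hv.vector_space_axioms] lsum_flip[OF vsM]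
  show ?thesis
  proof (intro bicov_bimodule.intro cov_bimodule.intro cov_bimodule_axioms.intro bicov_bimodule_axioms.intro hopf_sweedler_cop)
    show "vector_space (bscale (copM M))" "module.subspace (bscale (copM M)) (carr (copM M))"
      using vsM subspace_carr by simp_all
    show "bilin (hsp (cop H)) (msp (copM M)) (bscale (copM M)) (lact (copM M))"
      "bilin (msp (copM M)) (hsp (cop H)) (bscale (copM M)) (ract (copM M))"
      using bilin_lact bilin_ract by simp_all
    show "lin (msp (copM M)) fscale (lcoact (copM M))" "lin (msp (copM M)) fscale (rcoact (copM M))"
      using lin_lcoact0 lin_rcoact0 by (simp_all add: linear_map_def flip_add flip_fscale)
  next
    fix F :: "'h \<Rightarrow> 'm \<Rightarrow> 'k" and x h
    assume "bilin (hsp (cop H)) (msp (copM M)) (*) F" and x: "x \<in> carr (copM M)"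
    then have F: "bilin (msp M) (hsp H) (*) (\<lambda>y a. F a y)" by (simp add: bilin_def)
    show "ksum (lcoact (copM M) (lact (copM M) h x)) (\<lambda>(a, y). F a y)
      = ksum (comult (cop H) h) (\<lambda>(h1, h2). ksum (lcoact (copM M) x) (\<lambda>(a, y). F (h1 * a) (lact (copM M) h2 y)))"
      using x rcoact_lact0[OF F] unfolding cop_simps copM_simps fl by blast
    show "ksum (lcoact (copM M) (ract (copM M) x h)) (\<lambda>(a, y). F a y)
      = ksum (comult (cop H) h) (\<lambda>(h1, h2). ksum (lcoact (copM M) x) (\<lambda>(a, y). F (a * h1) (ract (copM M) y h2)))"
      using x rcoact_ract0[OF F] unfolding cop_simps copM_simps fl by blast
  next
    fix G :: "'m \<Rightarrow> 'h \<Rightarrow> 'k" and x h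
    assume "bilin (msp (copM M)) (hsp (cop H)) (*) G" and x: "x \<in> carr (copM M)"
    then have G: "bilin (hsp H) (msp M) (*) (\<lambda>a y. G y a)" by (simp add: bilin_def)
    show "ksum (rcoact (copM M) (lact (copM M) h x)) (\<lambda>(y, a). G y a)
      = ksum (comult (cop H) h) (\<lambda>(h1, h2). ksum (rcoact (copM M) x) (\<lambda>(y, a). G (lact (copM M) h1 y) (h2 * a)))"
      using x lcoact_lact0[OF G] unfolding cop_simps copM_simps fl by blast
    show "ksum (rcoact (copM M) (ract (copM M) x h)) (\<lambda>(y, a). G y a)
      = ksum (comult (cop H) h) (\<lambda>(h1, h2). ksum (rcoact (copM M) x) (\<lambda>(y, a). G (ract (copM M) y h1) (a * h2)))"
      using x lcoact_ract0[OF G] unfolding cop_simps copM_simps fl by blast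
  next
    fix G :: "'h \<Rightarrow> 'h \<Rightarrow> 'm \<Rightarrow> 'k" and x
    assume "trilin (hsp (cop H)) (hsp (cop H)) (msp (copM M)) (*) G" and x: "x \<in> carr (copM M)"
    then have G: "trilin (msp M) (hsp H) (hsp H) (*) (\<lambda>z b a. G a b z)" by (simp add: trilin_def)
    show "ksum (lcoact (copM M) x) (\<lambda>(a, y). ksum (lcoact (copM M) y) (\<lambda>(b, z). G a b z))
      = ksum (lcoact (copM M) x) (\<lambda>(a, y). ksum (comult (cop H) a) (\<lambda>(a1, a2). G a1 a2 y))"
      using x rcoassoc0[OF G] unfolding cop_simps copM_simps fl by blast
  next
    fix G :: "'m \<Rightarrow> 'h \<Rightarrow> 'h \<Rightarrow> 'k" and x
    assume "trilin (msp (copM M)) (hsp (cop H)) (hsp (cop H)) (*) G" and x: "x \<in> carr (copM M)"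
    then have G: "trilin (hsp H) (hsp H) (msp M) (*) (\<lambda>a b z. G z b a)" by (simp add: trilin_def)
    show "ksum (rcoact (copM M) x) (\<lambda>(y, a). ksum (rcoact (copM M) y) (\<lambda>(z, b). G z b a))
      = ksum (rcoact (copM M) x) (\<lambda>(y, a). ksum (comult (cop H) a) (\<lambda>(a1, a2). G y a1 a2))"
      using x lcoassoc0[OF G] unfolding cop_simps copM_simps fl by blast
  next
    fix x assume x: "x \<in> carr (copM M)"
    show "lsum (bscale (copM M)) (lcoact (copM M) x) (\<lambda>(a, y). bscale (copM M) (counit (cop H) a) y) = x"
      "lsum (bscale (copM M)) (rcoact (copM M) x) (\<lambda>(y, a). bscale (copM M) (counit (cop H) a) y) = x"
      using x lcounit rcounit by (simp_all add: fl)
  qed (auto dest!: keys_flip intro: lcoact_keys rcoact_keys)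
qed

lemma bicov_bimodule_bij_cop: "bicov_bimodule_bij (cop H) (copM M)"
proof -
  interpret C: bicov_bimodule "cop H" "copM M" by (rule bicov_bimodule_cop)
  show ?thesis by unfold_locales (simp add: bij_T)
qed

lemma wor_cop_wor:
  assumes t: "t \<in> htpow M 2"
  shows "wor (cop H) (copM M) (wor H M t) = t"
proof -
  interpret C: bicov_bimodule "cop H" "copM M" by (rule bicov_bimodule_cop)
  note vf = vector_space_fscale
  have lcop: "lin (fscale, UNIV) fscale (wor (cop H) (copM M))" by (rule C.lin_wor)
  have *: "wor (cop H) (copM M) (htens M [lact M a (rc n), ract M (lc m) b]) = htens M [lact M a (lc m), ract M (rc n) b]"
    if n: "n \<in> carr M" and m: "m \<in> carr M" for a b n m
  proof -
    have ht: "ht_lact (copM M) = ht_lact M" "ht_ract (copM M) = ht_ract M"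
      by (simp_all add: fun_eq_iff ht_lact_def ht_ract_def)
    \<comment> \<open>Over \<open>cop H\<close> left and right coinvariance trade places, so
      \<open>rc n\<close> and \<open>lc m\<close> stand in the order that \<open>worf_coinv\<close>
      asks for and are flipped back.\<close>
    have 1: "C.lcoinv (rc n)"
      using rcoinv_rc[OF n] unfolding rcoinv_def C.lcoinv_def copM_simps cop_simps lsum_flip[OF vector_space_mult]
      by (auto simp: bilin_def)
    have 2: "C.rcoinv (lc m)"
      using lcoinv_lc[OF m] unfolding lcoinv_def C.rcoinv_def copM_simps cop_simps lsum_flip[OF vector_space_mult]
      by (auto simp: bilin_def)
    have 3: "C.worf (rc n) (lc m) = htens M [lc m, rc n]"
      using C.worf_coinv[OF 1 2] by simp
    have "wor (cop H) (copM M) (htens M [lact M a (rc n), ract M (lc m) b])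
       = C.worf (lact (copM M) a (rc n)) (ract (copM M) (lc m) b)"
      using C.wor_htens[of "lact M a (rc n)" "ract M (lc m) b"] by simp
    also have "\<dots> = ht_lact M a (ht_ract M (C.worf (rc n) (lc m)) b)"
      using n m by (subst C.worf_lact, simp, simp, subst C.worf_ract, simp, simp, simp add: ht)
    also have "\<dots> = htens M [lact M a (lc m), ract M (rc n) b]"
      by (simp add: 3 ht_ract_htens ht_lact_htens)
    finally show ?thesis .
  qed
  show ?thesis
  proof (rule htpow2_eqI[where M = M and t = t and g = "\<lambda>t. t", OF lin_compose[OF lcop lin_wor] _ vf _ t])
    fix x y assume x: "x \<in> carr M" and y: "y \<in> carr M"
    have "wor (cop H) (copM M) (wor H M (htens M [x, y])) =
      fsum (lcoact M x) (\<lambda>(a, m). fsum (rcoact M y) (\<lambda>(n, b). wor (cop H) (copM M) (htens M [lact M a (rc n), ract M (lc m) b])))"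
      by (simp add: wor_htens worf_decomp x y lin_lsum_UNIV(2)[OF vf lcop])
    also have "\<dots> = fsum (lcoact M x) (\<lambda>(a, m). fsum (rcoact M y) (\<lambda>(n, b). htens M [lact M a (lc m), ract M (rc n) b]))"
      by (intro lsum_cong2 *) (auto dest: lcoact_keys[OF x] rcoact_keys[OF y])
    also have "\<dots> = htens M [x, y]" by (rule htens_decomp[OF x y])
    finally show "wor (cop H) (copM M) (wor H M (htens M [x, y])) = htens M [x, y]" .
  qed (simp add: linear_map_def)
qed

text \<open>\<open>cop\<close> and \<open>copM\<close> are involutions, so
  \<open>wor_cop_wor\<close> also applies with \<open>H\<close> and \<open>cop H\<close> exchanged,
  and the inverse is two-sided.\<close>

lemma bij_betw_wor: "bij_betw (wor H M) (htpow M 2) (htpow M 2)"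
proof -
  interpret C: bicov_bimodule_bij "cop H" "copM M" by (rule bicov_bimodule_bij_cop)
  show ?thesis
    using wor_cop_wor C.wor_cop_wor wor_closed C.wor_closed
    by (intro bij_betw_byWitness[where f' = "wor (cop H) (copM M)"]) auto
qed

end

subsection \<open>The bimodule of one-forms\<close>

lemma subspace_keys: "module.subspace fscale {t :: 'x \<Rightarrow>\<^sub>0 'k::field. keys t \<subseteq> A}"
proof -
  interpret vector_space "fscale :: 'k \<Rightarrow> ('x \<Rightarrow>\<^sub>0 'k) \<Rightarrow> _" by (rule vector_space_fscale)
  show ?thesis
  proof (rule subspaceI)
    show "x + y \<in> {t. keys t \<subseteq> A}" if "x \<in> {t. keys t \<subseteq> A}" "y \<in> {t. keys t \<subseteq> A}" for x y :: "'x \<Rightarrow>\<^sub>0 'k"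
      using that Poly_Mapping.keys_add[of x y] by blast
    show "fscale c x \<in> {t. keys t \<subseteq> A}" if "x \<in> {t. keys t \<subseteq> A}" for c and x :: "'x \<Rightarrow>\<^sub>0 'k"
      using that keys_fscale[OF vector_space_fscale, of c x] by blast
  qed simp
qed

text \<open>\<open>quot_proj R t - t\<close> lies in the span of \<open>R\<close>, so the support
  grows at most by the supports of the relations. This is why the Sweedler legs occurring in a
  representative lie in the carriers.\<close>

lemma keys_quot_proj:
  fixes R :: "('x \<Rightarrow>\<^sub>0 'k::field) set"
  assumes "\<And>r. r \<in> R \<Longrightarrow> keys r \<subseteq> A" "keys t \<subseteq> A"
  shows "keys (quot_proj R t) \<subseteq> A"
proof -
  interpret vector_space "fscale :: 'k \<Rightarrow> ('x \<Rightarrow>\<^sub>0 'k) \<Rightarrow> _" by (rule vector_space_fscale)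
  have "fspan R \<subseteq> {t. keys t \<subseteq> A}"
    using assms(1) by (intro span_minimal subspace_keys) auto
  then have "quot_proj R t - t \<in> {t. keys t \<subseteq> A}" using quot_proj_minus by blast
  from subspace_add[OF subspace_keys this, of t] assms(2) show ?thesis by simp
qed

lemma keys_gen_diff: "x \<in> A \<Longrightarrow> y \<in> A \<Longrightarrow> keys (gen x - fscale c (gen y) :: 'x \<Rightarrow>\<^sub>0 'k::field) \<subseteq> A"
  and keys_gen_diff2: "x \<in> A \<Longrightarrow> y \<in> A \<Longrightarrow> z \<in> A \<Longrightarrow> keys (gen x - gen y - gen z :: 'x \<Rightarrow>\<^sub>0 'k) \<subseteq> A"
  by (auto simp: in_keys_iff lookup_minus lookup_single when_def split: if_splits)

lemma keys_ktens:
  fixes V :: "('k::field, 'a::ab_group_add) vspace" and W :: "('k, 'b::ab_group_add) vspace"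
  assumes "vector_space (fst V)" "module.subspace (fst V) (snd V)" "vector_space (fst W)" "module.subspace (fst W) (snd W)"
    and "a \<in> snd V" "b \<in> snd W"
  shows "keys (ktens V W a b) \<subseteq> snd V \<times> snd W"
proof -
  interpret V: vector_space "fst V" by fact
  interpret W: vector_space "fst W" by fact
  note sub = V.subspace_add[OF assms(2)] V.subspace_scale[OF assms(2)] W.subspace_add[OF assms(4)] W.subspace_scale[OF assms(4)]
  show ?thesis
    unfolding ktens_def
  proof (rule keys_quot_proj)
    show "keys r \<subseteq> snd V \<times> snd W" if "r \<in> ktens_rels V W" for r
      using that unfolding ktens_rels_def
      by - (elim UnE CollectE exE conjE; hypsubst; intro keys_gen_diff keys_gen_diff2; simp add: sub)
  qed (use assms(5,6) in simp)
qed

lemma keys_ktensor: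
  fixes V :: "('k::field, 'a::ab_group_add) vspace" and W :: "('k, 'b::ab_group_add) vspace"
  assumes "vector_space (fst V)" "module.subspace (fst V) (snd V)" "vector_space (fst W)" "module.subspace (fst W) (snd W)"
    and "t \<in> snd (ktensor V W)"
  shows "keys t \<subseteq> snd V \<times> snd W"
proof -
  interpret vector_space "fscale :: 'k \<Rightarrow> ('a \<times> 'b \<Rightarrow>\<^sub>0 'k) \<Rightarrow> _" by (rule vector_space_fscale)
  have "fspan {ktens V W a b | a b. a \<in> snd V \<and> b \<in> snd W} \<subseteq> {t. keys t \<subseteq> snd V \<times> snd W}"
    using keys_ktens[OF assms(1-4)] by (intro span_minimal subspace_keys) auto
  then show ?thesis using assms(5) by (auto simp: ktensor_def)
qed

lemma ktens_in_ktensor: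
  fixes V :: "('k::field, 'a::ab_group_add) vspace" and W :: "('k, 'b::ab_group_add) vspace"
  assumes "a \<in> snd V" "b \<in> snd W"
  shows "ktens V W a b \<in> snd (ktensor V W)"
proof -
  interpret vector_space "fscale :: 'k \<Rightarrow> ('a \<times> 'b \<Rightarrow>\<^sub>0 'k) \<Rightarrow> _" by (rule vector_space_fscale)
  show ?thesis using assms by (auto simp: ktensor_def intro!: span_base)
qed

lemma fst_ktensor [simp]: "fst (ktensor V W) = fscale"
  by (simp add: ktensor_def)

lemma lin_ktensor_id: "lin (ktensor V W) fscale (\<lambda>t. t)"
  by (simp add: linear_map_def)

lemma lsum_ktens3:
  assumes vs: "vector_space s" and G: "trilin U V W s G" and "a \<in> snd U" "b \<in> snd V" "c \<in> snd W"
    and "vector_space (fst V)" "module.subspace (fst V) (snd V)" "vector_space (fst W)" "module.subspace (fst W) (snd W)"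
  shows "lsum s (ktens U (ktensor V W) a (ktens V W b c)) (\<lambda>(x, t). lsum s t (\<lambda>(y, z). G x y z)) = G a b c"
proof -
  have "bilin U (ktensor V W) s (\<lambda>x t. lsum s t (\<lambda>(y, z). G x y z))"
    using G keys_ktensor[OF assms(6-9)]
    by (auto simp: bilin_def trilin_def intro!: lin_lsum_fun2[OF vs] lin_lsum_arg[OF vs] lin_ktensor_id)
  then have "lsum s (ktens U (ktensor V W) a (ktens V W b c)) (\<lambda>(x, t). lsum s t (\<lambda>(y, z). G x y z))
    = lsum s (ktens V W b c) (\<lambda>(y, z). G a y z)"
    by (rule lsum_ktens[OF vs]) (use assms in \<open>auto intro: ktens_in_ktensor\<close>)
  also have "\<dots> = G a b c"
    by (rule lsum_ktens[OF vs]) (use assms in \<open>auto simp: trilin_def bilin_def\<close>)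
  finally show ?thesis .
qed

lemma hopf_algebra_sweedler:
  fixes H :: "('k::field, 'h::ring_1) hopf"
  assumes H: "hopf_algebra H"
  shows "hopf_sweedler H"
proof -
  note H' = H[unfolded hopf_algebra_def]
  have vs: "vector_space (hscale H)" using H' by (simp add: algebra_over_def)
  interpret hv: vector_space "hscale H" by (rule vs)
  have vs2: "vector_space (fst (hsp H))" "module.subspace (fst (hsp H)) (snd (hsp H))" by (simp_all add: vs)
  note vm = vector_space_mult
  note k3 = lsum_ktens3[OF vm _ _ _ _ vs2 vs2]
  note k2 = lsum_ktens[OF vm, of "hsp H" "hsp H"]
  show ?thesis
  proof (intro hopf_sweedler.intro)
    show "algebra_over (hscale H)" using H' by blast
    show "lin (hsp H) fscale (comult H)" using H' by (simp add: linear_map_def)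
    show "lin (hsp H) (*) (counit H)" "lin (hsp H) (hscale H) (antip H)"
      using H' by (simp_all add: lin_UNIV_iff vs vm)
    show "ksum (comult H 1) (\<lambda>(a1, a2). F a1 a2) = F 1 1" if "bilin (hsp H) (hsp H) (*) F" for F
      using H' k2[OF that] by simp
    show "ksum (comult H (a * b)) (\<lambda>(x, y). F x y)
      = ksum (comult H a) (\<lambda>(a1, a2). ksum (comult H b) (\<lambda>(b1, b2). F (a1 * b1) (a2 * b2)))"
      if "bilin (hsp H) (hsp H) (*) F" for F a b
    proof -
      have "comult H (a * b) = fsum (comult H a) (\<lambda>(a1, a2).
             fsum (comult H b) (\<lambda>(b1, b2). htH H (a1 * b1) (a2 * b2)))"
        using H' by blast
      then show ?thesis by (simp add: lsum_lsum2[OF vm] k2[OF that])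
    qed
    show "ksum (comult H a) (\<lambda>(a1, a2). ksum (comult H a1) (\<lambda>(b1, b2). G b1 b2 a2))
      = ksum (comult H a) (\<lambda>(a1, a2). ksum (comult H a2) (\<lambda>(b1, b2). G a1 b1 b2))"
      if G: "trilin (hsp H) (hsp H) (hsp H) (*) G" for G a
    proof -
      \<comment> \<open>The axiom is an equation between formal sums. Applying to both sides the
        functional induced by \<open>G\<close> on the threefold tensor product gives the version
        tested on forms.\<close>
      have "fsum (comult H a) (\<lambda>(a1, a2). fsum (comult H a1) (\<lambda>(b1, b2).
             ktens (hsp H) (hhsp H) b1 (htH H b2 a2)))
        = fsum (comult H a) (\<lambda>(a1, a2). fsum (comult H a2) (\<lambda>(b1, b2).
             ktens (hsp H) (hhsp H) a1 (htH H b1 b2)))" (is "?l = ?r") using H' by blast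
      then have "ksum ?l (\<lambda>(x, t). ksum t (\<lambda>(y, z). G x y z)) = ksum ?r (\<lambda>(x, t). ksum t (\<lambda>(y, z). G x y z))"
        by simp
      then show ?thesis by (simp add: lsum_lsum2[OF vm] k3[OF G])
    qed
  qed (use H' in blast)+
qed

context
  fixes H :: "('k::field, 'h::ring_1) hopf" and C :: "('k, 'h, 'o::ring_1) calculus"
  assumes H: "hopf_algebra H" and C: "bicovariant_calculus H C"
begin

interpretation hopf_sweedler H by (rule hopf_algebra_sweedler[OF H])

lemma
  shows vs_o: "vector_space (oscale C)"
    and subspace_grade: "module.subspace (oscale C) (grade C n)"
    and oscale_mult: "oscale C c x * y = oscale C c (x * y)" "x * oscale C c y = oscale C c (x * y)"
    and grade_mult: "x \<in> grade C m \<Longrightarrow> y \<in> grade C n \<Longrightarrow> x * y \<in> grade C (m + n)"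
    and incl_grade: "incl C a \<in> grade C 0"
    and incl_one: "incl C 1 = 1" and incl_mult: "incl C (a * b) = incl C a * incl C b"
    and incl_add: "incl C (a + b) = incl C a + incl C b"
    and incl_scale: "incl C (hscale H c a) = oscale C c (incl C a)"
    and diff_grade: "x \<in> grade C n \<Longrightarrow> diff C x \<in> grade C (Suc n)"
    and diff_incl_mult: "diff C (incl C a * y) = diff C (incl C a) * y + incl C a * diff C y"
proof -
  have D: "differential_calculus H C" using C by (simp add: bicovariant_calculus_def)
  note D' = D[unfolded differential_calculus_def]
  then have G: "graded_algebra (oscale C) (grade C)" by blast
  note G' = G[unfolded graded_algebra_def algebra_over_def]
  show "vector_space (oscale C)" "module.subspace (oscale C) (grade C n)" using G' by blast+
  show "oscale C c x * y = oscale C c (x * y)" "x * oscale C c y = oscale C c (x * y)" using G' by metis+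
  show "x \<in> grade C m \<Longrightarrow> y \<in> grade C n \<Longrightarrow> x * y \<in> grade C (m + n)" using G' by blast
  show ig: "incl C a \<in> grade C 0" for a using D' by blast
  show "incl C 1 = 1" "incl C (a * b) = incl C a * incl C b" using D' by blast+
  show "incl C (a + b) = incl C a + incl C b" "incl C (hscale H c a) = oscale C c (incl C a)"
    using D' by (auto simp: Vector_Spaces.linear_iff)
  show "x \<in> grade C n \<Longrightarrow> diff C x \<in> grade C (Suc n)" using D' by blast
  have "diff C (incl C a * y) = diff C (incl C a) * y + (- 1) ^ 0 * (incl C a * diff C y)"
    using D' ig by blast
  then show "diff C (incl C a * y) = diff C (incl C a) * y + incl C a * diff C y" by simp
qed

lemma incl_mult_grade: "x \<in> grade C n \<Longrightarrow> incl C a * x \<in> grade C n" "x \<in> grade C n \<Longrightarrow> x * incl C a \<in> grade C n"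
  using grade_mult[OF incl_grade, of x n] grade_mult[of x n, OF _ incl_grade] by simp_all

lemma lin_omult: "lin V (oscale C) F \<Longrightarrow> lin V (oscale C) (\<lambda>x. F x * y)"
  "lin V (oscale C) F \<Longrightarrow> lin V (oscale C) (\<lambda>x. y * F x)"
  by (simp_all add: linear_map_def distrib_left distrib_right oscale_mult)

lemma lin_incl: "lin V (hscale H) F \<Longrightarrow> lin V (oscale C) (\<lambda>x. incl C (F x))"
  by (simp add: linear_map_def incl_add incl_scale)

lemma lin_oid: "lin (oscale C, A) (oscale C) (\<lambda>x. x)"
  by (simp add: linear_map_def)

lemma keys_lco: "x \<in> grade C n \<Longrightarrow> (a, y) \<in> keys (lco C x) \<Longrightarrow> y \<in> grade C n"
  and keys_rco: "x \<in> grade C n \<Longrightarrow> (y, a) \<in> keys (rco C x) \<Longrightarrow> y \<in> grade C n"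
proof -
  assume x: "x \<in> grade C n"
  have "lco C x \<in> snd (ktensor (hsp H) (osp C n))" "rco C x \<in> snd (ktensor (osp C n) (hsp H))"
    using C x unfolding bicovariant_calculus_def left_comodule_calculus_def right_comodule_calculus_def linear_map_def
    by auto
  with keys_ktensor[of "hsp H" "osp C n" "lco C x"] keys_ktensor[of "osp C n" "hsp H" "rco C x"]
  show "(a, y) \<in> keys (lco C x) \<Longrightarrow> y \<in> grade C n" "(y, a) \<in> keys (rco C x) \<Longrightarrow> y \<in> grade C n"
    by (auto simp: vs_o subspace_grade hv.vector_space_axioms)
qed

context
  fixes s :: "'k \<Rightarrow> 'v \<Rightarrow> 'v::ab_group_add"
  assumes vs: "vector_space s"
begin

lemma lco_mult:
  assumes F: "bilin (hsp H) (osp C (m + n)) s F" and x: "x \<in> grade C m" and y: "y \<in> grade C n"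
  shows "lsum s (lco C (x * y)) (\<lambda>(a, z). F a z)
    = lsum s (lco C x) (\<lambda>(a, x0). lsum s (lco C y) (\<lambda>(b, y0). F (a * b) (x0 * y0)))"
proof -
  have "lco C (x * y) = fsum (lco C x) (\<lambda>(a, x0). fsum (lco C y) (\<lambda>(b, y0).
             ktens (hsp H) (osp C (m + n)) (a * b) (x0 * y0)))"
    using C x y unfolding bicovariant_calculus_def left_comodule_calculus_def by blast
  then have "lsum s (lco C (x * y)) (\<lambda>(a, z). F a z)
    = lsum s (lco C x) (\<lambda>(a, x0). lsum s (lco C y) (\<lambda>(b, y0).
        lsum s (ktens (hsp H) (osp C (m + n)) (a * b) (x0 * y0)) (\<lambda>(a, z). F a z)))"
    by (simp add: lsum_lsum2[OF vs])
  also have "\<dots> = lsum s (lco C x) (\<lambda>(a, x0). lsum s (lco C y) (\<lambda>(b, y0). F (a * b) (x0 * y0)))"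
    by (intro lsum_cong2 lsum_ktens[OF vs F]) (auto intro!: grade_mult dest: keys_lco[OF x] keys_lco[OF y])
  finally show ?thesis .
qed

lemma rco_mult:
  assumes F: "bilin (osp C (m + n)) (hsp H) s F" and x: "x \<in> grade C m" and y: "y \<in> grade C n"
  shows "lsum s (rco C (x * y)) (\<lambda>(z, a). F z a)
    = lsum s (rco C x) (\<lambda>(x0, a). lsum s (rco C y) (\<lambda>(y0, b). F (x0 * y0) (a * b)))"
proof -
  have "rco C (x * y) = fsum (rco C x) (\<lambda>(x0, a). fsum (rco C y) (\<lambda>(y0, b).
             ktens (osp C (m + n)) (hsp H) (x0 * y0) (a * b)))"
    using C x y unfolding bicovariant_calculus_def right_comodule_calculus_def by blast
  then have "lsum s (rco C (x * y)) (\<lambda>(z, a). F z a)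
    = lsum s (rco C x) (\<lambda>(x0, a). lsum s (rco C y) (\<lambda>(y0, b).
        lsum s (ktens (osp C (m + n)) (hsp H) (x0 * y0) (a * b)) (\<lambda>(z, a). F z a)))"
    by (simp add: lsum_lsum2[OF vs])
  also have "\<dots> = lsum s (rco C x) (\<lambda>(x0, a). lsum s (rco C y) (\<lambda>(y0, b). F (x0 * y0) (a * b)))"
    by (intro lsum_cong2 lsum_ktens[OF vs F]) (auto intro!: grade_mult dest: keys_rco[OF x] keys_rco[OF y])
  finally show ?thesis .
qed

lemma lco_incl:
  assumes F: "bilin (hsp H) (osp C 0) s F"
  shows "lsum s (lco C (incl C h)) (\<lambda>(a, z). F a z) = lsum s (comult H h) (\<lambda>(h1, h2). F h1 (incl C h2))"
proof -
  have "lco C (incl C h) = fsum (comult H h) (\<lambda>(a1, a2). ktens (hsp H) (osp C 0) a1 (incl C a2))"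
    using C unfolding bicovariant_calculus_def left_comodule_calculus_def by blast
  then show ?thesis by (simp add: lsum_lsum2[OF vs] lsum_ktens[OF vs F] incl_grade)
qed

lemma rco_incl:
  assumes F: "bilin (osp C 0) (hsp H) s F"
  shows "lsum s (rco C (incl C h)) (\<lambda>(z, a). F z a) = lsum s (comult H h) (\<lambda>(h1, h2). F (incl C h1) h2)"
proof -
  have "rco C (incl C h) = fsum (comult H h) (\<lambda>(a1, a2). ktens (osp C 0) (hsp H) (incl C a1) a2)"
    using C unfolding bicovariant_calculus_def right_comodule_calculus_def by blast
  then show ?thesis by (simp add: lsum_lsum2[OF vs] lsum_ktens[OF vs F] incl_grade)
qed

end

lemma bilin_lin1o:
  assumes "bilin (osp C n) W s F" "b \<in> snd W" "lin V (oscale C) G" "\<And>x. x \<in> snd V \<Longrightarrow> G x \<in> grade C n"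
  shows "lin V s (\<lambda>x. F (G x) b)"
  using assms by (simp add: bilin_def linear_map_def)

lemma bilin_lin2o:
  assumes "bilin U (osp C n) s F" "a \<in> snd U" "lin V (oscale C) G" "\<And>x. x \<in> snd V \<Longrightarrow> G x \<in> grade C n"
  shows "lin V s (\<lambda>x. F a (G x))"
  using assms by (simp add: bilin_def linear_map_def)

lemma Omega1_simps [simp]: "carr (Omega1 C) = grade C 1" "bscale (Omega1 C) = oscale C"
  "lact (Omega1 C) a w = incl C a * w" "ract (Omega1 C) w a = w * incl C a"
  "lcoact (Omega1 C) = lco C" "rcoact (Omega1 C) = rco C"
  by (simp_all add: Omega1_def)

lemma bicov_bimodule_Omega1: "bicov_bimodule H (Omega1 C)"
proof -
  note vm = vector_space_mult
  note lins = lin_hopf lin_omult lin_incl lin_oid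
  have inter: "incl C a * x \<in> grade C (Suc 0)" "x * incl C a \<in> grade C (Suc 0)" if "x \<in> grade C (Suc 0)" for x a
    using incl_mult_grade that by auto
  have vs2: "vector_space (fst (hsp H))" "module.subspace (fst (hsp H)) (snd (hsp H))" by (simp_all add: hv.vector_space_axioms)
  have os2: "vector_space (fst (osp C n))" "module.subspace (fst (osp C n)) (snd (osp C n))" for n by (simp_all add: vs_o subspace_grade)
  show ?thesis
  proof (intro bicov_bimodule.intro cov_bimodule.intro cov_bimodule_axioms.intro bicov_bimodule_axioms.intro hopf_sweedler_axioms,
      unfold Omega1_simps One_nat_def)
    show "vector_space (oscale C)" "module.subspace (oscale C) (grade C (Suc 0))" by (rule vs_o subspace_grade)+
    show "bilin (hsp H) (osp C (Suc 0)) (oscale C) (\<lambda>a. (*) (incl C a))" "bilin (osp C (Suc 0)) (hsp H) (oscale C) (\<lambda>w a. w * incl C a)"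
      by (auto simp: bilin_def intro!: lins)
    show "lin (osp C (Suc 0)) fscale (lco C)" "lin (osp C (Suc 0)) fscale (rco C)"
      using C unfolding bicovariant_calculus_def left_comodule_calculus_def right_comodule_calculus_def linear_map_def by auto
  next
    fix F :: "'h \<Rightarrow> 'o \<Rightarrow> 'k" and x h
    assume F: "bilin (hsp H) (osp C (Suc 0)) (*) F" and x: "x \<in> grade C (Suc 0)"
    note ls = lins bilin_lin1[OF F] bilin_lin2o[OF F] vm
    \<comment> \<open>The action of \<open>H\<close> is multiplication by a form of degree 0, so the
      compatibility is multiplicativity of the coaction in degree 0 + 1, combined with the fact that
      the coaction extends \<Delta>.\<close>
    have "ksum (lco C (incl C h * x)) (\<lambda>(a, y). F a y)
      = ksum (lco C (incl C h)) (\<lambda>(a, x0). ksum (lco C x) (\<lambda>(b, y0). F (a * b) (x0 * y0)))"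
      by (rule lco_mult[where m = 0 and n = "Suc 0", OF vm]) (use F x incl_grade in auto)
    also have "\<dots> = ksum (comult H h) (\<lambda>(h1, h2). ksum (lco C x) (\<lambda>(a, y). F (h1 * a) (incl C h2 * y)))"
      by (rule lco_incl[OF vm]) (auto simp: bilin_def dest: keys_lco[OF x] intro!: ls grade_mult[of _ 0 _ "Suc 0", simplified])
    finally show "ksum (lco C (incl C h * x)) (\<lambda>(a, y). F a y) = \<dots>" .
    have "ksum (lco C (x * incl C h)) (\<lambda>(a, y). F a y)
      = ksum (lco C x) (\<lambda>(a, x0). ksum (lco C (incl C h)) (\<lambda>(b, y0). F (a * b) (x0 * y0)))"
      by (rule lco_mult[where m = "Suc 0" and n = 0, OF vm]) (use F x incl_grade in auto)
    also have "\<dots> = ksum (lco C x) (\<lambda>(a, y). ksum (comult H h) (\<lambda>(h1, h2). F (a * h1) (y * incl C h2)))"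
      by (intro lsum_cong2 lco_incl[OF vm])
         (auto simp: bilin_def dest: keys_lco[OF x] intro!: ls grade_mult[of _ "Suc 0" _ 0, simplified])
    also have "\<dots> = ksum (comult H h) (\<lambda>(h1, h2). ksum (lco C x) (\<lambda>(a, y). F (a * h1) (y * incl C h2)))"
      by (rule lsum_swap2[OF vm])
    finally show "ksum (lco C (x * incl C h)) (\<lambda>(a, y). F a y) = \<dots>" .
  next
    fix F :: "'o \<Rightarrow> 'h \<Rightarrow> 'k" and x h
    assume F: "bilin (osp C (Suc 0)) (hsp H) (*) F" and x: "x \<in> grade C (Suc 0)"
    note ls = lins bilin_lin1o[OF F] bilin_lin2[OF F] vm
    have "ksum (rco C (incl C h * x)) (\<lambda>(y, a). F y a)
      = ksum (rco C (incl C h)) (\<lambda>(x0, a). ksum (rco C x) (\<lambda>(y0, b). F (x0 * y0) (a * b)))"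
      by (rule rco_mult[where m = 0 and n = "Suc 0", OF vm]) (use F x incl_grade in auto)
    also have "\<dots> = ksum (comult H h) (\<lambda>(h1, h2). ksum (rco C x) (\<lambda>(y, a). F (incl C h1 * y) (h2 * a)))"
      by (rule rco_incl[OF vm]) (auto simp: bilin_def dest: keys_rco[OF x] intro!: ls grade_mult[of _ 0 _ "Suc 0", simplified])
    finally show "ksum (rco C (incl C h * x)) (\<lambda>(y, a). F y a) = \<dots>" .
    have "ksum (rco C (x * incl C h)) (\<lambda>(y, a). F y a)
      = ksum (rco C x) (\<lambda>(x0, a). ksum (rco C (incl C h)) (\<lambda>(y0, b). F (x0 * y0) (a * b)))"
      by (rule rco_mult[where m = "Suc 0" and n = 0, OF vm]) (use F x incl_grade in auto)
    also have "\<dots> = ksum (rco C x) (\<lambda>(y, a). ksum (comult H h) (\<lambda>(h1, h2). F (y * incl C h1) (a * h2)))"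
      by (intro lsum_cong2 rco_incl[OF vm])
         (auto simp: bilin_def dest: keys_rco[OF x] intro!: ls grade_mult[of _ "Suc 0" _ 0, simplified])
    also have "\<dots> = ksum (comult H h) (\<lambda>(h1, h2). ksum (rco C x) (\<lambda>(y, a). F (y * incl C h1) (a * h2)))"
      by (rule lsum_swap2[OF vm])
    finally show "ksum (rco C (x * incl C h)) (\<lambda>(y, a). F y a) = \<dots>" .
  next
    fix G x
    assume G: "trilin (hsp H) (hsp H) (osp C (Suc 0)) (*) G" and x: "x \<in> grade C (Suc 0)"
    let ?k = "\<lambda>a b y. ktens (hsp H) (ktensor (hsp H) (osp C (Suc 0))) a (ktens (hsp H) (osp C (Suc 0)) b y)"
    \<comment> \<open>The functional induced by \<open>G\<close> on the iterated tensor product in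
      which the calculus states coassociativity.\<close>
    let ?L = "\<lambda>u. ksum u (\<lambda>(x, t). ksum t (\<lambda>(y, z). G x y z))"
    have k: "G a b y = ?L (?k a b y)" if "y \<in> grade C (Suc 0)" for a b y
      using that by (intro lsum_ktens3[OF vm G _ _ _ vs2 os2, symmetric]) auto
    have "ksum (lco C x) (\<lambda>(a, y). ksum (lco C y) (\<lambda>(b, z). G a b z))
      = ?L (fsum (lco C x) (\<lambda>(a, x0). fsum (lco C x0) (\<lambda>(b, y). ?k a b y)))"
      unfolding lsum_lsum2[OF vm] by (intro lsum_cong2 k) (auto dest: keys_lco[OF keys_lco[OF x]])
    also have "\<dots> = ?L (fsum (lco C x) (\<lambda>(a, x0). fsum (comult H a) (\<lambda>(a1, a2). ?k a1 a2 x0)))"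
      by (rule arg_cong[where f = ?L])
         (use C x in \<open>unfold bicovariant_calculus_def left_comodule_calculus_def, blast\<close>)
    also have "\<dots> = ksum (lco C x) (\<lambda>(a, y). ksum (comult H a) (\<lambda>(a1, a2). G a1 a2 y))"
      unfolding lsum_lsum2[OF vm] by (intro lsum_cong2 k[symmetric]) (auto dest: keys_lco[OF x])
    finally show "ksum (lco C x) (\<lambda>(a, y). ksum (lco C y) (\<lambda>(b, z). G a b z)) = \<dots>" .
  next
    fix G x
    assume G: "trilin (osp C (Suc 0)) (hsp H) (hsp H) (*) G" and x: "x \<in> grade C (Suc 0)"
    let ?k = "\<lambda>y b a. ktens (osp C (Suc 0)) (hhsp H) y (htH H b a)"
    let ?L = "\<lambda>u. ksum u (\<lambda>(x, t). ksum t (\<lambda>(y, z). G x y z))"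
    have k: "G y b a = ?L (?k y b a)" if "y \<in> grade C (Suc 0)" for a b y
      using that by (intro lsum_ktens3[OF vm G _ _ _ vs2 vs2, symmetric]) auto
    have "ksum (rco C x) (\<lambda>(y, a). ksum (rco C y) (\<lambda>(z, b). G z b a))
      = ?L (fsum (rco C x) (\<lambda>(x0, a). fsum (rco C x0) (\<lambda>(y, b). ?k y b a)))"
      unfolding lsum_lsum2[OF vm] by (intro lsum_cong2 k) (auto dest: keys_rco[OF keys_rco[OF x]])
    also have "\<dots> = ?L (fsum (rco C x) (\<lambda>(x0, a). fsum (comult H a) (\<lambda>(a1, a2). ?k x0 a1 a2)))"
      by (rule arg_cong[where f = ?L])
         (use C x in \<open>unfold bicovariant_calculus_def right_comodule_calculus_def, blast\<close>)
    also have "\<dots> = ksum (rco C x) (\<lambda>(y, a). ksum (comult H a) (\<lambda>(a1, a2). G y a1 a2))"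
      unfolding lsum_lsum2[OF vm] by (intro lsum_cong2 k[symmetric]) (auto dest: keys_rco[OF x])
    finally show "ksum (rco C x) (\<lambda>(y, a). ksum (rco C y) (\<lambda>(z, b). G z b a)) = \<dots>" .
  next
    fix x assume x: "x \<in> grade C (Suc 0)"
    show "lsum (oscale C) (lco C x) (\<lambda>(a, y). oscale C (counit H a) y) = x"
      using C x unfolding bicovariant_calculus_def left_comodule_calculus_def by blast
    show "lsum (oscale C) (rco C x) (\<lambda>(y, a). oscale C (counit H a) y) = x"
      using C x unfolding bicovariant_calculus_def right_comodule_calculus_def by blast
  qed (auto simp: inter incl_mult incl_one mult.assoc intro: keys_lco keys_rco)
qed

end

subsection \<open>The dual of a finitely generated bimodule\<close>

lemma bilin_ktens:
  fixes V :: "('k::field, 'a::ab_group_add) vspace" and W :: "('k, 'b::ab_group_add) vspace"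
  shows "bilin V W fscale (ktens V W)"
  unfolding bilin_def linear_map_def ktens_def fst_conv snd_conv
  by (intro conjI ballI allI UNIV_I quot_proj_relI_add quot_proj_relI_scale; unfold ktens_rels_def; blast)

text \<open>Elements of the tensor product are fixed by the projection and hence equal the sum of
  their own pure tensors. So every linear functional on them is a bilinear form summed over the
  entries, and functionals separate points.\<close>

lemma ktensor_eqI:
  fixes V :: "('k::field, 'a::ab_group_add) vspace" and W :: "('k, 'b::ab_group_add) vspace"
  assumes t: "t \<in> snd (ktensor V W)" and u: "u \<in> snd (ktensor V W)"
    and eq: "\<And>F. bilin V W (*) F \<Longrightarrow> ksum t (\<lambda>(a, b). F a b) = ksum u (\<lambda>(a, b). F a b)"
  shows "t = u"
proof -
  note vf = vector_space_fscale
  interpret vector_space "fscale :: 'k \<Rightarrow> ('a \<times> 'b \<Rightarrow>\<^sub>0 'k) \<Rightarrow> _" by (rule vf)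
  let ?q = "quot_proj (ktens_rels V W)"
  have q: "fsum t (\<lambda>(a, b). ktens V W a b) = t" if t: "t \<in> snd (ktensor V W)" for t
  proof -
    have "fsum t (\<lambda>(a, b). ktens V W a b) = fsum t (\<lambda>x. ?q (gen x))"
      by (simp add: ktens_def split_def)
    also have "\<dots> = ?q (fsum t gen)"
      by (rule lin_lsum_UNIV(1)[OF vf linear_quot_proj, symmetric])
    also have "\<dots> = ?q t" by (simp add: lsum_self)
    also have "?q t = t"
    proof -
      have sub: "subspace {t. ?q t = t}"
        using lin_add[OF linear_quot_proj[of "ktens_rels V W"]] lin_scale[OF linear_quot_proj[of "ktens_rels V W"]]
          lin_zero[OF vf vf linear_quot_proj[of "ktens_rels V W"]]
        by (intro subspaceI) auto
      have "snd (ktensor V W) \<subseteq> {t. ?q t = t}"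
        unfolding ktensor_def snd_conv by (rule span_minimal[OF _ sub]) (auto simp: ktens_def quot_proj_idem)
      with t show ?thesis by auto
    qed
    finally show ?thesis .
  qed
  show ?thesis
  proof (rule functional_ext[OF vf])
    fix p :: "('a \<times> 'b \<Rightarrow>\<^sub>0 'k) \<Rightarrow> 'k" assume p: "lin (fscale, UNIV) (*) p"
    have "p t = ksum t (\<lambda>(a, b). p (ktens V W a b))"
      by (subst q[OF t, symmetric]) (rule lin_lsum_UNIV(2)[OF vf p])
    also have "\<dots> = ksum u (\<lambda>(a, b). p (ktens V W a b))"
      by (rule eq) (rule bilin_compose[OF p bilin_ktens])
    also have "\<dots> = p u"
      by (subst (2) q[OF u, symmetric]) (rule lin_lsum_UNIV(2)[OF vf p, symmetric])
    finally show "p t = p u" .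
  qed
qed

text \<open>Coordinates in a basis, indexed by all vectors with value 0 off the basis, so that the
  expansion can be summed over any finite set containing the support.\<close>

lemma (in vector_space) basis_expansion:
  obtains rep :: "'b \<Rightarrow> 'b \<Rightarrow> 'a" where "\<And>b. lin (scale, UNIV) (*) (rep b)" "\<And>a. finite {b. rep b a \<noteq> 0}"
    "\<And>a B. finite B \<Longrightarrow> {b. rep b a \<noteq> 0} \<subseteq> B \<Longrightarrow> (\<Sum>b\<in>B. rep b a *s b) = a"
proof -
  define E where "E = extend_basis {}"
  have E: "independent E" "span E = UNIV"
    unfolding E_def using independent_extend_basis span_extend_basis independent_empty by blast+
  have 3: "(\<Sum>b\<in>B. representation E a b *s b) = a" if "finite B" "{b. representation E a b \<noteq> 0} \<subseteq> B" for a B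
  proof -
    have "(\<Sum>b\<in>B. representation E a b *s b) = (\<Sum>b | representation E a b \<noteq> 0. representation E a b *s b)"
      using that by (intro sum.mono_neutral_right) auto
    then show ?thesis using E by (simp add: sum_nonzero_representation_eq)
  qed
  show thesis
    by (rule that[of "\<lambda>b a. representation E a b"])
      (use E 3 in \<open>auto simp: linear_map_def representation_add representation_scale finite_representation\<close>)
qed

context hopf_sweedler
begin

text \<open>Contracting the first leg with functionals already separates: expanding that leg in a
  basis writes any bilinear \<open>F\<close> as a sum of F b applied to the contraction with the
  coordinate of b. One finite set \<open>B\<close> of basis vectors serves both tensors.\<close>

lemma htensor_eqI:
  fixes W :: "('k, 'b::ab_group_add) vspace"
  assumes W: "vector_space (fst W)" "module.subspace (fst W) (snd W)"
    and t: "t \<in> snd (ktensor (hsp H) W)" and u: "u \<in> snd (ktensor (hsp H) W)"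
    and eq: "\<And>p. lin (hsp H) (*) p \<Longrightarrow> lsum (fst W) t (\<lambda>(a, b). fst W (p a) b) = lsum (fst W) u (\<lambda>(a, b). fst W (p a) b)"
  shows "t = u"
proof (rule ktensor_eqI[OF t u])
  fix F :: "'h \<Rightarrow> 'b \<Rightarrow> 'k" assume F: "bilin (hsp H) W (*) F"
  interpret w: vector_space "fst W" by (rule W)
  obtain rep :: "'h \<Rightarrow> 'h \<Rightarrow> 'k" where rep: "\<And>b. lin (hsp H) (*) (rep b)" "\<And>a. finite {b. rep b a \<noteq> 0}"
    "\<And>a B. finite B \<Longrightarrow> {b. rep b a \<noteq> 0} \<subseteq> B \<Longrightarrow> (\<Sum>b\<in>B. hscale H (rep b a) b) = a"
    using hv.basis_expansion by blast
  define B where "B = (\<Union>(a, x)\<in>keys t \<union> keys u. {b. rep b a \<noteq> 0})"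
  have finB: "finite B" unfolding B_def using rep(2) by auto
  have *: "ksum v (\<lambda>(a, x). F a x) = (\<Sum>b\<in>B. F b (lsum (fst W) v (\<lambda>(a, x). fst W (rep b a) x)))"
    if "v \<in> {t, u}" for v
  proof -
    have kv: "keys v \<subseteq> UNIV \<times> snd W"
      using keys_ktensor[of "hsp H" W v] that t u W hv.vector_space_axioms by fastforce
    have "ksum v (\<lambda>(a, x). F a x) = ksum v (\<lambda>(a, x). \<Sum>b\<in>B. F b (fst W (rep b a) x))"
    proof (rule lsum_cong2)
      fix a x assume ax: "(a, x) \<in> keys v"
      then have "{b. rep b a \<noteq> 0} \<subseteq> B" unfolding B_def using that by auto
      then have "F a x = F (\<Sum>b\<in>B. hscale H (rep b a) b) x" using rep(3) finB by simp
      also have "\<dots> = (\<Sum>b\<in>B. F (hscale H (rep b a) b) x)"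
        by (rule lin_sum[OF hv.vector_space_axioms hv.subspace_UNIV]) (use F ax kv in \<open>auto simp: bilin_def\<close>)
      also have "\<dots> = (\<Sum>b\<in>B. F b (fst W (rep b a) x))"
        using F ax kv by (intro sum.cong) (auto simp: bilin_def linear_map_def)
      finally show "F a x = \<dots>" .
    qed
    also have "\<dots> = (\<Sum>b\<in>B. ksum v (\<lambda>(a, x). F b (fst W (rep b a) x)))"
      unfolding lsum_def split_def by (simp add: sum_distrib_left) (rule sum.swap)
    also have "\<dots> = (\<Sum>b\<in>B. F b (lsum (fst W) v (\<lambda>(a, x). fst W (rep b a) x)))"
      unfolding split_def
      by (intro sum.cong refl lin_lsum[OF W, symmetric])
         (use F kv in \<open>auto simp: bilin_def intro!: w.subspace_scale[OF W(2)]\<close>)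
    finally show ?thesis .
  qed
  show "ksum t (\<lambda>(a, b). F a b) = ksum u (\<lambda>(a, b). F a b)"
    using *[of t] *[of u] eq[OF rep(1)] by simp
qed

end

context hopf_sweedler_bij
begin

lemma lin_T: "lin V (hscale H) F \<Longrightarrow> lin V (hscale H) (\<lambda>x. T (F x))"
  using lin_T0 by (rule lin_compose)

lemma T_mult: "T (a * b) = T b * T a"
  by (rule S_inj) (simp add: antip_mult)

text \<open>\<open>T\<close> is the antipode of the co-opposite Hopf algebra, so it cancels against
  the neighbouring leg in reversed order.\<close>

lemma D3_T:
  assumes vs: "vector_space s" and F: "bilin (hsp H) (hsp H) s F"
  shows "D3 s a (\<lambda>a1 a2 a3. F (T a2 * a1) a3) = F 1 a" "D3 s a (\<lambda>a1 a2 a3. F (a2 * T a1) a3) = F 1 a"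
proof -
  interpret C: hopf_sweedler "cop H" by (rule hopf_sweedler_cop)
  note lins = lin_hopf lin_T bilin_lin1[OF F] bilin_lin2[OF F]
  have lF: "lin (hsp (cop H)) s (\<lambda>x. F x c)" for c using F by (auto simp: bilin_def)
  have "D3 s a (\<lambda>a1 a2 a3. F (T a2 * a1) a3) = lsum s (comult H a) (\<lambda>(a1, a3). lsum s (comult H a1) (\<lambda>(b1, b2). F (T b2 * b1) a3))"
    by (rule D3_left[OF vs]) (auto simp: trilin_def intro!: lins)
  also have "\<dots> = lsum s (comult H a) (\<lambda>(a1, a3). s (counit H a1) (F 1 a3))"
    using C.antip_left[OF vs lF] by (intro lsum_cong2) (simp add: lsum_flip[OF vs])
  also have "\<dots> = F 1 a" using F by (intro counit_left[OF vs]) (auto simp: bilin_def)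
  finally show "D3 s a (\<lambda>a1 a2 a3. F (T a2 * a1) a3) = F 1 a" .
  have "D3 s a (\<lambda>a1 a2 a3. F (a2 * T a1) a3) = lsum s (comult H a) (\<lambda>(a1, a3). lsum s (comult H a1) (\<lambda>(b1, b2). F (b2 * T b1) a3))"
    by (rule D3_left[OF vs]) (auto simp: trilin_def intro!: lins)
  also have "\<dots> = lsum s (comult H a) (\<lambda>(a1, a3). s (counit H a1) (F 1 a3))"
    using C.antip_right[OF vs lF] by (intro lsum_cong2) (simp add: lsum_flip[OF vs])
  also have "\<dots> = F 1 a" using F by (intro counit_left[OF vs]) (auto simp: bilin_def)
  finally show "D3 s a (\<lambda>a1 a2 a3. F (a2 * T a1) a3) = F 1 a" .
qed

end

locale fin_gen_bimodule = bicov_bimodule_bij H M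
  for H :: "('k::field, 'h::ring_1) hopf" and M :: "('k, 'h, 'm::ab_group_add) bimod" +
  assumes fin_gen: "\<exists>B. finite B \<and> B \<subseteq> carr M \<and> (\<forall>m\<in>carr M. \<exists>c. m = (\<Sum>b\<in>B. ract M b (c b)))"
begin

definition dual :: "('m \<Rightarrow> 'h) set" where
  "dual = right_hom (carr M) (ract M) UNIV (*)"

abbreviation dsp where "dsp \<equiv> (vf_scale H, dual)"

lemma vs_vf: "vector_space (vf_scale H :: _ \<Rightarrow> ('m \<Rightarrow> 'h) \<Rightarrow> _)"
  by unfold_locales (auto simp: vf_scale_def fun_eq_iff hv.scale_left_distrib hv.scale_right_distrib)

lemma dualD:
  assumes "X \<in> dual"
  shows "lin (msp M) (hscale H) X" "x \<in> carr M \<Longrightarrow> X (ract M x h) = X x * h" "x \<notin> carr M \<Longrightarrow> X x = 0"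
proof -
  \<comment> \<open>A scalar acts as right multiplication by \<open>hscale H c 1\<close>, so right
    linearity contains linearity over the field.\<close>
  have *: "x \<in> carr M \<Longrightarrow> bscale M c x = ract M x (hscale H c 1)" for x c
    using bilin_ract by (auto simp: bilin_def linear_map_def)
  show "lin (msp M) (hscale H) X"
    using assms by (intro linI) (auto simp: dual_def right_hom_def *)
qed (use assms in \<open>auto simp: dual_def right_hom_def\<close>)

lemma dualI:
  assumes "lin (msp M) (hscale H) X" "\<And>x h. x \<in> carr M \<Longrightarrow> X (ract M x h) = X x * h" "\<And>x. x \<notin> carr M \<Longrightarrow> X x = 0"
  shows "X \<in> dual"
  using assms by (auto simp: dual_def right_hom_def linear_map_def)

lemma subspace_dual: "module.subspace (vf_scale H) dual"
proof -
  interpret v: vector_space "vf_scale H :: _ \<Rightarrow> ('m \<Rightarrow> 'h) \<Rightarrow> _" by (rule vs_vf)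
  show ?thesis
    by (rule v.subspaceI) (auto simp: dual_def right_hom_def vf_scale_def distrib_right hv.scale_right_distrib)
qed

lemma lsum_vf_apply: "lsum (vf_scale H) t F w = hsum H t (\<lambda>x. F x w)"
proof -
  have "(\<Sum>x\<in>A. vf_scale H (c x) (F x)) w = (\<Sum>x\<in>A. hscale H (c x) (F x w))" for A and c
    by (induction A rule: infinite_finite_induct) (auto simp: vf_scale_def)
  then show ?thesis by (simp add: lsum_def)
qed

lemma lsum_vf_apply2: "lsum (vf_scale H) t (\<lambda>(a, b). F a b) w = hsum H t (\<lambda>(a, b). F a b w)"
  by (simp add: lsum_vf_apply split_def)

lemma lin_dual: "X \<in> dual \<Longrightarrow> lin V (bscale M) F \<Longrightarrow> (\<And>x. x \<in> snd V \<Longrightarrow> F x \<in> carr M) \<Longrightarrow> lin V (hscale H) (\<lambda>x. X (F x))"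
  using dualD(1)[of X] by (simp add: linear_map_def)

text \<open>The element \<open>X(\<omega>\<^sub>0)\<^sub>-\<^sub>1 S\<^sup>-\<^sup>1(\<omega>\<^sub>-\<^sub>1) \<otimes> X(\<omega>\<^sub>0)\<^sub>0\<close> of \<open>H \<otimes> H\<close>, paired with the bilinear map \<open>F\<close>.\<close>

definition EL :: "('k \<Rightarrow> 'v \<Rightarrow> 'v::ab_group_add) \<Rightarrow> ('m \<Rightarrow> 'h) \<Rightarrow> 'm \<Rightarrow> ('h \<Rightarrow> 'h \<Rightarrow> 'v) \<Rightarrow> 'v" where
  "EL s X w F = lsum s (lcoact M w) (\<lambda>(w1, w0). lsum s (comult H (X w0)) (\<lambda>(a1, a0). F (a1 * T w1) a0))"

definition dual_lcoact :: "('m \<Rightarrow> 'h) \<Rightarrow> ('h \<times> ('m \<Rightarrow> 'h) \<Rightarrow>\<^sub>0 'k)" where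
  "dual_lcoact X = (THE t. t \<in> snd (ktensor (hsp H) dsp) \<and>
     (\<forall>w\<in>carr M. fsum t (\<lambda>(X1, X0). htH H X1 (X0 w)) = EL fscale X w (htH H)))"

text \<open>Once the first leg is contracted, both sides are functions and can be compared
  pointwise; off the carrier every element of the dual takes the default value 0.\<close>

lemma dual_tensor_eqI:
  assumes "t \<in> snd (ktensor (hsp H) dsp)" "u \<in> snd (ktensor (hsp H) dsp)"
    and "\<And>p w. lin (hsp H) (*) p \<Longrightarrow> w \<in> carr M \<Longrightarrow>
      hsum H t (\<lambda>(a, X). hscale H (p a) (X w)) = hsum H u (\<lambda>(a, X). hscale H (p a) (X w))"
  shows "t = u"
proof (rule htensor_eqI[where W = dsp])
  fix p assume p: "lin (hsp H) (*) (p :: 'h \<Rightarrow> 'k)"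
  have off: "hsum H v (\<lambda>(a, X). hscale H (p a) (X w)) = 0" if "w \<notin> carr M" "v \<in> snd (ktensor (hsp H) dsp)" for v w
  proof -
    have "keys v \<subseteq> UNIV \<times> dual"
      using keys_ktensor[of "hsp H" dsp v] that by (simp add: hv.vector_space_axioms vs_vf subspace_dual)
    then have "hsum H v (\<lambda>(a, X). hscale H (p a) (X w)) = hsum H v (\<lambda>(a, X). 0)"
      using that by (intro lsum_cong2) (auto simp: dualD(3))
    then show ?thesis by (simp add: lsum_def split_def)
  qed
  show "lsum (fst dsp) t (\<lambda>(a, b). fst dsp (p a) b) = lsum (fst dsp) u (\<lambda>(a, b). fst dsp (p a) b)"
  proof
    fix w
    show "lsum (fst dsp) t (\<lambda>(a, b). fst dsp (p a) b) w = lsum (fst dsp) u (\<lambda>(a, b). fst dsp (p a) b) w"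
      using assms(3)[OF p, of w] off[OF _ assms(1), of w] off[OF _ assms(2), of w]
      by (cases "w \<in> carr M") (simp_all add: lsum_vf_apply2, simp_all add: vf_scale_def)
  qed
qed (use assms in \<open>simp_all add: vs_vf subspace_dual\<close>)

lemma lin_EL:
  assumes "vector_space s" "X \<in> dual"
  shows "lin (msp M) s (\<lambda>w. EL s X w F)"
  unfolding EL_def using assms by (auto intro!: lin_bim)

text \<open>The factor \<open>h\<close> enters through \<open>X w0 * h2\<close> and through
  \<open>T (w1 * h1)\<close>. Between them the first leg contains \<open>p * T h1\<close> with
  consecutive legs of \<open>h\<close>, which cancels. This makes the coordinates of the coaction
  right linear.\<close>

lemma EL_ract:
  assumes vs: "vector_space s" and F: "bilin (hsp H) (hsp H) s F" and X: "X \<in> dual" and w: "w \<in> carr M"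
  shows "EL s X (ract M w h) F = EL s X w (\<lambda>a b. F a (b * h))"
proof -
  note lins = lin_bim lin_T bilin_lin1[OF F] bilin_lin2[OF F] lin_dual[OF X] vs
  have "EL s X (ract M w h) F = lsum s (comult H h) (\<lambda>(h1, h2). lsum s (lcoact M w) (\<lambda>(w1, w0).
      lsum s (comult H (X (ract M w0 h2))) (\<lambda>(a1, a0). F (a1 * T (w1 * h1)) a0)))"
    unfolding EL_def by (rule lcoact_ract[OF vs _ w]) (auto simp: bilin_def intro!: lins)
  also have "\<dots> = lsum s (comult H h) (\<lambda>(h1, h2). lsum s (lcoact M w) (\<lambda>(w1, w0).
      lsum s (comult H (X w0 * h2)) (\<lambda>(a1, a0). F (a1 * T (w1 * h1)) a0)))"
    by (intro lsum_cong2) (auto simp: dualD(2)[OF X] dest: lcoact_keys[OF w])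
  also have "\<dots> = lsum s (comult H h) (\<lambda>(h1, h2). lsum s (lcoact M w) (\<lambda>(w1, w0).
      lsum s (comult H (X w0)) (\<lambda>(a1, a0). lsum s (comult H h2) (\<lambda>(p, q). F (a1 * p * T (w1 * h1)) (a0 * q)))))"
    by (intro lsum_cong2 comult_mult[OF vs]) (auto simp: bilin_def intro!: lins)
  also have "\<dots> = lsum s (comult H h) (\<lambda>(h1, h2). lsum s (lcoact M w) (\<lambda>(w1, w0). lsum s (comult H h2) (\<lambda>(p, q).
      lsum s (comult H (X w0)) (\<lambda>(a1, a0). F (a1 * ((p * T h1) * T w1)) (a0 * q)))))"
    by (intro lsum_cong2, subst lsum_swap2[OF vs]) (simp add: T_mult mult.assoc)
  also have "\<dots> = D3 s h (\<lambda>h1 p q. lsum s (lcoact M w) (\<lambda>(w1, w0).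
      lsum s (comult H (X w0)) (\<lambda>(a1, a0). F (a1 * ((p * T h1) * T w1)) (a0 * q))))"
    unfolding D3_def by (intro lsum_cong2 lsum_swap2[OF vs])
  also have "\<dots> = lsum s (lcoact M w) (\<lambda>(w1, w0). lsum s (comult H (X w0)) (\<lambda>(a1, a0). F (a1 * (1 * T w1)) (a0 * h)))"
    by (rule D3_T(2)[OF vs, where F = "\<lambda>u q. lsum s (lcoact M w) (\<lambda>(w1, w0).
      lsum s (comult H (X w0)) (\<lambda>(a1, a0). F (a1 * (u * T w1)) (a0 * q)))"]) (auto simp: bilin_def intro!: lins)
  finally show ?thesis by (simp add: EL_def)
qed

text \<open>Contracting the first leg of the prescribed element with the coordinates of a basis of
  \<open>H\<close> gives maps \<open>Y b\<close> in the dual, and the coaction should be the sum of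
  all b \<otimes> \<open>Y b\<close>. Finite generation allows a finite sum: it is correct on
  generators by expansion in the basis, and then everywhere by right linearity.\<close>

lemma dual_lcoact_exists:
  assumes X: "X \<in> dual"
  shows "\<exists>t. t \<in> snd (ktensor (hsp H) dsp) \<and> (\<forall>w\<in>carr M. fsum t (\<lambda>(X1, X0). htH H X1 (X0 w)) = EL fscale X w (htH H))"
proof -
  note hs = hv.vector_space_axioms
  obtain B where B: "finite B" "B \<subseteq> carr M" "\<And>m. m \<in> carr M \<Longrightarrow> \<exists>c. m = (\<Sum>b\<in>B. ract M b (c b))"
    using fin_gen by blast
  obtain rep :: "'h \<Rightarrow> 'h \<Rightarrow> 'k" where rep: "\<And>b. lin (hsp H) (*) (rep b)" "\<And>a. finite {b. rep b a \<noteq> 0}"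
    "\<And>a B. finite B \<Longrightarrow> {b. rep b a \<noteq> 0} \<subseteq> B \<Longrightarrow> (\<Sum>b\<in>B. hscale H (rep b a) b) = a"
    using hv.basis_expansion by blast
  \<comment> \<open>The basis vectors that occur in first legs when \<open>w\<close> is a generator;
    finitely many, because \<open>B\<close> and all supports are finite.\<close>
  define E where "E = (\<Union>w\<in>B. \<Union>(w1, w0)\<in>keys (lcoact M w). \<Union>(a1, a0)\<in>keys (comult H (X w0)). {b. rep b (a1 * T w1) \<noteq> 0})"
  have finE: "finite E" unfolding E_def using B(1) rep(2) by auto
  define Y where "Y b w = (if w \<in> carr M then EL (hscale H) X w (\<lambda>a c. hscale H (rep b a) c) else 0)" for b w
  have bil: "bilin (hsp H) (hsp H) (hscale H) (\<lambda>a c. hscale H (p a) c)" if "lin (hsp H) (*) p" for p :: "'h \<Rightarrow> 'k"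
    unfolding bilin_def using that by (auto intro!: lin_hopf)
  have ELr: "EL (hscale H) X (ract M w h) (\<lambda>a c. hscale H (p a) c) = EL (hscale H) X w (\<lambda>a c. hscale H (p a) c) * h"
    if "lin (hsp H) (*) p" "w \<in> carr M" for p :: "'h \<Rightarrow> 'k" and w h
  proof -
    have l: "lin (hsp H) (hscale H) (\<lambda>x. x * h)" by (intro lin_hopf)
    show ?thesis unfolding EL_ract[OF hs bil[OF that(1)] X that(2)]
      by (simp add: EL_def lin_lsum_UNIV(2)[OF hs l])
  qed
  have Y: "Y b \<in> dual" for b
  proof (rule dualI)
    show "lin (msp M) (hscale H) (Y b)"
    proof -
      interpret m: vector_space "bscale M" by (rule vsM)
      have "lin (msp M) (hscale H) (\<lambda>w. EL (hscale H) X w (\<lambda>a c. hscale H (rep b a) c))" by (rule lin_EL[OF hs X])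
      then show ?thesis
        by (simp add: linear_map_def Y_def m.subspace_add[OF subspace_carr] m.subspace_scale[OF subspace_carr])
    qed
  qed (auto simp: Y_def ELr[OF rep(1)])
  have key: "(\<Sum>b\<in>E. hscale H (p b) (Y b w)) = EL (hscale H) X w (\<lambda>a c. hscale H (p a) c)"
    if p: "lin (hsp H) (*) p" and w: "w \<in> carr M" for p :: "'h \<Rightarrow> 'k" and w
  proof -
    have gen: "(\<Sum>b\<in>E. hscale H (p b) (Y b w)) = EL (hscale H) X w (\<lambda>a c. hscale H (p a) c)" if w: "w \<in> B" for w
    proof -
      have wM: "w \<in> carr M" using w B by auto
      have l: "lin (hsp H) (hscale H) (\<lambda>x. hscale H c x)" for c by (intro lin_hopf)
      have "(\<Sum>b\<in>E. hscale H (p b) (Y b w)) = (\<Sum>b\<in>E. EL (hscale H) X w (\<lambda>a c. hscale H (p b) (hscale H (rep b a) c)))"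
        by (simp only: Y_def wM if_True EL_def lin_lsum_UNIV(2)[OF hs l])
      also have "\<dots> = hsum H (lcoact M w) (\<lambda>(w1, w0). \<Sum>b\<in>E. hsum H (comult H (X w0)) (\<lambda>(a1, a0). hscale H (p b) (hscale H (rep b (a1 * T w1)) a0)))"
        unfolding EL_def lsum_def split_def hv.scale_sum_right by (rule sum.swap)
      also have "\<dots> = hsum H (lcoact M w) (\<lambda>(w1, w0). hsum H (comult H (X w0)) (\<lambda>(a1, a0). \<Sum>b\<in>E. hscale H (p b) (hscale H (rep b (a1 * T w1)) a0)))"
        unfolding lsum_def split_def hv.scale_sum_right by (intro sum.cong refl sum.swap)
      also have "\<dots> = EL (hscale H) X w (\<lambda>a c. hscale H (p a) c)"
        unfolding EL_def
      proof (intro lsum_cong2)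
        fix w1 w0 a1 a0 assume k: "(w1, w0) \<in> keys (lcoact M w)" "(a1, a0) \<in> keys (comult H (X w0))"
        have sub: "{b. rep b (a1 * T w1) \<noteq> 0} \<subseteq> E" unfolding E_def using w k by fastforce
        have "p (a1 * T w1) = p (\<Sum>b\<in>E. hscale H (rep b (a1 * T w1)) b)" using rep(3)[OF finE sub] by simp
        also have "\<dots> = (\<Sum>b\<in>E. p (hscale H (rep b (a1 * T w1)) b))"
          by (rule lin_sum[OF hs _ p]) auto
        also have "\<dots> = (\<Sum>b\<in>E. rep b (a1 * T w1) * p b)" using p by (simp add: linear_map_def)
        finally show "(\<Sum>b\<in>E. hscale H (p b) (hscale H (rep b (a1 * T w1)) a0)) = hscale H (p (a1 * T w1)) a0"
          by (simp add: hv.scale_sum_left mult.commute)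
      qed
      finally show ?thesis .
    qed
    \<comment> \<open>Both sides are additive and right linear in \<open>w\<close>, so the identity
      passes from the generators to \<open>w\<close>.\<close>
    obtain c where c: "w = (\<Sum>b\<in>B. ract M b (c b))" using B(3) w by blast
    have "(\<Sum>b\<in>E. hscale H (p b) (Y b w)) = (\<Sum>b\<in>E. \<Sum>x\<in>B. hscale H (p b) (Y b x) * c x)"
      unfolding c using B(2) lin_sum[OF vsM subspace_carr dualD(1)[OF Y], of B "\<lambda>b. ract M b (c b)"]
      by (intro sum.cong refl) (auto simp: hv.scale_sum_right dualD(2)[OF Y] subset_iff intro!: sum.cong)
    also have "\<dots> = (\<Sum>x\<in>B. (\<Sum>b\<in>E. hscale H (p b) (Y b x)) * c x)"
      by (subst sum.swap) (simp add: sum_distrib_right)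
    also have "\<dots> = (\<Sum>x\<in>B. EL (hscale H) X (ract M x (c x)) (\<lambda>a c. hscale H (p a) c))"
      using gen ELr[OF p] B(2) by (intro sum.cong) auto
    also have "\<dots> = EL (hscale H) X w (\<lambda>a c. hscale H (p a) c)"
      unfolding c using B(2) by (subst lin_sum[OF vsM subspace_carr lin_EL[OF hs X]]) auto
    finally show ?thesis .
  qed
  define t where "t = (\<Sum>b\<in>E. ktens (hsp H) dsp b (Y b))"
  interpret f: vector_space "fscale :: 'k \<Rightarrow> ('h \<times> ('m \<Rightarrow> 'h) \<Rightarrow>\<^sub>0 'k) \<Rightarrow> _" by (rule vector_space_fscale)
  have t: "t \<in> snd (ktensor (hsp H) dsp)"
    unfolding t_def ktensor_def snd_conv by (intro f.span_sum f.span_base) (use Y in auto)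
  have lt: "lsum s t (\<lambda>(a, X). F a X) = (\<Sum>b\<in>E. F b (Y b))" if "vector_space s" "bilin (hsp H) dsp s F"
    for s :: "'k \<Rightarrow> 'v \<Rightarrow> 'v::ab_group_add" and F
    unfolding t_def lsum_sum[OF that(1)] using Y by (simp add: lsum_ktens[OF that])
  have "fsum t (\<lambda>(X1, X0). htH H X1 (X0 w)) = EL fscale X w (htH H)" if w: "w \<in> carr M" for w
  proof (rule htensor_eqI[of "hsp H"])
    show "vector_space (fst (hsp H))" "module.subspace (fst (hsp H)) (snd (hsp H))" by (simp_all add: hs)
    interpret g: vector_space "fscale :: 'k \<Rightarrow> ('h \<times> 'h \<Rightarrow>\<^sub>0 'k) \<Rightarrow> _" by (rule vector_space_fscale)
    have sub: "g.subspace (snd (hhsp H))" by (simp add: ktensor_def)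
    show "fsum t (\<lambda>(X1, X0). htH H X1 (X0 w)) \<in> snd (hhsp H)" "EL fscale X w (htH H) \<in> snd (hhsp H)"
      unfolding EL_def split_def by (intro lsum_in_subspace vector_space_fscale sub ktens_in_ktensor; simp)+
    fix p assume p: "lin (hsp H) (*) (p :: 'h \<Rightarrow> 'k)"
    have "hsum H (fsum t (\<lambda>(X1, X0). htH H X1 (X0 w))) (\<lambda>(a, b). hscale H (p a) b)
      = hsum H t (\<lambda>(X1, X0). hscale H (p X1) (X0 w))"
      by (simp add: lsum_lsum2[OF hs] lsum_ktens[OF hs bil[OF p]])
    also have "\<dots> = (\<Sum>b\<in>E. hscale H (p b) (Y b w))"
      by (rule lt[OF hs]) (use p in \<open>auto simp: bilin_def linear_map_def vf_scale_def hv.scale_left_distrib hv.scale_right_distrib mult.commute\<close>)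
    also have "\<dots> = EL (hscale H) X w (\<lambda>a c. hscale H (p a) c)" by (rule key[OF p w])
    also have "\<dots> = hsum H (EL fscale X w (htH H)) (\<lambda>(a, b). hscale H (p a) b)"
      by (simp add: EL_def lsum_lsum2[OF hs] lsum_ktens[OF hs bil[OF p]])
    finally show "lsum (fst (hsp H)) (fsum t (\<lambda>(X1, X0). htH H X1 (X0 w))) (\<lambda>(a, b). fst (hsp H) (p a) b)
      = lsum (fst (hsp H)) (EL fscale X w (htH H)) (\<lambda>(a, b). fst (hsp H) (p a) b)" by simp
  qed
  with t show ?thesis by blast
qed

lemma dual_functional:
  assumes t: "\<forall>w\<in>carr M. fsum t (\<lambda>(X1, X0). htH H X1 (X0 w)) = EL fscale X w (htH H)"
    and vs: "vector_space s" and F: "bilin (hsp H) (hsp H) s F" and w: "w \<in> carr M"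
  shows "lsum s t (\<lambda>(a, Y). F a (Y w)) = EL s X w F"
proof -
  have "lsum s (fsum t (\<lambda>(X1, X0). htH H X1 (X0 w))) (\<lambda>(a, b). F a b) = lsum s (EL fscale X w (htH H)) (\<lambda>(a, b). F a b)"
    using t w by simp
  then show ?thesis by (simp add: EL_def lsum_lsum2[OF vs] lsum_ktens[OF vs F])
qed

lemma bilin_functional: "lin (hsp H) (*) p \<Longrightarrow> bilin (hsp H) (hsp H) (hscale H) (\<lambda>a c. hscale H (p a) c)"
  unfolding bilin_def by (auto intro!: lin_hopf)

lemma dual_lcoact:
  assumes X: "X \<in> dual"
  shows dual_lcoact_closed: "dual_lcoact X \<in> snd (ktensor (hsp H) dsp)"
    and dual_lcoact_eval: "vector_space s \<Longrightarrow> bilin (hsp H) (hsp H) s F \<Longrightarrow> w \<in> carr M \<Longrightarrow>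
      lsum s (dual_lcoact X) (\<lambda>(a, Y). F a (Y w)) = EL s X w F"
proof -
  note hs = hv.vector_space_axioms
  let ?P = "\<lambda>t. t \<in> snd (ktensor (hsp H) dsp) \<and> (\<forall>w\<in>carr M. fsum t (\<lambda>(X1, X0). htH H X1 (X0 w)) = EL fscale X w (htH H))"
  have "\<exists>!t. ?P t"
  proof (rule ex_ex1I[OF dual_lcoact_exists[OF X]])
    show "t = u" if "?P t" "?P u" for t u
      using that dual_functional[of t X, OF _ hs bilin_functional] dual_functional[of u X, OF _ hs bilin_functional]
      by (intro dual_tensor_eqI) auto
  qed
  from theI'[OF this] have *: "?P (dual_lcoact X)" unfolding dual_lcoact_def .
  then show "dual_lcoact X \<in> snd (ktensor (hsp H) dsp)" by blast
  show "vector_space s \<Longrightarrow> bilin (hsp H) (hsp H) s F \<Longrightarrow> w \<in> carr M \<Longrightarrow>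
      lsum s (dual_lcoact X) (\<lambda>(a, Y). F a (Y w)) = EL s X w F"
    using dual_functional * by blast
qed

lemma keys_dual_tensor: "t \<in> snd (ktensor (hsp H) dsp) \<Longrightarrow> (a, Y) \<in> keys t \<Longrightarrow> Y \<in> dual"
  using keys_ktensor[of "hsp H" dsp t] by (auto simp: hv.vector_space_axioms vs_vf subspace_dual)

lemma dual_lact_closed:
  assumes X: "X \<in> dual"
  shows "(\<lambda>w. a * X w) \<in> dual"
  by (rule dualI) (simp_all add: lin_mult dualD(1)[OF X] dualD(2)[OF X] dualD(3)[OF X] mult.assoc)

lemma dual_ract_closed: "X \<in> dual \<Longrightarrow> (\<lambda>w. if w \<in> carr M then X (lact M b w) else 0) \<in> dual"
proof (rule dualI)
  assume X: "X \<in> dual"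
  interpret m: vector_space "bscale M" by (rule vsM)
  have "lin (msp M) (hscale H) (\<lambda>w. X (lact M b w))" by (auto intro!: lin_dual[OF X] lin_bim)
  then show "lin (msp M) (hscale H) (\<lambda>w. if w \<in> carr M then X (lact M b w) else 0)"
    by (simp add: linear_map_def m.subspace_add[OF subspace_carr] m.subspace_scale[OF subspace_carr])
  show "(if ract M x h \<in> carr M then X (lact M b (ract M x h)) else 0) = (if x \<in> carr M then X (lact M b x) else 0) * h"
    if "x \<in> carr M" for x h
    using that by (simp add: dualD(2)[OF X])
qed auto

lemma lin_eval_id: "lin (vf_scale H, A) (hscale H) (\<lambda>X. X w)"
  by (simp add: linear_map_def vf_scale_def)

lemma lin_EL_dual: "vector_space s \<Longrightarrow> lin dsp s (\<lambda>X. EL s X w F)"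
  unfolding EL_def by (intro lin_lsum_fun2 lin_lsum_arg lin_comult lin_eval_id)

lemma subspace_dual_tensor: "module.subspace fscale (snd (ktensor (hsp H) dsp))"
proof -
  interpret vector_space "fscale :: 'k \<Rightarrow> ('h \<times> ('m \<Rightarrow> 'h) \<Rightarrow>\<^sub>0 'k) \<Rightarrow> _" by (rule vector_space_fscale)
  show ?thesis by (simp add: ktensor_def)
qed

lemma lin_dual_lcoact: "lin dsp fscale dual_lcoact"
proof -
  interpret d: vector_space "vf_scale H :: _ \<Rightarrow> ('m \<Rightarrow> 'h) \<Rightarrow> _" by (rule vs_vf)
  interpret f: vector_space "fscale :: 'k \<Rightarrow> ('h \<times> ('m \<Rightarrow> 'h) \<Rightarrow>\<^sub>0 'k) \<Rightarrow> _" by (rule vector_space_fscale)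
  note hs = hv.vector_space_axioms
  note cl = dual_lcoact_closed d.subspace_add[OF subspace_dual] d.subspace_scale[OF subspace_dual]
    f.subspace_add[OF subspace_dual_tensor] f.subspace_scale[OF subspace_dual_tensor]
  note ev = dual_lcoact_eval[OF _ hs bilin_functional]
  show ?thesis
  proof (rule linI)
    fix X Y assume "X \<in> snd dsp" "Y \<in> snd dsp"
    then show "dual_lcoact (X + Y) = dual_lcoact X + dual_lcoact Y"
      using lin_add[OF lin_EL_dual[OF hs]] by (intro dual_tensor_eqI) (auto simp: cl ev lsum_add[OF hs])
  next
    fix c X assume "X \<in> snd dsp"
    then show "dual_lcoact (fst dsp c X) = fscale c (dual_lcoact X)"
      using lin_scale[OF lin_EL_dual[OF hs]] by (intro dual_tensor_eqI) (auto simp: cl ev lsum_fscale[OF hs])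
  qed
qed

text \<open>A common form for the right-hand sides of the two compatibility laws below:
  \<open>A\<close> multiplies the leg in \<open>H\<close> from the left or from the right, and
  \<open>R\<close> is the corresponding action on the dual. As a genuine element of H \<otimes>
  dual, \<open>u h\<close> can be compared with a coaction by
  \<open>dual_tensor_eqI\<close>.\<close>

lemma dual_action_tensor:
  fixes A :: "'h \<Rightarrow> 'h \<Rightarrow> 'h"
  assumes X: "X \<in> dual" and R: "\<forall>h. \<forall>Y\<in>dual. R h Y \<in> dual"
  defines "u \<equiv> \<lambda>h. fsum (comult H h) (\<lambda>(h1, h2). fsum (dual_lcoact X) (\<lambda>(a, Y). ktens (hsp H) dsp (A h1 a) (R h2 Y)))"
  shows "u h \<in> snd (ktensor (hsp H) dsp)"
    and "vector_space s \<Longrightarrow> bilin (hsp H) dsp s G \<Longrightarrow> lsum s (u h) (\<lambda>(a, Y). G a Y)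
      = lsum s (comult H h) (\<lambda>(h1, h2). lsum s (dual_lcoact X) (\<lambda>(a, Y). G (A h1 a) (R h2 Y)))"
proof -
  have kY: "(a, Y) \<in> keys (dual_lcoact X) \<Longrightarrow> Y \<in> dual" for a Y
    by (rule keys_dual_tensor[OF dual_lcoact_closed[OF X]])
  show "u h \<in> snd (ktensor (hsp H) dsp)"
    unfolding u_def split_def
    by (intro lsum_in_subspace vector_space_fscale subspace_dual_tensor ktens_in_ktensor) (auto simp: R dest: kY)
  assume vs: "vector_space s" and G: "bilin (hsp H) dsp s G"
  show "lsum s (u h) (\<lambda>(a, Y). G a Y)
      = lsum s (comult H h) (\<lambda>(h1, h2). lsum s (dual_lcoact X) (\<lambda>(a, Y). G (A h1 a) (R h2 Y)))"
    unfolding u_def lsum_lsum2[OF vs]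
    by (intro lsum_cong2 lsum_ktens[OF vs G]) (auto simp: R dest: kY)
qed

lemma dual_lcoact_lact:
  assumes F: "bilin (hsp H) dsp (*) F" and X: "X \<in> dual"
  shows "ksum (dual_lcoact (\<lambda>w. h * X w)) (\<lambda>(a, Y). F a Y)
    = ksum (comult H h) (\<lambda>(h1, h2). ksum (dual_lcoact X) (\<lambda>(a, Y). F (h1 * a) (\<lambda>w. h2 * Y w)))"
proof -
  note hs = hv.vector_space_axioms and vm = vector_space_mult
  define u where "u = fsum (comult H h) (\<lambda>(h1, h2). fsum (dual_lcoact X) (\<lambda>(a, Y).
    ktens (hsp H) dsp (h1 * a) (\<lambda>w. h2 * Y w)))"
  have "\<forall>h. \<forall>Y\<in>dual. (\<lambda>w. h * Y w) \<in> dual" by (simp add: dual_lact_closed)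
  note u = dual_action_tensor[OF X this, where A = "\<lambda>h1 a. h1 * a" and h = h, folded u_def]
  have "dual_lcoact (\<lambda>w. h * X w) = u"
  proof (rule dual_tensor_eqI[OF dual_lcoact_closed[OF dual_lact_closed[OF X]] u(1)])
    fix p w assume p: "lin (hsp H) (*) (p :: 'h \<Rightarrow> 'k)" and w: "w \<in> carr M"
    note ls = lin_bim lin_T lin_compose[OF p]
    have "hsum H (dual_lcoact (\<lambda>w. h * X w)) (\<lambda>(a, Y). hscale H (p a) (Y w))
      = EL (hscale H) (\<lambda>w. h * X w) w (\<lambda>a c. hscale H (p a) c)"
      by (rule dual_lcoact_eval[OF dual_lact_closed[OF X] hs bilin_functional[OF p] w])
    also have "\<dots> = hsum H (lcoact M w) (\<lambda>(w1, w0). hsum H (comult H h) (\<lambda>(h1, h2).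
        hsum H (comult H (X w0)) (\<lambda>(a1, a0). hscale H (p (h1 * a1 * T w1)) (h2 * a0))))"
      unfolding EL_def by (intro lsum_cong2 comult_mult[OF hs]) (auto simp: bilin_def intro!: ls)
    also have "\<dots> = hsum H (comult H h) (\<lambda>(h1, h2). EL (hscale H) X w (\<lambda>a c. hscale H (p (h1 * a)) (h2 * c)))"
      unfolding EL_def mult.assoc by (rule lsum_swap2[OF hs])
    also have "\<dots> = hsum H (comult H h) (\<lambda>(h1, h2). hsum H (dual_lcoact X) (\<lambda>(a, Y). hscale H (p (h1 * a)) (h2 * Y w)))"
      by (intro lsum_cong2 dual_lcoact_eval[OF X hs _ w, symmetric]) (auto simp: bilin_def intro!: ls)
    also have "\<dots> = hsum H u (\<lambda>(a, Y). hscale H (p a) (Y w))"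
      by (rule u(2)[OF hs, symmetric]) (auto simp: bilin_def intro!: ls lin_eval_id)
    finally show "hsum H (dual_lcoact (\<lambda>w. h * X w)) (\<lambda>(a, Y). hscale H (p a) (Y w)) = \<dots>" .
  qed
  with u(2)[OF vm F] show ?thesis by simp
qed

lemma dual_lcoact_ract:
  assumes F: "bilin (hsp H) dsp (*) F" and X: "X \<in> dual"
  defines "R \<equiv> \<lambda>X b w. if w \<in> carr M then X (lact M b w) else 0"
  shows "ksum (dual_lcoact (R X h)) (\<lambda>(a, Y). F a Y)
    = ksum (comult H h) (\<lambda>(h1, h2). ksum (dual_lcoact X) (\<lambda>(a, Y). F (a * h1) (R Y h2)))"
proof -
  note hs = hv.vector_space_axioms and vm = vector_space_mult
  have Rc: "Y \<in> dual \<Longrightarrow> R Y b \<in> dual" for Y b unfolding R_def by (rule dual_ract_closed)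
  define u where "u = fsum (comult H h) (\<lambda>(h1, h2). fsum (dual_lcoact X) (\<lambda>(a, Y).
    ktens (hsp H) dsp (a * h1) (R Y h2)))"
  have "\<forall>h. \<forall>Y\<in>dual. R Y h \<in> dual" by (simp add: Rc)
  note u = dual_action_tensor[OF X this, where A = "\<lambda>h1 a. a * h1" and h = h, folded u_def]
  have "dual_lcoact (R X h) = u"
  proof (rule dual_tensor_eqI[OF dual_lcoact_closed[OF Rc[OF X]] u(1)])
    fix p w assume p: "lin (hsp H) (*) (p :: 'h \<Rightarrow> 'k)" and w: "w \<in> carr M"
    note ls = lin_bim lin_T lin_compose[OF p] lin_dual[OF X]
    have "hsum H u (\<lambda>(a, Y). hscale H (p a) (Y w))
      = hsum H (comult H h) (\<lambda>(h1, h2). hsum H (dual_lcoact X) (\<lambda>(a, Y). hscale H (p (a * h1)) (R Y h2 w)))"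
      by (rule u(2)[OF hs]) (auto simp: bilin_def intro!: ls lin_eval_id)
    also have "\<dots> = hsum H (comult H h) (\<lambda>(h1, h2). hsum H (dual_lcoact X) (\<lambda>(a, Y). hscale H (p (a * h1)) (Y (lact M h2 w))))"
      using w by (simp add: R_def)
    also have "\<dots> = hsum H (comult H h) (\<lambda>(h1, h2). EL (hscale H) X (lact M h2 w) (\<lambda>a c. hscale H (p (a * h1)) c))"
      by (intro lsum_cong2 dual_lcoact_eval[OF X hs]) (auto simp: bilin_def w intro!: ls)
    also have "\<dots> = hsum H (comult H h) (\<lambda>(h1, h2). hsum H (comult H h2) (\<lambda>(h3, h4). hsum H (lcoact M w) (\<lambda>(w1, w0).
        hsum H (comult H (X (lact M h4 w0))) (\<lambda>(a1, a0). hscale H (p (a1 * T (h3 * w1) * h1)) a0))))"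
      unfolding EL_def by (intro lsum_cong2 lcoact_lact[OF hs _ w]) (auto simp: bilin_def intro!: ls)
    \<comment> \<open>\<open>T (h3 * w1) * h1 = T w1 * (T h3 * h1)\<close>, where \<open>h1\<close>
      and \<open>h3\<close> are consecutive legs of \<open>h\<close> and cancel by
      \<open>D3_T\<close>.\<close>
    also have "\<dots> = D3 (hscale H) h (\<lambda>h1 h3 h4. hsum H (lcoact M w) (\<lambda>(w1, w0).
        hsum H (comult H (X (lact M h4 w0))) (\<lambda>(a1, a0). hscale H (p (a1 * (T w1 * (T h3 * h1)))) a0)))"
      unfolding D3_def by (simp add: T_mult mult.assoc)
    also have "\<dots> = hsum H (lcoact M w) (\<lambda>(w1, w0).
        hsum H (comult H (X (lact M h w0))) (\<lambda>(a1, a0). hscale H (p (a1 * (T w1 * 1))) a0))"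
      by (rule D3_T(1)[OF hs, where F = "\<lambda>u q. hsum H (lcoact M w) (\<lambda>(w1, w0).
        hsum H (comult H (X (lact M q w0))) (\<lambda>(a1, a0). hscale H (p (a1 * (T w1 * u))) a0))"])
         (auto simp: bilin_def intro!: ls dest: lcoact_keys[OF w])
    also have "\<dots> = EL (hscale H) (R X h) w (\<lambda>a c. hscale H (p a) c)"
      unfolding EL_def by (intro lsum_cong2 lsum_cong) (auto simp: R_def dest: lcoact_keys[OF w])
    also have "\<dots> = hsum H (dual_lcoact (R X h)) (\<lambda>(a, Y). hscale H (p a) (Y w))"
      by (rule dual_lcoact_eval[OF Rc[OF X] hs bilin_functional[OF p] w, symmetric])
    finally show "hsum H (dual_lcoact (R X h)) (\<lambda>(a, Y). hscale H (p a) (Y w)) = hsum H u (\<lambda>(a, Y). hscale H (p a) (Y w))" ..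
  qed
  with u(2)[OF vm F] show ?thesis by simp
qed

section \<open>The right coaction of the dual\<close>

lemma fin_gen_bimodule_cop: "fin_gen_bimodule (cop H) (copM M)"
proof -
  interpret C: bicov_bimodule_bij "cop H" "copM M" by (rule bicov_bimodule_bij_cop)
  show ?thesis by unfold_locales (use fin_gen in simp)
qed

interpretation C: fin_gen_bimodule "cop H" "copM M"
  by (rule fin_gen_bimodule_cop)

lemma vf_scale_cop [simp]: "vf_scale (cop H) = vf_scale H"
  by (simp add: vf_scale_def fun_eq_iff)

lemma cop_dual [simp]: "C.dual = dual"
  by (simp add: C.dual_def dual_def)

text \<open>Exchanging the legs of an element of H \<otimes> dual gives a formal sum that need not
  be a chosen representative in dual \<otimes> H; reassembling it with \<open>ktens\<close> puts it
  there.\<close>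

definition dual_rcoact :: "('m \<Rightarrow> 'h) \<Rightarrow> (('m \<Rightarrow> 'h) \<times> 'h \<Rightarrow>\<^sub>0 'k)" where
  "dual_rcoact X = fsum (flip (fin_gen_bimodule.dual_lcoact (cop H) (copM M) X)) (\<lambda>(Y, a). ktens dsp (hsp H) Y a)"

lemma cop_lcoact_closed: "X \<in> dual \<Longrightarrow> C.dual_lcoact X \<in> snd (ktensor (hsp H) dsp)"
  using C.dual_lcoact_closed[of X] by simp

lemma cop_keys: "X \<in> dual \<Longrightarrow> (a, Y) \<in> keys (C.dual_lcoact X) \<Longrightarrow> Y \<in> dual"
  by (rule keys_dual_tensor[OF cop_lcoact_closed])

lemma dual_rcoact_closed:
  assumes X: "X \<in> dual"
  shows "dual_rcoact X \<in> snd (ktensor dsp (hsp H))"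
proof -
  interpret f: vector_space "fscale :: 'k \<Rightarrow> (('m \<Rightarrow> 'h) \<times> 'h \<Rightarrow>\<^sub>0 'k) \<Rightarrow> _" by (rule vector_space_fscale)
  have sub: "f.subspace (snd (ktensor dsp (hsp H)))" by (simp add: ktensor_def)
  show ?thesis
    unfolding dual_rcoact_def split_def
    by (intro lsum_in_subspace[OF vector_space_fscale sub] ktens_in_ktensor) (auto dest!: keys_flip dest: cop_keys[OF X])
qed

lemma lsum_dual_rcoact:
  assumes "vector_space s" "bilin dsp (hsp H) s F" "X \<in> dual"
  shows "lsum s (dual_rcoact X) (\<lambda>(Y, a). F Y a) = lsum s (C.dual_lcoact X) (\<lambda>(a, Y). F Y a)"
proof -
  have "lsum s (dual_rcoact X) (\<lambda>(Y, a). F Y a) = lsum s (flip (C.dual_lcoact X)) (\<lambda>(Y, a). F Y a)"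
    unfolding dual_rcoact_def lsum_lsum2[OF assms(1)]
    by (intro lsum_cong2 lsum_ktens[OF assms(1,2)]) (auto dest!: keys_flip dest: cop_keys[OF assms(3)])
  then show ?thesis by (simp add: lsum_flip[OF assms(1)])
qed

lemma EL_cop: "vector_space s \<Longrightarrow> C.EL s X w F
  = lsum s (rcoact M w) (\<lambda>(w0, w1). lsum s (comult H (X w0)) (\<lambda>(a0, a1). F (a1 * S w1) a0))"
  unfolding C.EL_def copM_simps cop_simps by (simp add: lsum_flip inv_inv_eq[OF bij])

text \<open>An equivalence, because the right coaction of vector fields is a definite description.
  Both directions come from the left coaction over \<open>cop H\<close>, whose inverse antipode is
  \<open>S\<close>.\<close>

lemma dual_rcoact_char:
  assumes X: "X \<in> dual" and t: "t \<in> snd (ktensor dsp (hsp H))"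
  shows "(\<forall>w\<in>carr M. fsum t (\<lambda>(X0, X1). htH H (X0 w) X1)
       = fsum (rcoact M w) (\<lambda>(w0, w1). fsum (comult H (X w0)) (\<lambda>(a0, a1). htH H a0 (a1 * S w1))))
    \<longleftrightarrow> t = dual_rcoact X" (is "?P t \<longleftrightarrow> _")
proof
  note vf = vector_space_fscale and hs = hv.vector_space_axioms and vm = vector_space_mult
  have bil: "bilin (hsp H) (hsp H) fscale (\<lambda>a c. htH H c a)" using bilin_ktens[of "hsp H" "hsp H"] by (simp add: bilin_def)
  assume tX: "t = dual_rcoact X"
  show "?P t"
  proof
    fix w assume w: "w \<in> carr M"
    have "fsum t (\<lambda>(X0, X1). htH H (X0 w) X1) = fsum (C.dual_lcoact X) (\<lambda>(a, Y). htH H (Y w) a)"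
      unfolding tX
      by (rule lsum_dual_rcoact[OF vf _ X])
         (use bilin_ktens[of "hsp H" "hsp H"] in \<open>auto simp: bilin_def linear_map_def vf_scale_def\<close>)
    also have "\<dots> = C.EL fscale X w (\<lambda>a c. htH H c a)"
      using C.dual_lcoact_eval[OF _ vf, of X "\<lambda>a c. htH H c a" w] X w bil by simp
    finally show "fsum t (\<lambda>(X0, X1). htH H (X0 w) X1)
       = fsum (rcoact M w) (\<lambda>(w0, w1). fsum (comult H (X w0)) (\<lambda>(a0, a1). htH H a0 (a1 * S w1)))"
      by (simp add: EL_cop[OF vf])
  qed
next
  note vf = vector_space_fscale and hs = hv.vector_space_axioms and vm = vector_space_mult
  assume P: "?P t"
  have kt: "(Y, a) \<in> keys t \<Longrightarrow> Y \<in> dual" for Y a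
    using keys_ktensor[of dsp "hsp H" t] t by (auto simp: hs vs_vf subspace_dual)
  \<comment> \<open>\<open>t\<close> is transported to H \<otimes> dual, where
    \<open>dual_tensor_eqI\<close> provides uniqueness.\<close>
  define u where "u = fsum (flip t) (\<lambda>(a, Y). ktens (hsp H) dsp a Y)"
  have u: "u \<in> snd (ktensor (hsp H) dsp)"
    unfolding u_def split_def
    by (intro lsum_in_subspace vf ktens_in_ktensor subspace_dual_tensor) (auto dest!: keys_flip kt)
  have lu: "lsum s u (\<lambda>(a, Y). G a Y) = lsum s t (\<lambda>(Y, a). G a Y)"
    if "vector_space s" "bilin (hsp H) dsp s G" for s :: "'k \<Rightarrow> 'v \<Rightarrow> 'v::ab_group_add" and G
  proof -
    have "lsum s u (\<lambda>(a, Y). G a Y) = lsum s (flip t) (\<lambda>(a, Y). G a Y)"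
      unfolding u_def lsum_lsum2[OF that(1)]
      by (intro lsum_cong2 lsum_ktens[OF that]) (auto dest!: keys_flip kt)
    then show ?thesis by (simp add: lsum_flip[OF that(1)])
  qed
  have "u = C.dual_lcoact X"
  proof (rule dual_tensor_eqI[OF u cop_lcoact_closed[OF X]])
    fix p w assume p: "lin (hsp H) (*) (p :: 'h \<Rightarrow> 'k)" and w: "w \<in> carr M"
    have bp: "bilin (hsp H) (hsp H) (hscale H) (\<lambda>c a. hscale H (p a) c)"
      using bilin_functional[OF p] by (simp add: bilin_def)
    have "hsum H u (\<lambda>(a, Y). hscale H (p a) (Y w)) = hsum H t (\<lambda>(Y, a). hscale H (p a) (Y w))"
      by (rule lu[OF hs]) (auto simp: bilin_def intro!: lin_bim lin_compose[OF p] lin_eval_id)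
    also have "\<dots> = hsum H (fsum t (\<lambda>(X0, X1). htH H (X0 w) X1)) (\<lambda>(c, a). hscale H (p a) c)"
      by (simp add: lsum_lsum2[OF hs] lsum_ktens[OF hs bp])
    also have "\<dots> = hsum H (fsum (rcoact M w) (\<lambda>(w0, w1). fsum (comult H (X w0)) (\<lambda>(a0, a1). htH H a0 (a1 * S w1)))) (\<lambda>(c, a). hscale H (p a) c)"
      using P w by simp
    also have "\<dots> = C.EL (hscale H) X w (\<lambda>a c. hscale H (p a) c)"
      by (simp add: EL_cop[OF hs] lsum_lsum2[OF hs] lsum_ktens[OF hs bp])
    also have "\<dots> = hsum H (C.dual_lcoact X) (\<lambda>(a, Y). hscale H (p a) (Y w))"
      using C.dual_lcoact_eval[of X "hscale H" "\<lambda>a c. hscale H (p a) c" w] hs bilin_functional[OF p] X w by simp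
    finally show "hsum H u (\<lambda>(a, Y). hscale H (p a) (Y w)) = \<dots>" .
  qed
  show "t = dual_rcoact X"
  proof (rule ktensor_eqI[OF t dual_rcoact_closed[OF X]])
    fix F :: "('m \<Rightarrow> 'h) \<Rightarrow> 'h \<Rightarrow> 'k" assume F: "bilin dsp (hsp H) (*) F"
    then have F': "bilin (hsp H) dsp (*) (\<lambda>a Y. F Y a)" by (simp add: bilin_def)
    show "ksum t (\<lambda>(a, b). F a b) = ksum (dual_rcoact X) (\<lambda>(a, b). F a b)"
      using lu[OF vm F'] \<open>u = C.dual_lcoact X\<close> by (simp add: lsum_dual_rcoact[OF vm F X])
  qed
qed

lemma lin_dual_rcoact: "lin dsp fscale dual_rcoact"
  using C.lin_dual_lcoact unfolding dual_rcoact_def[abs_def]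
  by (simp add: linear_map_def flip_add flip_fscale lsum_add lsum_fscale vector_space_fscale)

text \<open>
  The coactions of \<open>N\<close> are prescribed only on the dual, since those of the vector fields are given by definite
  descriptions and are unspecified elsewhere.
\<close>

lemma cov_bimodule_dual:
  assumes N: "carr N = dual" "bscale N = vf_scale H" "lact N = (\<lambda>a X w. a * X w)"
    "ract N = (\<lambda>X b w. if w \<in> carr M then X (lact M b w) else 0)"
    and lN: "\<And>X. X \<in> dual \<Longrightarrow> lcoact N X = dual_lcoact X"
    and rN: "\<And>X. X \<in> dual \<Longrightarrow> rcoact N X = dual_rcoact X"
  shows "cov_bimodule H N"
proof -
  note hs = hv.vector_space_axioms and vm = vector_space_mult
  interpret d: vector_space "vf_scale H :: _ \<Rightarrow> ('m \<Rightarrow> 'h) \<Rightarrow> _" by (rule vs_vf)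
  let ?R = "\<lambda>X b w. if w \<in> carr M then X (lact M b w) else (0::'h)"
  have dsub: "X \<in> dual \<Longrightarrow> Y \<in> dual \<Longrightarrow> X + Y \<in> dual" "X \<in> dual \<Longrightarrow> vf_scale H c X \<in> dual" for X Y c
    using d.subspace_add[OF subspace_dual] d.subspace_scale[OF subspace_dual] by auto
  show ?thesis
  proof (intro cov_bimodule.intro cov_bimodule_axioms.intro hopf_sweedler_axioms, unfold N)
    show "vector_space (vf_scale H :: _ \<Rightarrow> ('m \<Rightarrow> 'h) \<Rightarrow> _)" "module.subspace (vf_scale H) dual"
      by (rule vs_vf subspace_dual)+
    show "bilin (hsp H) dsp (vf_scale H) (\<lambda>a X w. a * X w)"
      by (auto simp: bilin_def linear_map_def vf_scale_def fun_eq_iff distrib_left distrib_right)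
    have *: "X (lact M (a + b) w) = X (lact M a w) + X (lact M b w)" "X (lact M (hscale H c a) w) = hscale H c (X (lact M a w))"
      if "X \<in> dual" "w \<in> carr M" for X w a b c
      using lin_add[OF lin_dual[OF that(1) lin_lact2[where V = "hsp H" and F = "\<lambda>x. x" and m = w]], of a b]
        lin_scale[OF lin_dual[OF that(1) lin_lact2[where V = "hsp H" and F = "\<lambda>x. x" and m = w]], of a c] that
      by (simp_all add: lin_id[OF hs])
    show "bilin dsp (hsp H) (vf_scale H) ?R"
      by (auto simp: bilin_def linear_map_def vf_scale_def fun_eq_iff *)
    show "lin dsp fscale (lcoact N)" "lin dsp fscale (rcoact N)"
      using lin_dual_lcoact lin_dual_rcoact by (simp_all add: linear_map_def lN rN dsub)
    show "Y \<in> dual" if "X \<in> dual" "(a, Y) \<in> keys (lcoact N X)" for X a Y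
      using that keys_dual_tensor[OF dual_lcoact_closed] by (simp add: lN)
    show "Y \<in> dual" if "X \<in> dual" "(Y, a) \<in> keys (rcoact N X)" for X a Y
      using that keys_ktensor[of dsp "hsp H" "dual_rcoact X"] dual_rcoact_closed[of X]
      by (auto simp: rN hs vs_vf subspace_dual)
  next
    fix F :: "'h \<Rightarrow> ('m \<Rightarrow> 'h) \<Rightarrow> 'k" and X h
    assume F: "bilin (hsp H) dsp (*) F" and X: "X \<in> dual"
    show "ksum (lcoact N (\<lambda>w. h * X w)) (\<lambda>(a, Y). F a Y)
      = ksum (comult H h) (\<lambda>(h1, h2). ksum (lcoact N X) (\<lambda>(a, Y). F (h1 * a) (\<lambda>w. h2 * Y w)))"
      unfolding lN[OF X] lN[OF dual_lact_closed[OF X]] by (rule dual_lcoact_lact[OF F X])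
    show "ksum (lcoact N (?R X h)) (\<lambda>(a, Y). F a Y)
      = ksum (comult H h) (\<lambda>(h1, h2). ksum (lcoact N X) (\<lambda>(a, Y). F (a * h1) (?R Y h2)))"
      unfolding lN[OF X] lN[OF dual_ract_closed[OF X]] by (rule dual_lcoact_ract[OF F X])
  next
    fix F :: "('m \<Rightarrow> 'h) \<Rightarrow> 'h \<Rightarrow> 'k" and X h
    assume F: "bilin dsp (hsp H) (*) F" and X: "X \<in> dual"
    then have F': "bilin (hsp (cop H)) C.dsp (*) (\<lambda>a Y. F Y a)" by (simp add: bilin_def)
    have X': "X \<in> C.dual" using X by simp
    \<comment> \<open>A form precomposed with the actions is again bilinear; this permits replacing
      the right coaction by the left one over \<open>cop H\<close> inside the iterated sums as
      well.\<close>
    have FL: "bilin dsp (hsp H) (*) (\<lambda>Y a. F (\<lambda>w. h1 * Y w) (h2 * a))" for h1 h2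
      using F dual_lact_closed
      by (auto simp: bilin_def intro!: bilin_lin2[OF F] lin_hopf)
         (auto simp: linear_map_def vf_scale_def distrib_left plus_fun_def dual_lact_closed)
    have RA: "?R (Y + Z) b = ?R Y b + ?R Z b" and RS: "?R (vf_scale H c Y) b = vf_scale H c (?R Y b)"
      for Y Z :: "'m \<Rightarrow> 'h" and b c
      by (auto simp: vf_scale_def)
    have FR: "bilin dsp (hsp H) (*) (\<lambda>Y a. F (?R Y h1) (a * h2))" for h1 h2
    proof -
      have "lin dsp (*) (\<lambda>Y. F (?R Y h1) (a * h2))" for a
      proof (rule linI, goal_cases)
        case (1 Y Z)
        then show ?case
          using F unfolding RA by (simp add: bilin_def linear_map_def dual_ract_closed del: plus_fun_apply)
      next
        case (2 c Y)
        then show ?case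
          using F unfolding fst_conv RS by (simp add: bilin_def linear_map_def dual_ract_closed)
      qed
      moreover have "lin (hsp H) (*) (\<lambda>a. F (?R Y h1) (a * h2))" if "Y \<in> dual" for Y
        by (intro bilin_lin2[OF F] lin_hopf) (simp add: dual_ract_closed that)
      ultimately show ?thesis by (simp add: bilin_def)
    qed
    show "ksum (rcoact N (\<lambda>w. h * X w)) (\<lambda>(Y, a). F Y a)
      = ksum (comult H h) (\<lambda>(h1, h2). ksum (rcoact N X) (\<lambda>(Y, a). F (\<lambda>w. h1 * Y w) (h2 * a)))"
      unfolding rN[OF X] rN[OF dual_lact_closed[OF X]] lsum_dual_rcoact[OF vm F dual_lact_closed[OF X]] lsum_dual_rcoact[OF vm FL X]
      using C.dual_lcoact_lact[OF F' X', of h] unfolding cop_simps lsum_flip[OF vm] .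
    show "ksum (rcoact N (?R X h)) (\<lambda>(Y, a). F Y a)
      = ksum (comult H h) (\<lambda>(h1, h2). ksum (rcoact N X) (\<lambda>(Y, a). F (?R Y h1) (a * h2)))"
      unfolding rN[OF X] rN[OF dual_ract_closed[OF X]] lsum_dual_rcoact[OF vm F dual_ract_closed[OF X]] lsum_dual_rcoact[OF vm FR X]
      using C.dual_lcoact_ract[OF F' X', of h] unfolding cop_simps copM_simps lsum_flip[OF vm] .
  qed (auto simp: fun_eq_iff dual_lact_closed dual_ract_closed mult.assoc intro: dualD(3))
qed

end

context
  fixes H :: "('k::field, 'h::ring_1) hopf" and C :: "('k, 'h, 'o::ring_1) calculus"
  assumes H: "hopf_algebra H" and b: "bij (antip H)" and C: "bicovariant_calculus H C" and fg: "fin_gen_right (Omega1 C)"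
begin

lemma fin_gen_bimodule_Omega1: "fin_gen_bimodule H (Omega1 C)"
proof -
  interpret bicov_bimodule H "Omega1 C" by (rule bicov_bimodule_Omega1[OF H C])
  show ?thesis by unfold_locales (use b fg in \<open>auto simp: fin_gen_right_def\<close>)
qed

lemma cov_bimodule_VF: "cov_bimodule H (VF H C)"
proof -
  interpret fin_gen_bimodule H "Omega1 C" by (rule fin_gen_bimodule_Omega1)
  have d: "vfields C = dual" unfolding vfields_def dual_def by (simp add: Omega1_def)
  show ?thesis
  proof (rule cov_bimodule_dual)
    show "carr (VF H C) = dual" "bscale (VF H C) = vf_scale H" "lact (VF H C) = (\<lambda>a X w. a * X w)"
      by (simp_all add: VF_def d)
    show "ract (VF H C) = (\<lambda>X b w. if w \<in> carr (Omega1 C) then X (lact (Omega1 C) b w) else 0)"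
      by (simp add: VF_def fun_eq_iff Omega1_def)
    \<comment> \<open>For the left coaction the two definite descriptions coincide after unfolding.
      The right coaction of the dual is built differently, so its values are identified through
      \<open>dual_rcoact_char\<close>.\<close>
    show "lcoact (VF H C) X = dual_lcoact X" for X
      unfolding dual_lcoact_def EL_def d[symmetric] by (simp add: VF_def vf_lcoact_def Omega1_def)
    show "rcoact (VF H C) X = dual_rcoact X" if "X \<in> dual" for X
    proof -
      have "vf_rcoact H C X = dual_rcoact X"
        unfolding vf_rcoact_def d
      proof (rule the_equality, goal_cases)
        case 1
        show ?case
          using dual_rcoact_char[OF that dual_rcoact_closed[OF that]] dual_rcoact_closed[OF that]
          by (simp only: Omega1_simps[OF H C])
      next
        case (2 t)
        then show ?case
          using dual_rcoact_char[OF that, of t] by (simp only: Omega1_simps[OF H C])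
      qed
      then show ?thesis by (simp add: VF_def)
    qed
  qed
qed

end

subsection \<open>Symmetric tensors and metrics\<close>

text \<open>Elements of the tensor square are chosen representatives, so projecting their entries
  again reproduces them. \<open>wor_at\<close> performs such a second projection after
  \<open>wor\<close>.\<close>

lemma htpow2_self:
  assumes t: "t \<in> htpow M 2"
  shows "fsum t (htens M) = t"
proof (rule htpow2_eqI[where M = M and t = t and f = "\<lambda>t. fsum t (htens M)" and g = "\<lambda>t. t", OF _ _ vector_space_fscale _ t])
  show "lin (fscale, UNIV) fscale (\<lambda>t. fsum t (htens M))"
    by (simp add: linear_map_def lsum_add lsum_fscale vector_space_fscale)
  show "fsum (htens M [x, y]) (htens M) = htens M [x, y]" if "x \<in> carr M" "y \<in> carr M" for x y
    by (rule lsum_htens2[OF vector_space_fscale])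
       (auto simp: bilin_def linear_map_def htens_add1 htens_add2 htens_scale1 htens_scale2 htens_balanced)
qed (simp add: linear_map_def)

section \<open>The antisymmetrizer in degree two\<close>

context cov_bimodule
begin

lemma wor_at_0:
  assumes t: "t \<in> htpow M 2"
  shows "wor_at H M 0 t = wor H M t"
proof (rule htpow2_eqI[where M = M and t = t and f = "wor_at H M 0" and g = "wor H M", OF _ lin_wor vector_space_fscale _ t])
  note vf = vector_space_fscale
  show "lin (fscale, UNIV) fscale (wor_at H M 0)"
    by (simp add: linear_map_def wor_at_def lsum_add lsum_fscale vf)
  fix x y assume xy: "x \<in> carr M" "y \<in> carr M"
  have "wor_at H M 0 (htens M [x, y]) = fsum (wor H M (htens M [x, y])) (htens M)"
    unfolding wor_at_def
    by (subst lsum_htens2[OF vf])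
       (auto simp: bilin_def htens_balanced intro!: lin_lsum_arg[OF vf] lin_compose[OF lin_wor] lin_htens1 lin_htens2 lin_id[OF vsM])
  also have "\<dots> = wor H M (htens M [x, y])"
    by (rule htpow2_self[OF wor_closed[OF htens_in_htpow2[OF xy]]])
  finally show "wor_at H M 0 (htens M [x, y]) = wor H M (htens M [x, y])" .
qed

lemma wor_inv_at_0: "wor_inv_at H M 2 0 = wor_inv H M"
proof
  fix t
  have "(\<lambda>u. u \<in> htpow M 2 \<and> wor_at H M 0 u = t) = (\<lambda>u. u \<in> htpow M 2 \<and> wor H M u = t)"
    using wor_at_0 by auto
  then show "wor_inv_at H M 2 0 t = wor_inv H M t"
    by (simp add: wor_inv_at_def wor_inv_def inv_into_def)
qed

text \<open>\<open>braid_perm\<close> picks an arbitrary reduced word. In degree two each of the two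
  permutations has exactly one, so the choice is determined.\<close>

lemma reduced_word_id: "reduced_word 2 id is \<longleftrightarrow> is = []"
  unfolding reduced_word_def by (auto dest: spec[of _ "[]"])

lemma reduced_word_transpose: "reduced_word 2 (Transposition.transpose 0 1) is \<longleftrightarrow> is = [0]"
proof
  have ne: "(id :: nat \<Rightarrow> nat) \<noteq> Transposition.transpose 0 1"
    by (metis id_apply transpose_apply_first zero_neq_one)
  show "is = [0]" if "reduced_word 2 (Transposition.transpose 0 1) is"
  proof -
    have 1: "\<forall>i\<in>set is. i = 0" "apply_adj_transps is = Transposition.transpose 0 1"
      using that by (auto simp: reduced_word_def)
    have "length is \<le> length [0::nat]"
      using that unfolding reduced_word_def by (elim conjE allE[of _ "[0]"]) simp
    then show ?thesis using 1 ne by (cases "is") auto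
  qed
  have "length js > 0" if "apply_adj_transps js = Transposition.transpose 0 1" for js
    using that ne by (cases js) auto
  then show "reduced_word 2 (Transposition.transpose 0 1) is" if "is = [0]"
    using that by (auto simp: reduced_word_def Suc_le_eq)
qed

lemma antisymmetrizer_2: "antisymmetrizer H M 2 t = t - wor_inv H M t"
proof -
  have "{..<2} = {0, 1::nat}" by auto
  then have p: "{p. p permutes {..<2}} = {id, Transposition.transpose 0 (1::nat)}"
    by (simp only: permutes_doubleton_iff) auto
  have ne: "(id :: nat \<Rightarrow> nat) \<noteq> Transposition.transpose 0 1"
    by (metis id_apply transpose_apply_first zero_neq_one)
  have f1: "fscale (- 1) u = - u" "fscale 1 u = u" for u :: "'m list \<Rightarrow>\<^sub>0 'k"
    by (rule poly_mapping_eqI, simp)+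
  have "reduced_word 2 id = (\<lambda>is. is = [])" "reduced_word 2 (Transposition.transpose 0 1) = (\<lambda>is. is = [0])"
    by (simp_all add: fun_eq_iff reduced_word_id reduced_word_transpose del: One_nat_def)
  then show ?thesis
    unfolding antisymmetrizer_def p using ne
    by (simp add: braid_perm_def wor_inv_at_0 sign_swap_id f1)
qed

end

context
  fixes H :: "('k::field, 'h::ring_1) hopf" and C :: "('k, 'h, 'o::ring_1) calculus"
  assumes H: "hopf_algebra H" and b: "bij (antip H)" and C: "bicovariant_calculus H C" and fg: "fin_gen_right (Omega1 C)"
begin

interpretation O: fin_gen_bimodule H "Omega1 C" by (rule fin_gen_bimodule_Omega1[OF H b C fg])
interpretation V: cov_bimodule H "VF H C" by (rule cov_bimodule_VF[OF H b C fg])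

declare Omega1_simps[OF H C, simp]

text \<open>By bijectivity of the braiding, its fixed points and those of its inverse agree. This
  description lets symmetric tensors inherit closure properties from the linearity of
  \<open>wor\<close>.\<close>

lemma sym2_iff: "t \<in> sym2 H C \<longleftrightarrow> t \<in> htpow (Omega1 C) 2 \<and> wor H (Omega1 C) t = t"
proof -
  have "fscale 1 t = t" by (rule poly_mapping_eqI) simp
  then show ?thesis
    using bij_betw_inv_into_left[OF O.bij_betw_wor, of t] bij_betw_inv_into_right[OF O.bij_betw_wor, of t]
    unfolding sym2_def eigsp_def wor_inv_def by auto
qed

lemma subspace_sym2: "module.subspace fscale (sym2 H C)"
proof -
  interpret f: vector_space "fscale :: 'k \<Rightarrow> ('o list \<Rightarrow>\<^sub>0 'k) \<Rightarrow> _" by (rule vector_space_fscale)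
  note sub = subspace_htpow[of "Omega1 C" 2]
  show ?thesis
    using lin_add[OF O.lin_wor] lin_scale[OF O.lin_wor] lin_zero[OF vector_space_fscale vector_space_fscale O.lin_wor]
      f.subspace_add[OF sub] f.subspace_scale[OF sub] f.subspace_0[OF sub]
    by (intro f.subspaceI) (auto simp: sym2_iff)
qed

lemma sym2_ract: "t \<in> sym2 H C \<Longrightarrow> ht_ract (Omega1 C) t h \<in> sym2 H C"
  by (auto simp: sym2_iff O.ht_ract_closed O.wor_ht_ract)

text \<open>The calculus identifies the kernel of the wedge product with that of the
  antisymmetrizer. In degree two the latter is the identity minus the inverse braiding, whose kernel
  is the eigenspace for 1.\<close>

lemma wedge_eq_0_iff:
  assumes W: "woronowicz_calculus H C" and t: "t \<in> htpow (Omega1 C) 2"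
  shows "wedge C t = 0 \<longleftrightarrow> t \<in> sym2 H C"
proof -
  have "wedge C t = 0 \<longleftrightarrow> antisymmetrizer H (Omega1 C) 2 t = 0"
    using W t unfolding woronowicz_calculus_def by (meson one_le_numeral)
  also have "\<dots> \<longleftrightarrow> t \<in> sym2 H C"
  proof -
    have "fscale 1 t = t" by (rule poly_mapping_eqI) simp
    then show ?thesis using t by (auto simp: O.antisymmetrizer_2 sym2_def eigsp_def)
  qed
  finally show ?thesis .
qed

lemma VF_simps [simp]: "carr (VF H C) = vfields C" "bscale (VF H C) = vf_scale H" "lact (VF H C) a X = (\<lambda>w. a * X w)"
  by (simp_all add: VF_def)

lemma ract_VF_apply: "ract (VF H C) X b w = (if w \<in> grade C 1 then X (incl C b * w) else 0)"
  by (simp add: VF_def)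

lemma vfields_eq: "vfields C = O.dual"
  unfolding vfields_def O.dual_def by (simp add: Omega1_def)

lemma vfieldsD:
  assumes "X \<in> vfields C"
  shows "lin (osp C 1) (hscale H) X" "w \<in> grade C 1 \<Longrightarrow> X (w * incl C h) = X w * h" "w \<notin> grade C 1 \<Longrightarrow> X w = 0"
  using O.dualD[of X] assms unfolding vfields_eq Omega1_simps[OF H C] by auto

lemma lin_vf_eval: "lin U (vf_scale H) F \<Longrightarrow> lin U (hscale H) (\<lambda>x. F x w)"
  by (simp add: linear_map_def vf_scale_def)

text \<open>For one-forms \<open>x, y\<close> this is \<open>\<langle>X \<otimes> Y, x \<otimes> y\<rangle>\<close>, and the value is \<open>0\<close> if \<open>x\<close> or \<open>y\<close> is not a one-form.\<close>

definition vpair :: "('o \<Rightarrow> 'h) \<Rightarrow> ('o \<Rightarrow> 'h) \<Rightarrow> 'o \<Rightarrow> 'o \<Rightarrow> 'h" where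
  "vpair X Y x = ract (VF H C) X (Y x)"

lemma vpair_closed: "X \<in> vfields C \<Longrightarrow> vpair X Y x \<in> vfields C"
  using V.ract_closed[of X "Y x"] by (simp add: vpair_def)

lemma bilin_vpair: "bilin (msp (VF H C)) (msp (VF H C)) (vf_scale H) (\<lambda>X Y. vpair X Y x)"
  using V.bilin_ract unfolding vpair_def bilin_def
  by (auto simp: linear_map_def vf_scale_def)

lemma vpair_balanced: "X \<in> vfields C \<Longrightarrow> vpair (ract (VF H C) X h) Y x = vpair X (lact (VF H C) h Y) x"
  using V.ract_ract[of X h "Y x"] by (simp add: vpair_def)

lemma vpair_lact: "X \<in> vfields C \<Longrightarrow> vpair (lact (VF H C) h X) Y x = lact (VF H C) h (vpair X Y x)"
  using V.lact_ract[of X h "Y x"] unfolding vpair_def by simp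

lemma vpair_ract_arg: "X \<in> vfields C \<Longrightarrow> Y \<in> vfields C \<Longrightarrow> x \<in> grade C 1 \<Longrightarrow>
  vpair X Y (x * incl C h) = ract (VF H C) (vpair X Y x) h"
  using V.ract_ract[of X "Y x" h] by (simp add: vpair_def vfieldsD(2))

lemma sharp_htens: "sharp H C (htens (VF H C) [X, Y]) x = vpair X Y x"
proof -
  have "lsum (vf_scale H) (htens (VF H C) [X, Y]) (\<lambda>Xs. vpair (Xs ! 0) (Xs ! 1) x) = vpair X Y x"
    by (subst lsum_htens2[OF O.vs_vf]) (use bilin_vpair vpair_balanced in auto)
  then show ?thesis by (simp add: sharp_def vpair_def)
qed

lemma lin_sharp: "lin (fscale, UNIV) (vf_scale H) (\<lambda>g. sharp H C g x)"
  unfolding sharp_def by (simp add: linear_map_def lsum_add lsum_fscale O.vs_vf)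

lemma lin_vf_lact: "lin (vf_scale H, UNIV) (vf_scale H) (\<lambda>X w. h * X w)"
  by (auto simp: linear_map_def vf_scale_def distrib_left)

lemma sharp_lact:
  assumes g: "g \<in> htpow (VF H C) 2"
  shows "sharp H C (ht_lact (VF H C) f g) x = (\<lambda>w. f * sharp H C g x w)"
  by (rule htpow2_eqI[where M = "VF H C" and t = g, OF lin_compose[OF lin_sharp V.lin_ht_lact] lin_compose[OF lin_vf_lact lin_sharp] O.vs_vf _ g])
     (use vpair_lact in \<open>simp add: V.ht_lact_htens sharp_htens del: VF_simps(3)\<close>, simp)

text \<open>The braiding is left linear, so f g stays symmetric. Left multiplication by
  \<open>f\<close> commutes with the right action and is inverted on vector fields by
  \<open>finv\<close>, so the map induced by f g is again a right linear bijection.\<close>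

lemma metric_lact:
  assumes g: "metric H C g" and f: "f * finv = 1" "finv * f = 1"
  shows "metric H C (ht_lact (VF H C) f g)"
proof -
  have g2: "g \<in> htpow (VF H C) 2" and wg: "wor H (VF H C) g = g"
    and sh: "sharp H C g \<in> right_hom (grade C 1) (ract (Omega1 C)) (vfields C) (ract (VF H C))"
    and bij: "bij_betw (sharp H C g) (grade C 1) (vfields C)"
    using g by (auto simp: metric_def)
  have sl: "sharp H C (ht_lact (VF H C) f g) = (\<lambda>X w. f * X w) \<circ> sharp H C g"
    by (simp add: fun_eq_iff sharp_lact[OF g2])
  have vl: "(\<lambda>w. h * X w) \<in> vfields C" if "X \<in> vfields C" for X h
    using V.lact_closed[of X h] that by simp
  have "bij_betw (\<lambda>X w. f * X w) (vfields C) (vfields C)"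
    by (rule bij_betw_byWitness[where f' = "\<lambda>X w. finv * X w"]) (auto simp: vl f mult.assoc[symmetric])
  then have b': "bij_betw (sharp H C (ht_lact (VF H C) f g)) (grade C 1) (vfields C)"
    unfolding sl by (rule bij_betw_trans[OF bij])
  have "sharp H C (ht_lact (VF H C) f g) \<in> right_hom (grade C 1) (ract (Omega1 C)) (vfields C) (ract (VF H C))"
  proof -
    have "(\<lambda>w. f * ract (VF H C) X h w) = ract (VF H C) (\<lambda>w. f * X w) h" if "X \<in> vfields C" for X h
      using V.lact_ract[of X f h] that by simp
    then show ?thesis
      using sh unfolding sl right_hom_def by (auto simp: vl distrib_left)
  qed
  then show ?thesis
    using b' V.ht_lact_closed[OF g2, of f] V.wor_ht_lact[OF g2, of f] by (simp add: metric_def wg)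
qed

lemma lsum_vpair_htens:
  assumes X: "X \<in> vfields C" and Y: "Y \<in> vfields C"
  shows "hsum H (htens (Omega1 C) [x, y]) (\<lambda>ws. vpair X Y (ws ! 0) (ws ! 1)) = vpair X Y x y"
proof (subst lsum_htens2[OF O.hv.vector_space_axioms])
  have YD: "lin (osp C 1) (hscale H) Y" by (rule vfieldsD(1)[OF Y])
  have "lin (osp C 1) (hscale H) (\<lambda>x. vpair X Y x y)" for y
    unfolding vpair_def by (rule lin_vf_eval) (use V.lin_ract2[OF YD, of X] X in simp)
  moreover have "lin (osp C 1) (hscale H) (vpair X Y x)" for x
    by (rule vfieldsD(1)[OF vpair_closed[OF X]])
  ultimately show "bilin (msp (Omega1 C)) (msp (Omega1 C)) (hscale H) (\<lambda>x y. vpair X Y ([x, y] ! 0) ([x, y] ! 1))"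
    by (simp add: bilin_def)
  show "vpair X Y ([ract (Omega1 C) x h, y] ! 0) ([ract (Omega1 C) x h, y] ! 1)
    = vpair X Y ([x, lact (Omega1 C) h y] ! 0) ([x, lact (Omega1 C) h y] ! 1)"
    if "x \<in> carr (Omega1 C)" "y \<in> carr (Omega1 C)" for x y h
    using that vpair_ract_arg[OF X Y, of x h] incl_mult_grade[OF H C, of y 1 h] by (simp add: ract_VF_apply)
qed simp

text \<open>\<open>vpair\<close> is bilinear in the vector fields at arbitrary arguments, so
  \<open>t\<close> may be any formal sum. Consequently \<open>pair2_lact\<close> and
  \<open>pair3_lact\<close> apply wherever the tensor lies.\<close>

lemma pair2_htens:
  "pair2 H C (htens (VF H C) [X, Y]) t = hsum H t (\<lambda>ws. vpair X Y (ws ! 0) (ws ! 1))"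
proof -
  note hs = O.hv.vector_space_axioms
  have "hsum H (htens (VF H C) [X, Y]) (\<lambda>Xs. hsum H t (\<lambda>ws. vpair (Xs ! 0) (Xs ! 1) (ws ! 0) (ws ! 1)))
    = hsum H t (\<lambda>ws. vpair X Y (ws ! 0) (ws ! 1))"
  proof (subst lsum_htens2[OF hs])
    show "bilin (msp (VF H C)) (msp (VF H C)) (hscale H) (\<lambda>x y. hsum H t (\<lambda>ws. vpair ([x, y] ! 0) ([x, y] ! 1) (ws ! 0) (ws ! 1)))"
      using bilin_vpair unfolding bilin_def
      by (intro conjI ballI lin_lsum_fun[OF hs]; intro lin_vf_eval; simp)
  qed (use vpair_balanced in auto)
  then show ?thesis by (simp add: pair2_def vpair_def)
qed

lemma lin_pair2: "lin (fscale, UNIV) (hscale H) (\<lambda>g. pair2 H C g t)" "lin (fscale, UNIV) (hscale H) (pair2 H C g)"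
proof -
  note hs = O.hv.vector_space_axioms
  show "lin (fscale, UNIV) (hscale H) (\<lambda>g. pair2 H C g t)"
    unfolding pair2_def by (simp add: linear_map_def lsum_add lsum_fscale hs)
  show "lin (fscale, UNIV) (hscale H) (pair2 H C g)"
    unfolding pair2_def[abs_def]
    by (intro lin_lsum_fun[OF hs] lin_lsum_arg[OF hs] lin_id[OF vector_space_fscale])
qed

lemma pair2_lact:
  assumes g: "g \<in> htpow (VF H C) 2"
  shows "pair2 H C (ht_lact (VF H C) f g) t = f * pair2 H C g t"
proof (rule htpow2_eqI[where M = "VF H C" and t = g and f = "\<lambda>g. pair2 H C (ht_lact (VF H C) f g) t" and g = "\<lambda>g. f * pair2 H C g t",
    OF lin_compose[OF lin_pair2(1) V.lin_ht_lact] O.lin_mult(2)[OF lin_pair2(1)] O.hv.vector_space_axioms _ g])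
  fix X Y assume X: "X \<in> carr (VF H C)" and "Y \<in> carr (VF H C)"
  have l: "lin (hsp H) (hscale H) (\<lambda>x. f * x)" by (intro O.lin_hopf)
  show "pair2 H C (ht_lact (VF H C) f (htens (VF H C) [X, Y])) t = f * pair2 H C (htens (VF H C) [X, Y]) t"
    unfolding V.ht_lact_htens pair2_htens lin_lsum_UNIV(1)[OF O.hv.vector_space_axioms l]
    using vpair_lact[of X f Y] X by (simp del: One_nat_def)
qed

lemma pair2_ract:
  assumes g: "g \<in> htpow (VF H C) 2" and t: "t \<in> htpow (Omega1 C) 2"
  shows "pair2 H C g (ht_ract (Omega1 C) t h) = pair2 H C g t * h"
proof (rule htpow2_eqI[where M = "VF H C" and t = g and f = "\<lambda>g. pair2 H C g (ht_ract (Omega1 C) t h)" and g = "\<lambda>g. pair2 H C g t * h",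
    OF lin_pair2(1) O.lin_mult(1)[OF lin_pair2(1)] O.hv.vector_space_axioms _ g])
  fix X Y assume "X \<in> carr (VF H C)" and "Y \<in> carr (VF H C)"
  then have X: "X \<in> vfields C" and Y: "Y \<in> vfields C" by simp_all
  show "pair2 H C (htens (VF H C) [X, Y]) (ht_ract (Omega1 C) t h) = pair2 H C (htens (VF H C) [X, Y]) t * h"
  proof (rule htpow2_eqI[where M = "Omega1 C" and t = t and f = "\<lambda>t. pair2 H C (htens (VF H C) [X, Y]) (ht_ract (Omega1 C) t h)"
        and g = "\<lambda>t. pair2 H C (htens (VF H C) [X, Y]) t * h",
      OF lin_compose[OF lin_pair2(2) O.lin_ht_ract] O.lin_mult(1)[OF lin_pair2(2)] O.hv.vector_space_axioms _ t])
    fix x y assume "x \<in> carr (Omega1 C)" "y \<in> carr (Omega1 C)"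
    then show "pair2 H C (htens (VF H C) [X, Y]) (ht_ract (Omega1 C) (htens (Omega1 C) [x, y]) h)
      = pair2 H C (htens (VF H C) [X, Y]) (htens (Omega1 C) [x, y]) * h"
      using vfieldsD(2)[OF vpair_closed[OF X], of y Y x h]
      by (simp add: O.ht_ract_htens pair2_htens lsum_vpair_htens[OF X Y] del: One_nat_def)
  qed
qed

lemma pair3_add: "pair3 H C g (t + u) = pair3 H C g t + pair3 H C g u"
  by (simp add: pair3_def lsum_add[OF vs_o[OF H C]])

lemma pair3_lact:
  assumes g: "g \<in> htpow (VF H C) 2"
  shows "pair3 H C (ht_lact (VF H C) f g) t = incl C f * pair3 H C g t"
proof -
  have l: "lin (oscale C, UNIV) (oscale C) (\<lambda>x. incl C f * x)" by (intro lin_omult[OF H C] lin_oid[OF H C])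
  show ?thesis
    unfolding pair3_def lin_lsum_UNIV(1)[OF vs_o[OF H C] l]
    by (simp add: pair2_lact[OF g] incl_mult[OF H C] mult.assoc)
qed

text \<open>The formulas behind \<open>osum\<close> and \<open>sym_proj12\<close> are linear
  extensions over formal sums, hence additive for arbitrary functions \<phi> and \<psi>. So the
  lemma covers the sum of a connection and a right linear map, although only the former obeys the
  Leibniz rule.\<close>

lemma vee_add: "vee H C (\<phi> + \<psi>) t = vee H C \<phi> t + vee H C \<psi> t"
proof -
  note vf = vector_space_fscale
  have conc: "hconc (Omega1 C) (u + v) w = hconc (Omega1 C) u w + hconc (Omega1 C) v w" for u v w
    by (simp add: hconc_def lsum_add vf)
  have at: "wor_at H (Omega1 C) i (u + v) = wor_at H (Omega1 C) i u + wor_at H (Omega1 C) i v" for i u v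
    by (simp add: wor_at_def lsum_add vf)
  have lco: "map_lcoact H C (\<phi> + \<psi>) m = map_lcoact H C \<phi> m + map_lcoact H C \<psi> m" for m
    by (simp add: map_lcoact_def ht2_lcoact_def lsum_add lsum_add_fun2 vf)
  have "osum H C (\<phi> + \<psi>) t = osum H C \<phi> t + osum H C \<psi> t"
    by (simp add: osum_def Let_def conc at lco lsum_add lsum_add_fun lsum_add_fun2 vf add_ac)
  then show ?thesis by (simp add: vee_def sym_proj12_def lsum_add vf)
qed

lemma Phi_zero: "Phi H C g 0 = 0"
proof
  fix t
  have "vee H C 0 t = 0" using vee_add[of 0 0 t] by simp
  then show "Phi H C g 0 t = 0 t" by (simp add: Phi_def pair3_def vs_o[OF H C])
qed

end

subsection \<open>Levi-Civita connections\<close>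

lemma woronowicz_bicovariant: "woronowicz_calculus H C \<Longrightarrow> bicovariant_calculus H C"
  by (simp add: woronowicz_calculus_def)

context
  fixes H :: "('k::field, 'h::ring_1) hopf" and C :: "('k, 'h, 'o::ring_1) calculus"
  assumes H: "hopf_algebra H" and b: "bij (antip H)" and W: "woronowicz_calculus H C" and fg: "fin_gen_right (Omega1 C)"
begin

lemmas C = woronowicz_bicovariant[OF W]

interpretation O: fin_gen_bimodule H "Omega1 C" by (rule fin_gen_bimodule_Omega1[OF H b C fg])

declare Omega1_simps[OF H C, simp]

lemma Hom_Omega_SymD:
  assumes "\<psi> \<in> Hom_Omega_Sym H C"
  shows "w \<in> grade C 1 \<Longrightarrow> \<psi> w \<in> sym2 H C" "w \<notin> grade C 1 \<Longrightarrow> \<psi> w = 0"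
    "w \<in> grade C 1 \<Longrightarrow> w' \<in> grade C 1 \<Longrightarrow> \<psi> (w + w') = \<psi> w + \<psi> w'"
    "w \<in> grade C 1 \<Longrightarrow> \<psi> (w * incl C a) = ht_ract (Omega1 C) (\<psi> w) a"
  using assms by (simp_all add: Hom_Omega_Sym_def right_hom_def)

lemma ht_ract_scale:
  assumes t: "t \<in> htpow (Omega1 C) 2"
  shows "ht_ract (Omega1 C) t (hscale H c 1) = fscale c t"
proof (rule htpow2_eqI[where M = "Omega1 C" and t = t and f = "\<lambda>t. ht_ract (Omega1 C) t (hscale H c 1)" and g = "fscale c",
    OF O.lin_ht_ract lin_smult[OF vector_space_fscale lin_id[OF vector_space_fscale]] vector_space_fscale _ t])
  fix x y assume "x \<in> carr (Omega1 C)" "y \<in> carr (Omega1 C)"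
  then show "ht_ract (Omega1 C) (htens (Omega1 C) [x, y]) (hscale H c 1) = fscale c (htens (Omega1 C) [x, y])"
    using htens_scale2[of x "Omega1 C" y c]
    by (simp add: O.ht_ract_htens incl_scale[OF H C] incl_one[OF H C] oscale_mult[OF H C])
qed

text \<open>A connection must be linear over the field, whereas \<open>right_hom\<close> asks for
  additivity and right linearity; the right action of \<open>hscale H c 1\<close> bridges the
  two.\<close>

lemma Hom_Omega_Sym_scale:
  assumes \<psi>: "\<psi> \<in> Hom_Omega_Sym H C" and w: "w \<in> grade C 1"
  shows "\<psi> (oscale C c w) = fscale c (\<psi> w)"
proof -
  have "\<psi> (oscale C c w) = \<psi> (w * incl C (hscale H c 1))"
    by (simp add: incl_scale[OF H C] incl_one[OF H C] oscale_mult[OF H C])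
  also have "\<dots> = fscale c (\<psi> w)"
    using Hom_Omega_SymD[OF \<psi>] w by (simp add: ht_ract_scale sym2_iff[OF H b C fg])
  finally show ?thesis .
qed

lemma right_connection_add:
  assumes D: "right_connection H C D" and \<psi>: "\<psi> \<in> Hom_Omega_Sym H C"
  shows "right_connection H C (D + \<psi>)"
proof -
  interpret f: vector_space "fscale :: 'k \<Rightarrow> ('o list \<Rightarrow>\<^sub>0 'k) \<Rightarrow> _" by (rule vector_space_fscale)
  note \<psi>D = Hom_Omega_SymD[OF \<psi>] Hom_Omega_Sym_scale[OF \<psi>]
  have "\<psi> w \<in> htpow (Omega1 C) 2" if "w \<in> grade C 1" for w
    using \<psi>D(1)[OF that] by (simp add: sym2_iff[OF H b C fg])
  then show ?thesis
    using D lin_add[OF O.lin_ht_ract] \<psi>D f.subspace_add[OF subspace_htpow[of "Omega1 C" 2]]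
    unfolding right_connection_def linear_map_def by (auto simp: f.scale_right_distrib algebra_simps)
qed

lemma wedge_add: "wedge C (t + u) = wedge C t + wedge C u"
  by (simp add: wedge_def lsum_add vs_o[OF H C])

lemma torsion_free_add:
  assumes D: "torsion_free C D" and \<psi>: "\<psi> \<in> Hom_Omega_Sym H C"
  shows "torsion_free C (D + \<psi>)"
proof -
  have "wedge C (\<psi> w) = 0" if "w \<in> grade C 1" for w
    using Hom_Omega_SymD(1)[OF \<psi> that] wedge_eq_0_iff[OF H b C fg W] by (simp add: sym2_iff[OF H b C fg])
  then show ?thesis using D by (simp add: torsion_free_def wedge_add)
qed

lemma torsion_free_diff:
  assumes D: "right_connection H C D" "torsion_free C D" and D': "right_connection H C D'" "torsion_free C D'"
  shows "D - D' \<in> Hom_Omega_Sym H C"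
proof -
  interpret f: vector_space "fscale :: 'k \<Rightarrow> ('o list \<Rightarrow>\<^sub>0 'k) \<Rightarrow> _" by (rule vector_space_fscale)
  have sym: "D w - D' w \<in> sym2 H C" if w: "w \<in> grade C 1" for w
  proof -
    have h: "D w - D' w \<in> htpow (Omega1 C) 2"
      using D(1) D'(1) w f.subspace_diff[OF subspace_htpow[of "Omega1 C" 2]]
      by (simp add: right_connection_def linear_map_def)
    have "wedge C (D w) = wedge C (D' w)"
      using D(2) D'(2) w by (metis add_right_cancel torsion_free_def)
    moreover have "wedge C (D w) = wedge C (D w - D' w) + wedge C (D' w)"
      by (simp flip: wedge_add)
    ultimately have "wedge C (D w - D' w) = 0" by simp
    then show ?thesis using wedge_eq_0_iff[OF H b C fg W h] by simp
  qed
  show ?thesis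
    using D(1) D'(1) sym lin_minus[OF O.lin_ht_ract]
    by (auto simp: Hom_Omega_Sym_def right_hom_def right_connection_def linear_map_def)
qed

lemma levi_civita_conformal:
  fixes f finv :: 'h
  assumes g: "metric H C g" and f: "f * finv = 1" "finv * f = 1"
    and bij: "bij_betw (Phi H C g) (Hom_Omega_Sym H C) (Hom_Sym_Omega H C)"
    and LC: "levi_civita H C g D"
  defines "g' \<equiv> ht_lact (VF H C) f g"
    and "D' \<equiv> D + inv_into (Hom_Omega_Sym H C) (Phi H C g)
           (\<lambda>t. if t \<in> sym2 H C
                then incl C finv * diff C (incl C f) * incl C (pair2 H C g t) else 0)"
  shows "levi_civita H C g' D' \<and> (\<forall>nabla. levi_civita H C g' nabla \<longrightarrow> nabla = D')"
proof -
  interpret s: vector_space "fscale :: 'k \<Rightarrow> ('o list \<Rightarrow>\<^sub>0 'k) \<Rightarrow> _" by (rule vector_space_fscale)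
  note all = H b C fg
  have g2: "g \<in> htpow (VF H C) 2" using g by (simp add: metric_def)
  \<comment> \<open>The value 0 off the symmetric tensors follows the convention of
    \<open>right_hom\<close>. The one-form stands on the left, so right linearity of the pairing is
    preserved.\<close>
  define \<theta> where "\<theta> t = (if t \<in> sym2 H C then incl C finv * diff C (incl C f) * incl C (pair2 H C g t) else 0)" for t
  have "\<theta> \<in> Hom_Sym_Omega H C"
  proof -
    have df: "diff C (incl C f) \<in> grade C 1" using diff_grade[OF H C incl_grade[OF H C], of f] by simp
    have "incl C finv * diff C (incl C f) * incl C a \<in> grade C 1" for a
      by (intro incl_mult_grade[OF H C] df)
    moreover have "t + u \<in> sym2 H C" if "t \<in> sym2 H C" "u \<in> sym2 H C" for t u
      using s.subspace_add[OF subspace_sym2[OF all]] that .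
    moreover have "pair2 H C g (t + u) = pair2 H C g t + pair2 H C g u" for t u
      using lin_add[OF lin_pair2(2)[OF all]] by simp
    moreover have "pair2 H C g (ht_ract (Omega1 C) t h) = pair2 H C g t * h" if "t \<in> sym2 H C" for t h
      using that pair2_ract[OF all g2] by (simp add: sym2_iff[OF all])
    ultimately show ?thesis
      using sym2_ract[OF all]
      by (auto simp: Hom_Sym_Omega_def right_hom_def \<theta>_def incl_add[OF H C] incl_mult[OF H C] distrib_left mult.assoc)
  qed
  define \<psi> where "\<psi> = inv_into (Hom_Omega_Sym H C) (Phi H C g) \<theta>"
  have D': "D' = D + \<psi>" unfolding D'_def \<psi>_def \<theta>_def ..
  have \<psi>: "\<psi> \<in> Hom_Omega_Sym H C" "Phi H C g \<psi> = \<theta>"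
    unfolding \<psi>_def using bij \<open>\<theta> \<in> _\<close>
    by (simp_all add: bij_betw_apply[OF bij_betw_inv_into] bij_betw_inv_into_right)
  have "metric_compatible H C g' D'"
    unfolding metric_compatible_def
  proof
    fix t assume t: "t \<in> sym2 H C"
    let ?p = "incl C (pair2 H C g t)"
    have ff: "incl C f * (incl C finv * x) = x" for x
      by (simp add: mult.assoc[symmetric] incl_mult[OF H C, symmetric] f incl_one[OF H C])
    have "pair3 H C g (vee H C D t) = diff C ?p"
      using LC t by (simp add: levi_civita_def metric_compatible_def)
    moreover have "pair3 H C g (vee H C \<psi> t) = incl C finv * diff C (incl C f) * ?p"
      using \<psi>(2) t by (auto simp: Phi_def \<theta>_def fun_eq_iff)
    ultimately have "pair3 H C g' (vee H C D' t) = incl C f * (diff C ?p + incl C finv * diff C (incl C f) * ?p)"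
      by (simp add: g'_def D' pair3_lact[OF all g2] vee_add[OF all] pair3_add[OF all] distrib_left)
    \<comment> \<open>\<open>f\<close> cancels \<open>finv\<close> in the second summand, leaving
      the two terms of the Leibniz rule for f times the pairing.\<close>
    also have "\<dots> = diff C (incl C f * ?p)"
      by (simp add: diff_incl_mult[OF H C] distrib_left mult.assoc ff)
    also have "\<dots> = diff C (incl C (pair2 H C g' t))"
      by (simp add: g'_def pair2_lact[OF all g2] incl_mult[OF H C])
    finally show "pair3 H C g' (vee H C D' t) = \<dots>" .
  qed
  then have LC': "levi_civita H C g' D'"
    using LC right_connection_add[OF _ \<psi>(1)] torsion_free_add[OF _ \<psi>(1)] by (simp add: levi_civita_def D')
  moreover have "E = D'" if E: "levi_civita H C g' E" for E
  proof -
    have d: "E - D' \<in> Hom_Omega_Sym H C"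
      using E LC' by (intro torsion_free_diff) (simp_all add: levi_civita_def)
    have "Phi H C g (E - D') t = 0" for t
    proof (cases "t \<in> sym2 H C")
      case True
      \<comment> \<open>Both connections have the same right-hand side in the compatibility
        condition, so the difference pairs to 0 with f g; multiplying by \<open>finv\<close> gives
        the same for \<open>g\<close>.\<close>
      have "pair3 H C g' (vee H C (D' + (E - D')) t) = pair3 H C g' (vee H C D' t)"
        using E LC' True by (simp add: levi_civita_def metric_compatible_def)
      then have "incl C f * pair3 H C g (vee H C (E - D') t) = 0"
        unfolding vee_add[OF all] pair3_add[OF all] by (simp add: g'_def pair3_lact[OF all g2])
      then have "incl C finv * (incl C f * pair3 H C g (vee H C (E - D') t)) = 0" by simp
      then show ?thesis
        by (simp add: mult.assoc[symmetric] incl_mult[OF H C, symmetric] f incl_one[OF H C] Phi_def)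
    next
      case False
      then show ?thesis by (simp add: Phi_def vee_def pair3_def vs_o[OF H C])
    qed
    then have "Phi H C g (E - D') = Phi H C g 0"
      by (simp add: fun_eq_iff Phi_zero[OF all])
    moreover have "0 \<in> Hom_Omega_Sym H C"
      using s.subspace_0[OF subspace_sym2[OF all]] lin_zero[OF vector_space_fscale vector_space_fscale O.lin_ht_ract]
      by (simp add: Hom_Omega_Sym_def right_hom_def)
    ultimately have "E - D' = 0"
      using bij d by (meson bij_betw_def inj_onD)
    then show ?thesis by simp
  qed
  ultimately show ?thesis by blast
qed

end

theorem theorem5p12:
  fixes H :: "('k::field, 'h::ring_1) hopf"
    and C :: "('k, 'h, 'o::ring_1) calculus"
    and g :: "('o \<Rightarrow> 'h) list \<Rightarrow>\<^sub>0 'k"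
    and f finv :: 'h
    and nablaLC :: "'o \<Rightarrow> ('o list \<Rightarrow>\<^sub>0 'k)"
  assumes "hopf_algebra H" and "bij (antip H)"
    and "woronowicz_calculus H C"
    and "fin_gen_right (Omega1 C)"
    and "braid_diagonalisable H C" and "braid_eigenvalue H C 1"
    and "metric H C g"
    and "f * finv = 1" and "finv * f = 1"
    and "bij_betw (Phi H C g) (Hom_Omega_Sym H C) (Hom_Sym_Omega H C)"
    and "levi_civita H C g nablaLC"
  defines "g' \<equiv> ht_lact (VF H C) f g"
    and "nabla' \<equiv> nablaLC + inv_into (Hom_Omega_Sym H C) (Phi H C g)
           (\<lambda>t. if t \<in> sym2 H C
                then incl C finv * diff C (incl C f) * incl C (pair2 H C g t) else 0)"
  shows "metric H C g' \<and> levi_civita H C g' nabla' \<and>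
         (\<forall>nabla. levi_civita H C g' nabla \<longrightarrow> nabla = nabla')"
  unfolding g'_def nabla'_def
  by (intro conjI metric_lact[OF assms(1,2) woronowicz_bicovariant[OF assms(3)] assms(4,7-9)]
      levi_civita_conformal[OF assms(1-4,7-11), THEN conjunct1] levi_civita_conformal[OF assms(1-4,7-11), THEN conjunct2])

end
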